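(* Let $n\ge 2$ and let $\mathbf c\in\mathcal Pol_n$ be such that $P(\mathbf c)$ is a maximal polytrope. Consider the "indeterminate polytrope" $P(\mathbf a)=\{\mathbf y\in\mathbb R^n\mid y_i-y_j\le a_{ij},\ y_n=0\}$ with fixed normal fan equal to that of $P(\mathbf c)$. Let $K=\mathbb Q(a_{ij}\mid i\neq j\in[n])$, $R=K[x_{ij}\mid i\ne j\in[n]]$, $$q=\sum_{i\neq j\in[n]}a_{ij}x_{ij}\in R,$$ and run the algorithm described in the context (for the type of $\mathbf c$) on the input $p=q^{n-1}$, with output $\delta/\gamma\in K$. Then $\delta/\gamma$ is the multivariate (normalized) volume polynomial of $P(\mathbf a)$ in the variables $a_{ij}$, i.e. $$\operatorname{Vol}_{P(\mathbf a)}(\mathbf a)=\frac{\delta}{\gamma}.$$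
   Context: Write $[n]=\{1,\dots,n\}$. A vector $\mathbf c=(c_{ij})_{i\neq j\in[n]}\in\mathbb R^{n^2-n}$ is regarded as an $n\times n$ matrix with zero diagonal, i.e. as edge weights on the complete directed graph on $[n]$. The polytrope region $\mathcal Pol_n\subset\mathbb R^{n^2-n}$ is the set of $\mathbf c$ such that the weighted graph has no negative cycle and $c_{ij}$ equals the lowest weight of a path from $i$ to $j$ for all $i\neq j$. For $\mathbf c\in\mathcal Pol_n$ the associated polytrope is $P(\mathbf c)=\{\mathbf y\in\mathbb R^n\mid y_i-y_j\le c_{ij}\ (i\ne j),\ y_n=0\}$, viewed in $\mathbb R^{n-1}$ by forgetting the last coordinate. It is maximal if it has dimension $n-1$ and $\binom{2n-2}{n-1}$ vertices; it is then a simple polytope. For $i\neq j$ let $F_{ij}$ be the facet of $P(\mathbf c)$ on which $y_i-y_j=c_{ij}$, and for a vertex $v$ of $P(\mathbf c)$ let $\mathcal I_v=\{ij\mid v\in F_{ij}\}$. The multivariate (normalized) volume polynomial $\operatorname{Vol}_{P(\mathbf a)}(\mathbf a)$ for the fixed normal fan is the polynomial in the $a_{ij}$ whose value at every $\mathbf c'\in\mathcal Pol_n$ for which $P(\mathbf c')$ is maximal with the same normal fan as $P(\mathbf c)$ equals the normalized volume $(n-1)!\operatorname{vol}(P(\mathbf c'))$, where $\operatorname{vol}$ is Euclidean volume in $\mathbb R^{n-1}$. Ideals in $R$: $I=\langle x_{ij}x_{ji}-1,\ x_{ij}x_{jk}-x_{ik}\mid i,j,k\in[n]\text{ pairwise distinct}\rangle$;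 $M=in_{\mathbf c}(I)$, the ideal generated by the initial forms of elements of $I$, the initial form of $f$ being the sum of the terms of $f$ whose exponent vector has maximal dot product with $\mathbf c$; and $L=\big\langle \sum_{j\neq k}x_{kj}-\sum_{j\neq k}x_{jk}\ \big|\ k\in[n]\big\rangle$. The ideal $M$ is the Stanley–Reisner ideal of the normal fan of $P(\mathbf c)$, and its minimal primes are the ideals $\langle x_{ij}\mid ij\notin\mathcal I_v\rangle$ for $v$ a vertex of $P(\mathbf c)$. Algorithm, with input a polynomial $p\in R$: (1) Compute a Gröbner basis $\mathcal G$ of $M+L$. (2) Find a minimal prime $\langle x_{ij}\mid ij\notin\mathcal I_v\rangle$ of $M$ and compute the normal form of $\prod_{ij\in\mathcal I_v}x_{ij}$ modulo $\mathcal G$; it has the form $\gamma\cdot\mathbf x^{\boldsymbol\alpha}$, where $\gamma\in K$ is nonzero and $\mathbf x^{\boldsymbol\alpha}$ is the unique standard monomial of degree $n-1$. (3) Compute the normal form of $p$ modulo $\mathcal G$ and let $\delta\in K$ be the coefficient of $\mathbf x^{\boldsymbol\alpha}$ in it. (4) Output $\delta/\gamma$. *)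

theory Defs
  imports
    "HOL-Analysis.Analysis"
    "HOL-Library.Poly_Mapping"
    "HOL-Library.Set_Algebras"
    "HOL-Computational_Algebra.Fraction_Field"
    "Graph_Theory.Shortest_Path"
begin

section \<open>The complete directed graph\<close>

text \<open>
  The index set \<open>[n]\<close> is \<^typ>\<open>'n option\<close> for a finite type \<open>'n\<close>, where \<^term>\<open>None\<close>
  plays the role of the last index \<open>n\<close>. Hence \<open>n - 1\<close> is \<open>CARD('n)\<close>, the condition
  \<open>n \<ge> 2\<close> is automatic, and \<open>\<real>\<^bsup>n-1\<^esup>\<close> is \<open>real ^ 'n\<close>.
  The type \<open>'n edge\<close> consists of the pairs \<open>(i, j)\<close> with \<open>i \<noteq> j\<close>, so \<open>\<real>\<^bsup>n\<^sup>2-n\<^esup>\<close>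
  is \<open>real ^ 'n edge\<close>.
\<close>

typedef 'n edge = "{ij :: 'n option \<times> 'n option. fst ij \<noteq> snd ij}"
  morphisms ends Edge
  by (rule exI[of _ "(None, Some undefined)"]) simp

definition src :: "'n edge \<Rightarrow> 'n option" where
  "src e = fst (ends e)"

definition tgt :: "'n edge \<Rightarrow> 'n option" where
  "tgt e = snd (ends e)"

instance edge :: (finite) finite
proof
  have "inj (ends :: 'a edge \<Rightarrow> _)"
    by (simp add: ends_inject inj_on_def)
  then show "finite (UNIV :: 'a edge set)"
    by (rule inj_on_finite[OF _ subset_UNIV finite])
qed

text \<open>
  The library shows that a polynomial ring over an integral domain is an integral domain
  only for linearly ordered indeterminates. The fraction field below needs that
  instance, so the edges get an arbitrary linear order; nothing else depends on it.
\<close>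

definition edge_index :: "'n::finite edge \<Rightarrow> nat" where
  "edge_index = (SOME f. inj f)"

lemma inj_edge_index: "inj (edge_index :: 'n::finite edge \<Rightarrow> nat)"
proof -
  obtain f :: "'n edge \<Rightarrow> nat" where "inj f"
    using finite_imp_inj_to_nat_seg[OF finite_class.finite_UNIV] by blast
  then show ?thesis
    unfolding edge_index_def by (rule someI[where P = inj])
qed

instantiation edge :: (finite) linorder
begin

definition less_eq_edge :: "'a edge \<Rightarrow> 'a edge \<Rightarrow> bool" where
  "less_eq_edge d e \<longleftrightarrow> edge_index d \<le> edge_index e"

definition less_edge :: "'a edge \<Rightarrow> 'a edge \<Rightarrow> bool" where
  "less_edge d e \<longleftrightarrow> edge_index d < edge_index e"

instance
  by standard (auto simp: less_eq_edge_def less_edge_def dest: injD[OF inj_edge_index])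

end

definition complete_digraph :: "('n option, 'n edge) pre_digraph" where
  "complete_digraph = \<lparr>verts = UNIV, arcs = UNIV, tail = src, head = tgt\<rparr>"


section \<open>Polytropes\<close>

text \<open>
  The constant \<^const>\<open>wf_digraph.\<mu>\<close> is the infimum of the weights of all walks. In the absence
  of negative cycles it is the lowest weight of a path.
\<close>

definition polytrope_region :: "(real ^ 'n::finite edge) set" where
  "polytrope_region = {c.
     (\<forall>p. pre_digraph.cycle complete_digraph p \<longrightarrow> 0 \<le> wf_digraph.awalk_cost (($) c) p) \<and>
     (\<forall>e. ereal (c $ e) = wf_digraph.\<mu> complete_digraph (($) c) (src e) (tgt e))}"

text \<open>
  A point \<open>v\<close> of \<open>\<real>\<^bsup>n-1\<^esup>\<close> stands for the point \<open>y\<close> of \<open>\<real>\<^sup>n\<close> with \<open>y\<^sub>n = 0\<close> and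
  the remaining coordinates those of \<open>v\<close>.
\<close>

definition coord :: "real ^ 'n::finite \<Rightarrow> 'n option \<Rightarrow> real" where
  "coord v i = (case i of None \<Rightarrow> 0 | Some k \<Rightarrow> v $ k)"

definition polytrope :: "real ^ 'n::finite edge \<Rightarrow> (real ^ 'n) set" where
  "polytrope c = {v. \<forall>e. coord v (src e) - coord v (tgt e) \<le> c $ e}"

definition maximal_polytrope :: "real ^ 'n::finite edge \<Rightarrow> bool" where
  "maximal_polytrope c \<longleftrightarrow>
     aff_dim (polytrope c) = int CARD('n) \<and>
     card {v. v extreme_point_of polytrope c} = (2 * CARD('n)) choose CARD('n)"

definition polytrope_facet :: "real ^ 'n::finite edge \<Rightarrow> 'n edge \<Rightarrow> (real ^ 'n) set" where
  "polytrope_facet c e = {v \<in> polytrope c. coord v (src e) - coord v (tgt e) = c $ e}"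

definition incident_facets :: "real ^ 'n::finite edge \<Rightarrow> real ^ 'n \<Rightarrow> 'n edge set" where
  "incident_facets c v = {e. v \<in> polytrope_facet c e}"

definition normal_cone :: "'a::real_inner set \<Rightarrow> 'a set \<Rightarrow> 'a set" where
  "normal_cone P F = {w. \<forall>x\<in>F. \<forall>y\<in>P. w \<bullet> y \<le> w \<bullet> x}"

definition normal_fan :: "'a::real_inner set \<Rightarrow> 'a set set" where
  "normal_fan P = {normal_cone P F | F. F face_of P \<and> F \<noteq> {}}"


section \<open>Polynomial rings, ideals and Groebner bases\<close>

text \<open>
  Polynomials with coefficients in \<open>'k\<close> are finitely supported maps from monomials to \<open>'k\<close>,
  with the convolution product of \<^theory>\<open>HOL-Library.Poly_Mapping\<close>; a monomial is
  identified with its exponent vector, and the product of monomials is \<^term>\<open>(+)\<close>.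
\<close>

type_synonym 'n monomial = "'n edge \<Rightarrow>\<^sub>0 nat"
type_synonym 'n weight_poly = "'n monomial \<Rightarrow>\<^sub>0 rat"
type_synonym 'n weight_field = "'n weight_poly fract"
type_synonym 'n ring = "'n monomial \<Rightarrow>\<^sub>0 'n weight_field"

definition x_var :: "'n edge \<Rightarrow> ('n monomial \<Rightarrow>\<^sub>0 'k::{zero,one})" where
  "x_var e = Poly_Mapping.single (Poly_Mapping.single e 1) 1"

definition a_var :: "'n::finite edge \<Rightarrow> 'n weight_field" where
  "a_var e = Fract (x_var e) 1"

definition weight_poly_eval :: "'n::finite weight_poly \<Rightarrow> real ^ 'n edge \<Rightarrow> real" where
  "weight_poly_eval V c =
     (\<Sum>m\<in>Poly_Mapping.keys V. of_rat (Poly_Mapping.lookup V m) *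
        (\<Prod>e\<in>UNIV. (c $ e) ^ Poly_Mapping.lookup m e))"

text \<open>Ideals of a commutative ring are its submodules as a module over itself.\<close>

abbreviation ideal_of :: "'a::comm_ring_1 set \<Rightarrow> 'a set" where
  "ideal_of \<equiv> module.span (*)"

definition prime_ideal :: "'a::comm_ring_1 set \<Rightarrow> bool" where
  "prime_ideal Q \<longleftrightarrow>
     module.subspace (*) Q \<and> 1 \<notin> Q \<and> (\<forall>f g. f * g \<in> Q \<longrightarrow> f \<in> Q \<or> g \<in> Q)"

definition minimal_prime_of :: "'a::comm_ring_1 set \<Rightarrow> 'a set \<Rightarrow> bool" where
  "minimal_prime_of J Q \<longleftrightarrow>
     prime_ideal Q \<and> J \<subseteq> Q \<and> (\<forall>Q'. prime_ideal Q' \<and> J \<subseteq> Q' \<and> Q' \<subseteq> Q \<longrightarrow> Q' = Q)"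

definition total_degree :: "'n::finite monomial \<Rightarrow> nat" where
  "total_degree m = (\<Sum>e\<in>UNIV. Poly_Mapping.lookup m e)"

definition monomial_order :: "('n monomial \<Rightarrow> 'n monomial \<Rightarrow> bool) \<Rightarrow> bool" where
  "monomial_order le \<longleftrightarrow>
     class.linorder le (\<lambda>s t. le s t \<and> s \<noteq> t) \<and>
     (\<forall>s. le 0 s) \<and> (\<forall>s t u. le s t \<longrightarrow> le (s + u) (t + u))"

text \<open>The leading monomial is unspecified for \<open>f = 0\<close>, but the leading term of \<open>0\<close> is \<open>0\<close>.\<close>

definition leading_monomial ::
    "('n monomial \<Rightarrow> 'n monomial \<Rightarrow> bool) \<Rightarrow> ('n monomial \<Rightarrow>\<^sub>0 'k::field) \<Rightarrow> 'n monomial" where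
  "leading_monomial le f =
     (THE m. m \<in> Poly_Mapping.keys f \<and> (\<forall>m'\<in>Poly_Mapping.keys f. le m' m))"

definition leading_coeff ::
    "('n monomial \<Rightarrow> 'n monomial \<Rightarrow> bool) \<Rightarrow> ('n monomial \<Rightarrow>\<^sub>0 'k::field) \<Rightarrow> 'k" where
  "leading_coeff le f = Poly_Mapping.lookup f (leading_monomial le f)"

definition leading_term ::
    "('n monomial \<Rightarrow> 'n monomial \<Rightarrow> bool) \<Rightarrow> ('n monomial \<Rightarrow>\<^sub>0 'k::field) \<Rightarrow> ('n monomial \<Rightarrow>\<^sub>0 'k)"
  where
  "leading_term le f = Poly_Mapping.single (leading_monomial le f) (leading_coeff le f)"

definition leading_ideal ::
    "('n monomial \<Rightarrow> 'n monomial \<Rightarrow> bool) \<Rightarrow> ('n monomial \<Rightarrow>\<^sub>0 'k::field) set \<Rightarrow>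
      ('n monomial \<Rightarrow>\<^sub>0 'k) set" where
  "leading_ideal le J = ideal_of (leading_term le ` J)"

definition groebner_basis ::
    "('n monomial \<Rightarrow> 'n monomial \<Rightarrow> bool) \<Rightarrow> ('n monomial \<Rightarrow>\<^sub>0 'k::field) set \<Rightarrow>
      ('n monomial \<Rightarrow>\<^sub>0 'k) set \<Rightarrow> bool" where
  "groebner_basis le J G \<longleftrightarrow> finite G \<and> G \<subseteq> J \<and> leading_ideal le G = leading_ideal le J"

definition standard_monomial ::
    "('n monomial \<Rightarrow> 'n monomial \<Rightarrow> bool) \<Rightarrow> ('n monomial \<Rightarrow>\<^sub>0 'k::field) set \<Rightarrow>
      'n monomial \<Rightarrow> bool" where
  "standard_monomial le J m \<longleftrightarrow> Poly_Mapping.single m 1 \<notin> leading_ideal le J"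

text \<open>
  One step of the division algorithm: subtract a multiple of some \<open>g \<in> G\<close> in order to cancel
  a term of \<open>f\<close> that is divisible by the leading term of \<open>g\<close>. A normal form of \<open>f\<close> is an
  irreducible polynomial reached from \<open>f\<close>.
\<close>

definition reduces_to ::
    "('n monomial \<Rightarrow> 'n monomial \<Rightarrow> bool) \<Rightarrow> ('n monomial \<Rightarrow>\<^sub>0 'k::field) set \<Rightarrow>
      ('n monomial \<Rightarrow>\<^sub>0 'k) \<Rightarrow> ('n monomial \<Rightarrow>\<^sub>0 'k) \<Rightarrow> bool" where
  "reduces_to le G f h \<longleftrightarrow>
     (\<exists>g\<in>G. \<exists>s. g \<noteq> 0 \<and> s + leading_monomial le g \<in> Poly_Mapping.keys f \<and>
        h = f - Poly_Mapping.single s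
                  (Poly_Mapping.lookup f (s + leading_monomial le g) / leading_coeff le g) * g)"

definition normal_form ::
    "('n monomial \<Rightarrow> 'n monomial \<Rightarrow> bool) \<Rightarrow> ('n monomial \<Rightarrow>\<^sub>0 'k::field) set \<Rightarrow>
      ('n monomial \<Rightarrow>\<^sub>0 'k) \<Rightarrow> ('n monomial \<Rightarrow>\<^sub>0 'k) \<Rightarrow> bool" where
  "normal_form le G f r \<longleftrightarrow> (reduces_to le G)\<^sup>*\<^sup>* f r \<and> \<not> (\<exists>h. reduces_to le G r h)"


section \<open>The ideals attached to a polytrope\<close>

definition I_ideal :: "'n::finite ring set" where
  "I_ideal = ideal_of
     ({x_var (Edge (i, j)) * x_var (Edge (j, i)) - 1 | i j. i \<noteq> j} \<union>
      {x_var (Edge (i, j)) * x_var (Edge (j, k)) - x_var (Edge (i, k)) | i j k.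
         i \<noteq> j \<and> j \<noteq> k \<and> i \<noteq> k})"

definition weight :: "real ^ 'n::finite edge \<Rightarrow> 'n monomial \<Rightarrow> real" where
  "weight c m = (\<Sum>e\<in>UNIV. c $ e * real (Poly_Mapping.lookup m e))"

definition initial_form ::
    "real ^ 'n::finite edge \<Rightarrow> ('n monomial \<Rightarrow>\<^sub>0 'k::comm_monoid_add) \<Rightarrow> ('n monomial \<Rightarrow>\<^sub>0 'k)" where
  "initial_form c f =
     (\<Sum>m | m \<in> Poly_Mapping.keys f \<and> (\<forall>m'\<in>Poly_Mapping.keys f. weight c m' \<le> weight c m).
        Poly_Mapping.single m (Poly_Mapping.lookup f m))"

definition M_ideal :: "real ^ 'n::finite edge \<Rightarrow> 'n ring set" where
  "M_ideal c = ideal_of (initial_form c ` I_ideal)"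

definition L_ideal :: "'n::finite ring set" where
  "L_ideal = ideal_of (range (\<lambda>k. (\<Sum>e | src e = k. x_var e) - (\<Sum>e | tgt e = k. x_var e)))"


section \<open>The algorithm and the volume polynomial\<close>

text \<open>
  The algorithm, on input \<open>p\<close> and with the choices of the monomial order \<open>le\<close>, the Groebner
  basis \<open>G\<close> and the vertex \<open>v\<close> made explicit, returns the output \<open>d\<close>.
  The sum of the two ideals is the elementwise sum of sets.
\<close>

definition algorithm_output ::
    "real ^ 'n::finite edge \<Rightarrow> ('n monomial \<Rightarrow> 'n monomial \<Rightarrow> bool) \<Rightarrow> 'n ring set \<Rightarrow>
      real ^ 'n \<Rightarrow> 'n ring \<Rightarrow> 'n weight_field \<Rightarrow> bool" where
  "algorithm_output c le G v p d \<longleftrightarrow>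
     groebner_basis le (M_ideal c + L_ideal) G \<and>
     v extreme_point_of polytrope c \<and>
     minimal_prime_of (M_ideal c) (ideal_of (x_var ` (- incident_facets c v))) \<and>
     (\<exists>\<alpha> \<gamma> r \<delta>.
        (\<forall>m. standard_monomial le (M_ideal c + L_ideal) m \<and> total_degree m = CARD('n)
              \<longleftrightarrow> m = \<alpha>) \<and>
        \<gamma> \<noteq> 0 \<and>
        normal_form le G (\<Prod>e\<in>incident_facets c v. x_var e) (Poly_Mapping.single \<alpha> \<gamma>) \<and>
        normal_form le G p r \<and>
        \<delta> = Poly_Mapping.lookup r \<alpha> \<and>
        d = \<delta> / \<gamma>)"

definition q_poly :: "'n::finite ring" where
  "q_poly = (\<Sum>e\<in>UNIV. Poly_Mapping.single 0 (a_var e) * x_var e)"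

definition is_volume_polynomial :: "real ^ 'n::finite edge \<Rightarrow> 'n weight_poly \<Rightarrow> bool" where
  "is_volume_polynomial c V \<longleftrightarrow>
     (\<forall>c'\<in>polytrope_region.
        maximal_polytrope c' \<and> normal_fan (polytrope c') = normal_fan (polytrope c) \<longrightarrow>
        weight_poly_eval V c' = fact CARD('n) * measure lborel (polytrope c'))"

definition volume_polynomial :: "real ^ 'n::finite edge \<Rightarrow> 'n weight_poly" where
  "volume_polynomial c = (THE V. is_volume_polynomial c V)"

end

theory Submission
  imports Defs
begin

text \<open>
  The vertices of a polytrope have pairwise different outdegree vectors of tight spanning
  trees; there are only \<open>(2n - 2) choose (n - 1)\<close> such vectors, so a maximal polytrope is simple,
  every vertex \<open>v\<close> comes with a unimodular basis of edge vectors, and neighbouring vertices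
  differ by one exchange. Fix a generic direction \<open>\<xi>\<close> and let \<open>\<xi>\<^sub>v\<close> be its coordinates
  with respect to the basis at \<open>v\<close>, extended by zero. Decomposing the polytrope into signed
  cones gives Lawrence's formula: the normalized volume is
  \<open>\<Sum>\<^sub>v (c \<bullet> \<xi>\<^sub>v)\<^sup>n\<^sup>-\<^sup>1 / \<Prod> \<xi>\<^sub>v\<close>. Hence the functional
  \<open>f \<mapsto> \<Sum>\<^sub>v f(\<xi>\<^sub>v) / \<Prod> \<xi>\<^sub>v\<close> on forms of degree \<open>n - 1\<close> sends \<open>q\<^sup>n\<^sup>-\<^sup>1\<close> to the
  volume polynomial and every vertex monomial to \<open>1\<close>. It kills \<open>M\<close>, which by linear
  programming duality is spanned by the monomials not supported at a vertex, and it kills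
  \<open>L\<close>, because the corresponding sums in degree \<open>n - 2\<close> vanish by translation invariance of the
  volume. As \<open>R / (M + L)\<close> is one-dimensional in degree \<open>n - 1\<close>, the functional divides the
  coefficients \<open>\<delta>\<close> and \<open>\<gamma>\<close> of the normal forms.
\<close>

section \<open>Edge vectors\<close>

text \<open>Two obstacles shape the proof. Volumes are real numbers, whereas the algorithm computes
  over a field of rational functions. The bridge is a direction \<open>\<xi>\<close> with rational
  coordinates: all dual bases are integral, so the functional takes rational values on monomials and
  can be read over the weight field by way of constants. Integrality of the dual bases also removes
  every determinant from Lawrence's formula. The second obstacle is that volumes are known only at
  real weights with the given fan, while coefficients are wanted. A neighbourhood of
  \<open>c\<close> has the same vertex bases: nearby weights keep all old vertices, and the bound on
  the number of vertices leaves no room for new ones. Polynomial identities there can be compared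
  coefficientwise. Finally, the functional also makes the algorithm succeed: it is 1 on the vertex
  monomial, so \<open>R / (M + L)\<close> is not zero in degree \<open>n - 1\<close>, and gradedness
  of \<open>M + L\<close> gives the normal form of that monomial its expected shape for every
  monomial order.\<close>

definition vertex_vec :: "'n::finite option \<Rightarrow> real ^ 'n" where
  "vertex_vec i = (\<chi> k. of_bool (i = Some k))"

definition edge_vec :: "'n::finite edge \<Rightarrow> real ^ 'n" where
  "edge_vec e = vertex_vec (src e) - vertex_vec (tgt e)"

definition rev_edge :: "'n edge \<Rightarrow> 'n edge" where
  "rev_edge e = Edge (tgt e, src e)"

lemma src_neq_tgt [simp]: "src e \<noteq> tgt e" "tgt e \<noteq> src e"
  using ends[of e] by (auto simp: src_def tgt_def)

lemma src_Edge [simp]: "i \<noteq> j \<Longrightarrow> src (Edge (i, j)) = i"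
  and tgt_Edge [simp]: "i \<noteq> j \<Longrightarrow> tgt (Edge (i, j)) = j"
  by (simp_all add: src_def tgt_def Edge_inverse)

lemma edge_eqI: "src e = src f \<Longrightarrow> tgt e = tgt f \<Longrightarrow> e = f"
  by (metis ends_inject prod_eq_iff src_def tgt_def)

lemma Edge_src_tgt [simp]: "Edge (src e, tgt e) = e"
  by (simp add: edge_eqI)

lemma src_rev_edge [simp]: "src (rev_edge e) = tgt e"
  and tgt_rev_edge [simp]: "tgt (rev_edge e) = src e"
  by (simp_all add: rev_edge_def)

lemma inner_vertex_vec: "vertex_vec i \<bullet> v = coord v i"
  by (cases i) (auto simp: vertex_vec_def coord_def inner_vec_def of_bool_def if_distrib[of "\<lambda>x. x * _"] cong: if_cong)

lemma inner_edge_vec: "edge_vec e \<bullet> v = coord v (src e) - coord v (tgt e)"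
  by (simp add: edge_vec_def inner_diff_left inner_vertex_vec)

lemma coord_None [simp]: "coord v None = 0" and coord_Some [simp]: "coord v (Some k) = v $ k"
  by (simp_all add: coord_def)

lemma edge_vec_rev [simp]: "edge_vec (rev_edge e) = - edge_vec e"
  by (simp add: edge_vec_def)

lemma inj_edge_vec: "inj (edge_vec :: 'n::finite edge \<Rightarrow> _)"
proof (rule injI)
  fix e f :: "'n edge"
  assume "edge_vec e = edge_vec f"
  then have eq: "of_bool (src e = Some k) - of_bool (tgt e = Some k)
    = (of_bool (src f = Some k) - of_bool (tgt f = Some k) :: real)" for k
    by (simp add: edge_vec_def vertex_vec_def vec_eq_iff)
  have s: "src e = Some k \<longleftrightarrow> src f = Some k" and t: "tgt e = Some k \<longleftrightarrow> tgt f = Some k" for k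
    using eq[of k] src_neq_tgt(1)[of e] src_neq_tgt(1)[of f] unfolding of_bool_def
    by (auto split: if_splits simp del: src_neq_tgt)
  show "e = f"
    by (rule edge_eqI) (metis s not_Some_eq, metis t not_Some_eq)
qed

lemma edge_vec_nonzero [simp]: "edge_vec e \<noteq> 0"
  using inj_edge_vec edge_vec_rev[of e] by (metis injD minus_zero src_rev_edge src_neq_tgt(1))

text \<open>Pairing with an edge vector tests whether the edge starts or ends at \<open>j\<close>.
  For \<open>None\<close>, where there is no coordinate, the indicator of the node is shifted by the
  constant -1, which differences along edges do not see.\<close>

definition node_vec :: "'n::finite option \<Rightarrow> real ^ 'n" where
  "node_vec j = (if j = None then (\<chi> k. -1) else vertex_vec j)"

lemma edge_vec_inner_node_vec:
  "edge_vec e \<bullet> node_vec j = of_bool (src e = j) - of_bool (tgt e = j)"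
  using src_neq_tgt(1)[of e]
  by (cases j; cases "src e"; cases "tgt e")
    (auto simp: inner_edge_vec node_vec_def vertex_vec_def of_bool_def simp del: src_neq_tgt)

lemma span_inner_eqI:
  assumes "span (edge_vec ` B) = UNIV" "\<And>e. e \<in> B \<Longrightarrow> edge_vec e \<bullet> x = edge_vec e \<bullet> y"
  shows "x = y"
proof -
  have "z \<bullet> (x - y) = 0" if "z \<in> span (edge_vec ` B)" for z
    using that
  proof (induction rule: span_induct)
    case base
    show ?case by (auto simp: subspace_def inner_add_left)
  next
    case (step z)
    then show ?case using assms(2) by (auto simp: inner_diff_right)
  qed
  \<comment> \<open>Spanning puts \<open>x - y\<close> itself among the \<open>z\<close>, so it is
    orthogonal to itself.\<close>
  from this[of "x - y"] show ?thesis using assms(1) by simp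
qed

section \<open>Edge bases\<close>

definition edge_basis :: "'n::finite edge set \<Rightarrow> bool" where
  "edge_basis B \<longleftrightarrow> card B = CARD('n) \<and> span (edge_vec ` B) = UNIV"

text \<open>At a simple vertex with tight edges \<open>B\<close>, the vector
  \<open>- dual_vec B e\<close> is the direction of the polytrope edge along which only the
  constraint \<open>e\<close> becomes slack.\<close>

definition dual_vec :: "'n::finite edge set \<Rightarrow> 'n edge \<Rightarrow> real ^ 'n" where
  "dual_vec B e = (SOME d. \<forall>f\<in>B. edge_vec f \<bullet> d = of_bool (f = e))"

lemma edge_basis_independent:
  fixes B :: "'n::finite edge set"
  assumes "edge_basis B" shows "independent (edge_vec ` B)"
  using assms unfolding edge_basis_def
  by (intro card_le_dim_spanning[of _ UNIV])
    (auto simp: card_image[OF inj_on_subset[OF inj_edge_vec]])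

lemma inner_dual_vec:
  assumes "edge_basis B" "e \<in> B" "f \<in> B"
  shows "edge_vec f \<bullet> dual_vec B e = of_bool (f = e)"
proof -
  obtain g where g: "linear g" "\<And>x. x \<in> edge_vec ` B \<Longrightarrow> g x = (of_bool (x = edge_vec e) :: real)"
    using linear_independent_extend[OF edge_basis_independent[OF assms(1)], of "\<lambda>x. of_bool (x = edge_vec e)"]
    by auto
  have "edge_vec f \<bullet> adjoint g 1 = of_bool (f = e)" if "f \<in> B" for f
    using adjoint_works[OF g(1), of "edge_vec f" 1] g(2)[of "edge_vec f"] that inj_edge_vec
    by (auto dest: injD)
  then have "\<exists>d. \<forall>f\<in>B. edge_vec f \<bullet> d = of_bool (f = e)" by blast
  from someI_ex[OF this] show ?thesis
    using assms by (simp add: dual_vec_def)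
qed

lemma dual_vec_expand:
  assumes "edge_basis B"
  shows "(\<Sum>e\<in>B. (edge_vec e \<bullet> x) *\<^sub>R dual_vec B e) = x"
proof (rule span_inner_eqI[of B])
  fix f assume "f \<in> B"
  then show "edge_vec f \<bullet> (\<Sum>e\<in>B. (edge_vec e \<bullet> x) *\<^sub>R dual_vec B e) = edge_vec f \<bullet> x"
    using assms by (simp add: inner_sum_right inner_dual_vec of_bool_def if_distrib cong: if_cong)
qed (use assms in \<open>simp add: edge_basis_def\<close>)

lemma edge_vec_expand:
  assumes "edge_basis B"
  shows "(\<Sum>e\<in>B. (w \<bullet> dual_vec B e) *\<^sub>R edge_vec e) = w"
proof -
  have "(\<Sum>e\<in>B. (w \<bullet> dual_vec B e) *\<^sub>R edge_vec e) \<bullet> x = w \<bullet> x" for x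
    by (subst (2) dual_vec_expand[OF assms, of x, symmetric])
      (simp add: inner_sum_left inner_sum_right mult.commute)
  then show ?thesis by (metis vector_eq_rdot)
qed

lemma inner_expand:
  assumes "edge_basis B"
  shows "w \<bullet> x = (\<Sum>e\<in>B. (w \<bullet> dual_vec B e) * (edge_vec e \<bullet> x))"
  by (subst edge_vec_expand[OF assms, of w, symmetric]) (simp add: inner_sum_left)

text \<open>The vertices at which the dual vector is integral form a union of components of the graph \<open>B\<close>.\<close>

lemma coord_dual_vec_Ints:
  assumes "edge_basis B" "e \<in> B"
  shows "coord (dual_vec B e) i \<in> \<int>"
proof -
  define d where "d = dual_vec B e"
  \<comment> \<open>The indicator of the nodes at which \<open>d\<close> is not integral. The node
    \<open>None\<close> has coordinate 0 and counts as integral, in agreement with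
    \<open>coord y None = 0\<close>.\<close>
  define y :: "real ^ 'a" where "y = (\<chi> k. of_bool (coord d (Some k) \<notin> \<int>))"
  have cy: "coord y i = of_bool (coord d i \<notin> \<int>)" for i
    by (cases i) (auto simp: y_def)
  have "y = 0"
  proof (rule span_inner_eqI[of B])
    fix f assume "f \<in> B"
    then have "coord d (src f) - coord d (tgt f) \<in> \<int>"
      using inner_dual_vec[OF assms, of f] by (simp add: inner_edge_vec d_def of_bool_def)
    then have "coord d (src f) \<in> \<int> \<longleftrightarrow> coord d (tgt f) \<in> \<int>"
      by (metis Ints_diff Ints_add diff_add_cancel add_diff_cancel_left' add.commute uminus_add_conv_diff)
    then show "edge_vec f \<bullet> y = edge_vec f \<bullet> 0"
      by (simp add: inner_edge_vec cy)
  qed (use assms in \<open>simp add: edge_basis_def\<close>)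
  then have "coord y i = 0" by (cases i) auto
  then show ?thesis using cy[of i] by (auto simp: d_def)
qed

lemma edge_vec_inner_dual_Ints:
  assumes "edge_basis B" "e \<in> B" shows "edge_vec f \<bullet> dual_vec B e \<in> \<int>"
  using coord_dual_vec_Ints[OF assms] by (simp add: inner_edge_vec)

section \<open>Polytropes and their extreme points\<close>

lemma mem_polytrope: "v \<in> polytrope c \<longleftrightarrow> (\<forall>e. edge_vec e \<bullet> v \<le> c $ e)"
  by (simp add: polytrope_def inner_edge_vec)

lemma mem_incident_facets:
  "e \<in> incident_facets c v \<longleftrightarrow> v \<in> polytrope c \<and> edge_vec e \<bullet> v = c $ e"
  by (simp add: incident_facets_def polytrope_facet_def inner_edge_vec)

lemma polytrope_eq: "polytrope c = (\<Inter>e. {v. edge_vec e \<bullet> v \<le> c $ e})"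
  by (auto simp: mem_polytrope)

lemma polyhedron_polytrope: "polyhedron (polytrope c)"
  unfolding polytrope_eq by (intro polyhedron_Inter) (auto intro: polyhedron_halfspace_le)

lemma convex_polytrope: "convex (polytrope c)"
  by (simp add: polyhedron_imp_convex polyhedron_polytrope)

lemma bounded_polytrope: "bounded (polytrope c)"
proof -
  define b where "b k = (\<bar>c $ Edge (Some k, None)\<bar> + \<bar>c $ Edge (None, Some k)\<bar>)" for k
  have "\<bar>v $ k\<bar> \<le> b k" if "v \<in> polytrope c" for v k
    using that[unfolded mem_polytrope, rule_format, of "Edge (Some k, None)"]
      that[unfolded mem_polytrope, rule_format, of "Edge (None, Some k)"]
    by (auto simp: inner_edge_vec b_def)
  then have "norm v \<le> (\<Sum>k\<in>UNIV. b k)" if "v \<in> polytrope c" for v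
    using that norm_le_l1_cart[of v] by (meson order.trans sum_mono)
  then show ?thesis by (auto simp: bounded_iff)
qed

lemma compact_polytrope: "compact (polytrope c)"
  by (simp add: bounded_polytrope compact_eq_bounded_closed polyhedron_imp_closed polyhedron_polytrope)

lemma polytope_polytrope: "polytope (polytrope c)"
  by (simp add: polytope_eq_bounded_polyhedron bounded_polytrope polyhedron_polytrope)

text \<open>One step length that respects finitely many strict inequalities, for moving a little
  from a point without violating its slack constraints.\<close>

lemma finite_small_scale:
  fixes a b :: "'a \<Rightarrow> real"
  assumes "finite A" "\<And>x. x \<in> A \<Longrightarrow> b x > 0"
  shows "\<exists>\<epsilon>>0. \<forall>x\<in>A. \<epsilon> * a x < b x"
  using assms
proof (induction)
  case empty
  show ?case by (auto intro: exI[of _ 1])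
next
  case (insert x A)
  then obtain \<epsilon> where e: "\<epsilon> > 0" "\<forall>x\<in>A. \<epsilon> * a x < b x" by auto
  define \<delta> where "\<delta> = b x / (2 * (\<bar>a x\<bar> + 1))"
  have bx: "b x > 0" using insert by auto
  have d: "\<delta> > 0" unfolding \<delta>_def using bx by (simp add: add_nonneg_pos)
  have "\<delta> * a x \<le> \<delta> * (\<bar>a x\<bar> + 1)" using d by (intro mult_left_mono) auto
  also have "\<dots> = b x / 2" unfolding \<delta>_def by (simp add: field_simps)
  finally have dx: "\<delta> * a x < b x" using bx by simp
  have sc: "min \<epsilon> \<delta> * a y < b y" if "\<epsilon> * a y < b y \<or> \<delta> * a y < b y" "b y > 0" for y
  proof (cases "a y \<le> 0")
    case True
    then have "min \<epsilon> \<delta> * a y \<le> 0" using e d by (simp add: mult_nonneg_nonpos)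
    then show ?thesis using that by linarith
  next
    case False
    then have "min \<epsilon> \<delta> * a y \<le> \<epsilon> * a y" "min \<epsilon> \<delta> * a y \<le> \<delta> * a y"
      by (auto intro!: mult_right_mono)
    then show ?thesis using that by linarith
  qed
  show ?case
    by (rule exI[of _ "min \<epsilon> \<delta>"]) (use e d dx sc insert.prems in auto)
qed

text \<open>A direction orthogonal to all tight edge vectors could be followed a little both ways.
  Conversely, tightness at an inner point of a segment forces tightness at both ends, and spanning
  equations have only one solution.\<close>

lemma extreme_point_iff_span:
  "v extreme_point_of polytrope c \<longleftrightarrow> v \<in> polytrope c \<and> span (edge_vec ` incident_facets c v) = UNIV"
proof (intro iffI conjI)
  assume ext: "v extreme_point_of polytrope c"
  then show vP: "v \<in> polytrope c" by (simp add: extreme_point_of_def)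
  show "span (edge_vec ` incident_facets c v) = UNIV"
  proof (rule ccontr)
    assume "\<not> ?thesis"
    from span_not_UNIV_orthogonal[OF this] obtain d where d: "d \<noteq> 0"
      "\<And>x. x \<in> span (edge_vec ` incident_facets c v) \<Longrightarrow> d \<bullet> x = 0" by blast
    obtain \<epsilon> where e: "\<epsilon> > 0" "\<forall>e \<in> - incident_facets c v. \<epsilon> * \<bar>edge_vec e \<bullet> d\<bar> < c $ e - edge_vec e \<bullet> v"
      using finite_small_scale[of "- incident_facets c v" "\<lambda>e. c $ e - edge_vec e \<bullet> v" "\<lambda>e. \<bar>edge_vec e \<bullet> d\<bar>"]
        vP by (auto simp: mem_incident_facets mem_polytrope order_less_le)
    have in_P: "v + s *\<^sub>R d \<in> polytrope c" if "\<bar>s\<bar> = \<epsilon>" for s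
      unfolding mem_polytrope
    proof
      fix e
      show "edge_vec e \<bullet> (v + s *\<^sub>R d) \<le> c $ e"
      proof (cases "e \<in> incident_facets c v")
        case True
        then have "d \<bullet> edge_vec e = 0" by (intro d(2) span_base) auto
        then show ?thesis using True by (simp add: inner_add_right inner_commute mem_incident_facets)
      next
        case False
        then have "\<epsilon> * \<bar>edge_vec e \<bullet> d\<bar> < c $ e - edge_vec e \<bullet> v" using e by blast
        moreover have "s * (edge_vec e \<bullet> d) \<le> \<epsilon> * \<bar>edge_vec e \<bullet> d\<bar>"
          using that abs_ge_self[of "s * (edge_vec e \<bullet> d)"] by (simp add: abs_mult)
        ultimately show ?thesis by (simp add: inner_add_right)
      qed
    qed
    have "v \<in> open_segment (v + \<epsilon> *\<^sub>R d) (v + (-\<epsilon>) *\<^sub>R d)"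
      unfolding in_segment using e d(1)
      by (auto intro!: exI[of _ "1/2"] simp: algebra_simps scaleR_left.add[symmetric])
    then show False using ext in_P[of \<epsilon>] in_P[of "-\<epsilon>"] e(1) by (auto simp: extreme_point_of_def)
  qed
next
  assume r: "v \<in> polytrope c \<and> span (edge_vec ` incident_facets c v) = UNIV"
  have False if "a \<in> polytrope c" "b \<in> polytrope c" "v \<in> open_segment a b" for a b
  proof -
    from that(3) obtain t where t: "0 < t" "t < 1" "v = (1 - t) *\<^sub>R a + t *\<^sub>R b" and "a \<noteq> b"
      by (auto simp: in_segment)
    have "a = b"
    proof (rule span_inner_eqI[of "incident_facets c v"])
      fix e assume "e \<in> incident_facets c v"
      then have eq: "(1 - t) * (edge_vec e \<bullet> a) + t * (edge_vec e \<bullet> b) = c $ e"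
        using t(3) by (simp add: mem_incident_facets inner_add_right)
      have le: "edge_vec e \<bullet> a \<le> c $ e" "edge_vec e \<bullet> b \<le> c $ e" using that by (auto simp: mem_polytrope)
      then have "(1 - t) * (edge_vec e \<bullet> a) \<le> (1 - t) * c $ e" "t * (edge_vec e \<bullet> b) \<le> t * c $ e"
        using t by (auto intro: mult_left_mono)
      moreover have "(1 - t) * c $ e + t * c $ e = c $ e" by (simp add: algebra_simps)
      ultimately have "(1 - t) * (edge_vec e \<bullet> a) = (1 - t) * c $ e" "t * (edge_vec e \<bullet> b) = t * c $ e"
        using eq by linarith+
      then show "edge_vec e \<bullet> a = edge_vec e \<bullet> b" using t by simp
    qed (use r in blast)
    then show False using \<open>a \<noteq> b\<close> by simp
  qed
  then show "v extreme_point_of polytrope c" using r by (auto simp: extreme_point_of_def)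
qed

lemma extreme_point_incident_inj:
  assumes "v extreme_point_of polytrope c" "w \<in> polytrope c" "incident_facets c v \<subseteq> incident_facets c w"
  shows "v = w"
  by (rule span_inner_eqI[of "incident_facets c v"])
    (use assms in \<open>auto simp: extreme_point_iff_span mem_incident_facets\<close>)

lemma extreme_point_of_basis:
  assumes "v \<in> polytrope c" "edge_basis B" "B \<subseteq> incident_facets c v"
  shows "v extreme_point_of polytrope c"
  using assms span_mono[of "edge_vec ` B" "edge_vec ` incident_facets c v"]
  by (auto simp: extreme_point_iff_span edge_basis_def)

lemma exists_edge_basis_subset:
  fixes A :: "'n::finite edge set"
  assumes "span (edge_vec ` A) = UNIV"
  obtains B where "B \<subseteq> A" "edge_basis B"
proof -
  obtain S where S: "S \<subseteq> edge_vec ` A" "independent S" "edge_vec ` A \<subseteq> span S"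
    using maximal_independent_subset[of "edge_vec ` A"] by blast
  then obtain B where B: "B \<subseteq> A" "S = edge_vec ` B" by (auto simp: subset_image_iff)
  have sp: "span S = UNIV" using S assms by (metis span_mono span_span top.extremum_unique)
  then have "card S = CARD('n)"
    using S(2) by (metis dim_UNIV dim_span dim_eq_card_independent DIM_cart DIM_real mult.right_neutral)
  then have "card B = CARD('n)"
    using B by (simp add: card_image[OF inj_on_subset[OF inj_edge_vec]])
  then show ?thesis using that B sp by (auto simp: edge_basis_def)
qed

section \<open>Counting extreme points by outdegree vectors\<close>

definition outdeg :: "'n edge set \<Rightarrow> 'n option \<Rightarrow> nat" where
  "outdeg B i = card {e \<in> B. src e = i}"

text \<open>A forest on the nodes \<open>S\<close> has fewer than \<open>|S|\<close> edges: its edge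
  vectors are independent in the span of the differences to one fixed node of
  \<open>S\<close>.\<close>

lemma card_edges_within:
  fixes B :: "'n::finite edge set"
  assumes "independent (edge_vec ` B)" "S \<noteq> {}"
  shows "card {e \<in> B. src e \<in> S \<and> tgt e \<in> S} < card S"
proof -
  obtain k where k: "k \<in> S" using assms by blast
  let ?E = "{e \<in> B. src e \<in> S \<and> tgt e \<in> S}"
  let ?T = "(\<lambda>i. vertex_vec i - vertex_vec k) ` (S - {k})"
  have gen: "vertex_vec i - vertex_vec k \<in> span ?T" if "i \<in> S" for i
    using that by (cases "i = k") (auto intro: span_base simp: span_zero)
  have "edge_vec ` ?E \<subseteq> span ?T"
  proof safe
    fix e assume "src e \<in> S" "tgt e \<in> S"
    then have "(vertex_vec (src e) - vertex_vec k) - (vertex_vec (tgt e) - vertex_vec k) \<in> span ?T"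
      by (intro span_diff gen)
    then show "edge_vec e \<in> span ?T" by (simp add: edge_vec_def)
  qed
  moreover have "independent (edge_vec ` ?E)"
    by (rule independent_mono[OF assms(1)]) auto
  ultimately have "card (edge_vec ` ?E) \<le> dim (span ?T)"
    by (rule independent_card_le_dim)
  also have "\<dots> \<le> card ?T" by (simp add: dim_le_card')
  also have "\<dots> \<le> card (S - {k})" by (rule card_image_le) simp
  also have "\<dots> < card S" using k by (intro psubset_card_mono) auto
  finally show ?thesis by (simp add: card_image[OF inj_on_subset[OF inj_edge_vec]])
qed

lemma sum_outdeg: "(\<Sum>i\<in>S. outdeg B i) = card {e \<in> B. src e \<in> S}"
  for B :: "'n::finite edge set"
proof -
  have "{e \<in> B. src e \<in> S} = (\<Union>i\<in>S. {e \<in> B. src e = i})" by auto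
  also have "card \<dots> = (\<Sum>i\<in>S. outdeg B i)"
    unfolding outdeg_def by (intro card_UN_disjoint) auto
  finally show ?thesis by simp
qed

text \<open>
  Let \<open>S\<close> be the set of indices at which the difference of the two points is maximal. Edges
  tight at \<open>v\<close> cannot leave \<open>S\<close>, edges tight at \<open>w\<close> cannot enter \<open>S\<close>; as bases are
  spanning trees, at most \<open>|S| - 1\<close> edges of \<open>A\<close> but at least \<open>|S|\<close> edges of \<open>B\<close> start in \<open>S\<close>.
\<close>

lemma outdeg_neq:
  fixes c :: "real ^ 'n::finite edge"
  assumes vw: "v \<in> polytrope c" "w \<in> polytrope c" "v \<noteq> w"
    and A: "A \<subseteq> incident_facets c v" "edge_basis A"
    and B: "B \<subseteq> incident_facets c w" "edge_basis B"
  shows "outdeg A \<noteq> outdeg B"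
proof
  assume eq: "outdeg A = outdeg B"
  define D where "D i = coord w i - coord v i" for i
  define M where "M = Max (range D)"
  define S where "S = {i. D i = M}"
  have le: "D i \<le> M" for i unfolding M_def by (rule Max_ge) auto
  have "M \<in> range D" unfolding M_def by (rule Max_in) auto
  then have S: "S \<noteq> {}" by (auto simp: S_def)
  \<comment> \<open>Otherwise the difference of the two points would be constant, hence equal to its
    value 0 at \<open>None\<close>.\<close>
  have S': "- S \<noteq> {}"
  proof
    assume "- S = {}"
    then have "i \<in> S" for i by blast
    then have "D i = D None" for i unfolding S_def by (metis (mono_tags) mem_Collect_eq)
    then have "w $ k = v $ k" for k by (metis D_def coord_None coord_Some eq_iff_diff_eq_0)
    then show False using vw by (simp add: vec_eq_iff)
  qed
  have DA: "D (src e) \<le> D (tgt e)" if "e \<in> A" for e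
  proof -
    have "edge_vec e \<bullet> v = c $ e" "edge_vec e \<bullet> w \<le> c $ e"
      using that A(1) vw(2) by (auto simp: mem_incident_facets mem_polytrope)
    then show ?thesis by (simp add: D_def inner_edge_vec)
  qed
  have DB: "D (tgt e) \<le> D (src e)" if "e \<in> B" for e
  proof -
    have "edge_vec e \<bullet> w = c $ e" "edge_vec e \<bullet> v \<le> c $ e"
      using that B(1) vw(1) by (auto simp: mem_incident_facets mem_polytrope)
    then show ?thesis by (simp add: D_def inner_edge_vec)
  qed
  have tA: "tgt e \<in> S" if "e \<in> A" "src e \<in> S" for e
    using DA[OF that(1)] that(2) le[of "tgt e"] by (simp add: S_def)
  have tB: "src e \<in> S" if "e \<in> B" "tgt e \<in> S" for e
    using DB[OF that(1)] that(2) le[of "src e"] by (simp add: S_def)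
  have "{e \<in> A. src e \<in> S} = {e \<in> A. src e \<in> S \<and> tgt e \<in> S}" using tA by blast
  then have 1: "(\<Sum>i\<in>S. outdeg A i) < card S"
    using card_edges_within[OF edge_basis_independent[OF A(2)] S] by (simp add: sum_outdeg)
  have Beq: "B = {e \<in> B. src e \<in> S} \<union> {e \<in> B. src e \<in> -S \<and> tgt e \<in> -S}" using tB by blast
  have "card B \<le> card {e \<in> B. src e \<in> S} + card {e \<in> B. src e \<in> -S \<and> tgt e \<in> -S}"
    by (subst Beq) (rule card_Un_le)
  moreover have "card {e \<in> B. src e \<in> -S \<and> tgt e \<in> -S} < card (-S)"
    using card_edges_within[OF edge_basis_independent[OF B(2)] S'] .
  \<comment> \<open>There is one node more than a basis has edges. Fewer than \<open>|-S|\<close>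
    edges of \<open>B\<close> lie inside the complement, so at least \<open>|S|\<close> of them
    start in \<open>S\<close>.\<close>
  moreover have "card S + card (-S) = CARD('n) + 1"
    using card_Un_disjoint[of S "-S"] by simp
  ultimately have "card S \<le> (\<Sum>i\<in>S. outdeg B i)"
    using B(2) by (simp add: sum_outdeg edge_basis_def)
  then show False using 1 eq by simp
qed

text \<open>Stars and bars: along an enumeration of the nodes, the functions become the lists of a
  given length and sum.\<close>

lemma card_outdegree_vectors:
  "card {f :: 'n::finite option \<Rightarrow> nat. sum f UNIV = CARD('n)} = (2 * CARD('n)) choose CARD('n)"
    (is "card ?F = _")
  and finite_outdegree_vectors:
  "finite {f :: 'n::finite option \<Rightarrow> nat. sum f UNIV = CARD('n)}"
proof -
  obtain xs :: "'n option list" where xs: "set xs = UNIV" "distinct xs"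
    using finite_distinct_list[of "UNIV :: 'n option set"] by auto
  have len: "length xs = CARD('n) + 1" using distinct_card[OF xs(2)] xs(1) by simp
  let ?L = "{l :: nat list. size l = CARD('n) + 1 \<and> sum_list l = CARD('n)}"
  have sl: "sum_list (map f xs) = sum f UNIV" for f :: "'n option \<Rightarrow> nat"
    using sum_list_distinct_conv_sum_set[OF xs(2), of f] xs(1) by simp
  have bij: "bij_betw (\<lambda>f. map f xs) ?F ?L"
    unfolding bij_betw_def
  proof
    show "inj_on (\<lambda>f. map f xs) ?F" using xs(1) by (auto simp: inj_on_def fun_eq_iff)
    show "(\<lambda>f. map f xs) ` ?F = ?L"
    proof safe
      fix l :: "nat list" assume l: "length l = CARD('n) + 1" "sum_list l = CARD('n)"
      define f where "f i = the (map_of (zip xs l) i)" for i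
      have "map f xs = l"
        by (rule nth_equalityI) (use l len xs in \<open>auto simp: f_def map_of_zip_nth\<close>)
      moreover from this have "sum f UNIV = CARD('n)" using sl[of f] l by simp
      ultimately show "l \<in> (\<lambda>f. map f xs) ` ?F" by blast
    qed (auto simp: len sl)
  qed
  have "card ?L = (2 * CARD('n)) choose CARD('n)"
    using card_length_sum_list[of "CARD('n) + 1" "CARD('n)"] by (simp add: mult_2)
  then show "card ?F = (2 * CARD('n)) choose CARD('n)"
    using bij_betw_same_card[OF bij] by simp
  \<comment> \<open>An infinite set would have cardinality 0, but the binomial coefficient is
    positive.\<close>
  then show "finite ?F" by (intro card_ge_0_finite) simp
qed

lemma edge_basis_outdeg: "edge_basis B \<Longrightarrow> sum (outdeg B) UNIV = CARD('n)"
  for B :: "'n::finite edge set"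
  by (simp add: sum_outdeg edge_basis_def)

definition tight_basis :: "real ^ 'n::finite edge \<Rightarrow> real ^ 'n \<Rightarrow> 'n edge set" where
  "tight_basis c v = (SOME B. B \<subseteq> incident_facets c v \<and> edge_basis B)"

lemma tight_basis:
  assumes "v extreme_point_of polytrope c"
  shows "tight_basis c v \<subseteq> incident_facets c v" "edge_basis (tight_basis c v)"
proof -
  have "\<exists>B. B \<subseteq> incident_facets c v \<and> edge_basis B"
    using exists_edge_basis_subset[of "incident_facets c v"] assms
    by (metis extreme_point_iff_span)
  from someI_ex[OF this] show "tight_basis c v \<subseteq> incident_facets c v" "edge_basis (tight_basis c v)"
    by (auto simp: tight_basis_def)
qed

lemma extreme_points_outdeg:
  fixes c :: "real ^ 'n::finite edge"
  shows "inj_on (\<lambda>v. outdeg (tight_basis c v)) {v. v extreme_point_of polytrope c}" (is "inj_on ?g ?X")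
    and "(\<lambda>v. outdeg (tight_basis c v)) ` {v. v extreme_point_of polytrope c}
       \<subseteq> {f. sum f UNIV = CARD('n)}"
proof -
  show "inj_on ?g ?X"
  proof (rule inj_onI, rule ccontr)
    fix v w assume "v \<in> ?X" "w \<in> ?X" "?g v = ?g w" "v \<noteq> w"
    then show False
      using outdeg_neq[of v c w "tight_basis c v" "tight_basis c w"] tight_basis[of v c] tight_basis[of w c]
      by (auto simp: extreme_point_iff_span)
  qed
  show "?g ` ?X \<subseteq> {f. sum f UNIV = CARD('n)}"
    using tight_basis edge_basis_outdeg by blast
qed

lemma finite_extreme_points: "finite {v. v extreme_point_of polytrope c}"
  for c :: "real ^ 'n::finite edge"
  using extreme_points_outdeg[of c] finite_outdegree_vectors[where 'n='n]
  by (meson finite_imageD finite_subset)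

lemma card_extreme_points_le:
  "card {v. v extreme_point_of polytrope c} \<le> (2 * CARD('n)) choose CARD('n)"
  for c :: "real ^ 'n::finite edge"
  using card_inj_on_le[OF extreme_points_outdeg[of c] finite_outdegree_vectors]
  by (simp add: card_outdegree_vectors)

section \<open>Exchange of edges in a basis\<close>

lemma edge_basis_exchange:
  fixes B :: "'n::finite edge set"
  assumes B: "edge_basis B" and f: "f \<in> B" and ne: "edge_vec e \<bullet> dual_vec B f \<noteq> 0"
  shows "edge_basis (insert e (B - {f}))"
proof -
  have "e \<notin> B - {f}" using ne inner_dual_vec[OF B f, of e] by auto
  then have crd: "card (insert e (B - {f})) = CARD('n)"
    using f B by (simp add: edge_basis_def)
  let ?S = "span (edge_vec ` insert e (B - {f}))"
  have "edge_vec g \<in> ?S" if "g \<in> B" for g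
  proof (cases "g = f")
    case True
    have "edge_vec e = (\<Sum>g\<in>B. (edge_vec e \<bullet> dual_vec B g) *\<^sub>R edge_vec g)"
      by (rule edge_vec_expand[OF B, symmetric])
    also have "\<dots> = (edge_vec e \<bullet> dual_vec B f) *\<^sub>R edge_vec f +
        (\<Sum>g\<in>B - {f}. (edge_vec e \<bullet> dual_vec B g) *\<^sub>R edge_vec g)"
      using f by (simp add: sum.remove)
    finally have "(edge_vec e \<bullet> dual_vec B f) *\<^sub>R edge_vec f
       = edge_vec e - (\<Sum>g\<in>B - {f}. (edge_vec e \<bullet> dual_vec B g) *\<^sub>R edge_vec g)"
      by (metis add_diff_cancel_right')
    also have "\<dots> \<in> ?S"
      by (intro span_diff span_sum span_scale) (auto intro: span_base)
    finally have "inverse (edge_vec e \<bullet> dual_vec B f) *\<^sub>R (edge_vec e \<bullet> dual_vec B f) *\<^sub>R edge_vec f \<in> ?S"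
      by (rule span_scale)
    then show ?thesis using ne True by simp
  qed (use that in \<open>auto intro: span_base\<close>)
  then have "span (edge_vec ` B) \<subseteq> ?S" by (intro span_minimal) auto
  then show ?thesis using crd B by (auto simp: edge_basis_def)
qed

text \<open>Suppose that only edges starting at \<open>src e\<close> occur in the expansion of
  \<open>e\<close>. The target of such an edge \<open>f\<close> is no end of \<open>e\<close>, and
  no other edge of the expansion touches it, so pairing with its node vector shows that the
  coefficient of \<open>f\<close> is 0. Then \<open>edge_vec e\<close> would vanish.\<close>

lemma basis_exchange_other_source:
  fixes B :: "'n::finite edge set"
  assumes B: "edge_basis B" and e: "e \<notin> B"
  shows "\<exists>f\<in>B. src f \<noteq> src e \<and> edge_vec e \<bullet> dual_vec B f \<noteq> 0"
proof (rule ccontr)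
  assume nt: "\<not> ?thesis"
  then have z: "src f = src e" if f: "f \<in> B" "edge_vec e \<bullet> dual_vec B f \<noteq> 0" for f
    using that by blast
  have ex: "edge_vec e = (\<Sum>f\<in>B. (edge_vec e \<bullet> dual_vec B f) *\<^sub>R edge_vec f)"
    by (rule edge_vec_expand[OF B, symmetric])
  have zero: "edge_vec e \<bullet> dual_vec B f = 0" if f: "f \<in> B" for f
  proof (rule ccontr)
    assume nz: "edge_vec e \<bullet> dual_vec B f \<noteq> 0"
    then have sf: "src f = src e" using z f by blast
    then have tf: "tgt f \<noteq> tgt e" using f e edge_eqI by metis
    have se: "src e \<noteq> tgt f" using sf src_neq_tgt(1)[of f] by metis
    define y where "y = node_vec (tgt f)"
    have cy: "edge_vec g \<bullet> y = of_bool (src g = tgt f) - of_bool (tgt g = tgt f)" for g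
      unfolding y_def by (rule edge_vec_inner_node_vec)
    have "edge_vec e \<bullet> y = (\<Sum>g\<in>B. (edge_vec e \<bullet> dual_vec B g) * (edge_vec g \<bullet> y))"
      by (rule inner_expand[OF B])
    also have "\<dots> = (\<Sum>g\<in>B. if g = f then (edge_vec e \<bullet> dual_vec B f) * (edge_vec f \<bullet> y) else 0)"
    proof (rule sum.cong[OF refl])
      fix g assume g: "g \<in> B"
      show "(edge_vec e \<bullet> dual_vec B g) * (edge_vec g \<bullet> y) =
        (if g = f then (edge_vec e \<bullet> dual_vec B f) * (edge_vec f \<bullet> y) else 0)"
      proof (cases "g = f \<or> edge_vec e \<bullet> dual_vec B g = 0")
        case False
        then have "src g = src e" using z g by blast
        moreover from this have "tgt g \<noteq> tgt f" using sf edge_eqI[of g f] False by auto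
        ultimately have "edge_vec g \<bullet> y = 0" using se by (simp add: cy)
        then show ?thesis using False by simp
      qed auto
    qed
    also have "\<dots> = (edge_vec e \<bullet> dual_vec B f) * (edge_vec f \<bullet> y)"
      using f by simp
    finally have "edge_vec e \<bullet> y = (edge_vec e \<bullet> dual_vec B f) * (edge_vec f \<bullet> y)" .
    moreover have "edge_vec e \<bullet> y = 0" using tf se by (simp add: cy)
    moreover have "edge_vec f \<bullet> y \<noteq> 0" by (simp add: cy)
    ultimately show False using nz by simp
  qed
  then have "edge_vec e = 0" by (subst ex) simp
  then show False by simp
qed

lemma outdeg_exchange:
  fixes B :: "'n::finite edge set"
  assumes "f \<in> B" "e \<notin> B" "src f \<noteq> src e"
  shows "outdeg (insert e (B - {f})) \<noteq> outdeg B"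
proof -
  have "{g \<in> insert e (B - {f}). src g = src e} = insert e {g \<in> B. src g = src e}"
    using assms by auto
  then have "outdeg (insert e (B - {f})) (src e) = Suc (outdeg B (src e))"
    using assms by (simp add: outdeg_def)
  then show ?thesis by (metis n_not_Suc_n)
qed

definition simple_polytrope :: "real ^ 'n::finite edge \<Rightarrow> bool" where
  "simple_polytrope c \<longleftrightarrow> (\<forall>v. v extreme_point_of polytrope c \<longrightarrow> edge_basis (incident_facets c v))"

text \<open>
  With the maximal number of vertices, every outdegree vector is the one of the chosen
  basis at some vertex, so by the preceding lemmas no vertex has a second basis of
  tight edges.
\<close>

lemma maximal_imp_simple:
  fixes c :: "real ^ 'n::finite edge"
  assumes "card {v. v extreme_point_of polytrope c} = (2 * CARD('n)) choose CARD('n)"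
  shows "simple_polytrope c"
  unfolding simple_polytrope_def
proof (intro allI impI)
  fix v assume v: "v extreme_point_of polytrope c"
  let ?X = "{v. v extreme_point_of polytrope c}" and ?g = "\<lambda>v. outdeg (tight_basis c v)"
  have onto: "?g ` ?X = {f. sum f UNIV = CARD('n)}"
    by (rule card_subset_eq)
      (use extreme_points_outdeg[of c] finite_outdegree_vectors[where 'n='n] in
        \<open>auto simp: card_image card_outdegree_vectors assms\<close>)
  let ?B = "tight_basis c v"
  have "incident_facets c v = ?B"
  proof (rule ccontr)
    assume "incident_facets c v \<noteq> ?B"
    then obtain e where e: "e \<in> incident_facets c v" "e \<notin> ?B" using tight_basis[OF v] by blast
    \<comment> \<open>Exchanging edges with a common source would leave the outdegrees unchanged, so
      \<open>f\<close> has to start elsewhere. The new outdegree vector then belongs to some vertex,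
      which can only be \<open>v\<close> itself, whose chosen basis has a different one.\<close>
    obtain f where f: "f \<in> ?B" "src f \<noteq> src e" "edge_vec e \<bullet> dual_vec ?B f \<noteq> 0"
      using basis_exchange_other_source[OF tight_basis(2)[OF v] e(2)] by blast
    let ?B' = "insert e (?B - {f})"
    have B': "edge_basis ?B'" by (rule edge_basis_exchange[OF tight_basis(2)[OF v] f(1) f(3)])
    then obtain w where w: "w \<in> ?X" "outdeg ?B' = ?g w"
      using onto edge_basis_outdeg by blast
    have "?B' \<subseteq> incident_facets c v" using e tight_basis[OF v] by auto
    then have "v = w"
      using outdeg_neq[of v c w ?B' "tight_basis c w"] w v B' tight_basis[of w c]
      by (auto simp: extreme_point_iff_span)
    then show False using w(2) outdeg_exchange[OF f(1) e(2) f(2)] by simp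
  qed
  then show "edge_basis (incident_facets c v)" using tight_basis[OF v] by simp
qed

section \<open>Ridges of the normal fan of a simple polytrope\<close>

text \<open>For a simple polytrope these are the maximal faces of the simplicial complex behind the
  normal fan.\<close>

definition vertex_bases :: "real ^ 'n::finite edge \<Rightarrow> 'n edge set set" where
  "vertex_bases c = incident_facets c ` {v. v extreme_point_of polytrope c}"

lemma finite_vertex_bases [simp]: "finite (vertex_bases c)" "finite (B :: 'n::finite edge set)"
  by auto

lemma vertex_bases_basis: "simple_polytrope c \<Longrightarrow> B \<in> vertex_bases c \<Longrightarrow> edge_basis B"
  by (auto simp: simple_polytrope_def vertex_bases_def)

lemma exists_edge_neg:
  assumes "d \<noteq> 0" obtains e where "edge_vec e \<bullet> d < 0"
proof -
  obtain k where k: "d $ k \<noteq> 0" using assms by (auto simp: vec_eq_iff)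
  have "edge_vec (Edge (Some k, None)) \<bullet> d = d $ k" by (simp add: inner_edge_vec)
  then show ?thesis using k that[of "Edge (Some k, None)"] that[of "rev_edge (Edge (Some k, None))"]
    by (cases "d $ k < 0") auto
qed

text \<open>
  Leaving the vertex \<open>v\<close> along the polytrope edge on which all tight constraints but \<open>e\<close> stay
  tight, one reaches a neighbouring vertex.
\<close>

lemma ridge_neighbour:
  fixes c :: "real ^ 'n::finite edge"
  assumes simp: "simple_polytrope c" and v: "v extreme_point_of polytrope c"
    and e: "e \<in> incident_facets c v"
  obtains s f where "s > 0" "(v - s *\<^sub>R dual_vec (incident_facets c v) e) extreme_point_of polytrope c"
    "f \<notin> incident_facets c v"
    "incident_facets c (v - s *\<^sub>R dual_vec (incident_facets c v) e) = insert f (incident_facets c v - {e})"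
    "dual_vec (insert f (incident_facets c v - {e})) f = - dual_vec (incident_facets c v) e"
proof -
  let ?I = "incident_facets c v"
  have B: "edge_basis ?I" using simp v by (simp add: simple_polytrope_def)
  define d where "d = dual_vec ?I e"
  have dI: "edge_vec g \<bullet> d = of_bool (g = e)" if "g \<in> ?I" for g
    using inner_dual_vec[OF B e that] by (simp add: d_def)
  have vP: "v \<in> polytrope c" using v by (simp add: extreme_point_iff_span)
  define N where "N = {g. edge_vec g \<bullet> d < 0}"
  have "d \<noteq> 0" using dI[OF e] by auto
  then have N: "finite N" "N \<noteq> {}" using exists_edge_neg[of d] by (auto simp: N_def)
  \<comment> \<open>The step length at which the constraint \<open>g\<close> becomes tight on the
    way from \<open>v\<close> in direction \<open>- d\<close>. The first constraint reached is
    \<open>f\<close>, as in the ratio test of the simplex method.\<close>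
  define r where "r g = (c $ g - edge_vec g \<bullet> v) / - (edge_vec g \<bullet> d)" for g
  have NI: "g \<notin> ?I" if "g \<in> N" for g using dI[of g] that by (auto simp: N_def of_bool_def split: if_splits)
  have rpos: "r g > 0" if "g \<in> N" for g
  proof -
    have "edge_vec g \<bullet> v < c $ g"
      using NI[OF that] vP by (auto simp: mem_incident_facets mem_polytrope order_less_le)
    moreover have "edge_vec g \<bullet> d < 0" using that by (simp add: N_def)
    ultimately show ?thesis unfolding r_def by (intro divide_pos_pos) auto
  qed
  define s where "s = Min (r ` N)"
  have "s \<in> r ` N" unfolding s_def using N by (intro Min_in) auto
  then obtain f where f: "f \<in> N" "r f = s" by blast
  have s: "s > 0" using rpos[OF f(1)] f(2) by simp
  define w where "w = v - s *\<^sub>R d"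
  have wg: "edge_vec g \<bullet> w = edge_vec g \<bullet> v - s * (edge_vec g \<bullet> d)" for g
    by (simp add: w_def inner_diff_right)
  have wP: "w \<in> polytrope c" unfolding mem_polytrope
  proof
    fix g
    show "edge_vec g \<bullet> w \<le> c $ g"
    proof (cases "g \<in> N")
      case True
      then have "s \<le> r g" unfolding s_def using N by simp
      then have "s * - (edge_vec g \<bullet> d) \<le> c $ g - edge_vec g \<bullet> v"
        using True pos_le_divide_eq[of "- (edge_vec g \<bullet> d)" s "c $ g - edge_vec g \<bullet> v"]
        by (simp only: r_def N_def mem_Collect_eq neg_0_less_iff_less)
      then show ?thesis by (simp add: wg)
    next
      case False
      then have "s * (edge_vec g \<bullet> d) \<ge> 0" using s by (simp add: N_def)
      then show ?thesis using vP[unfolded mem_polytrope, rule_format, of g] by (simp add: wg)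
    qed
  qed
  let ?I' = "insert f (?I - {e})"
  have sub: "?I' \<subseteq> incident_facets c w"
  proof
    fix g assume "g \<in> ?I'"
    moreover have "edge_vec f \<bullet> w = c $ f"
      using f by (simp add: wg r_def N_def field_simps split: if_splits)
    moreover have "edge_vec g \<bullet> w = c $ g" if "g \<in> ?I - {e}"
      using that dI[of g] by (simp add: wg mem_incident_facets)
    ultimately show "g \<in> incident_facets c w" using wP by (auto simp: mem_incident_facets)
  qed
  have B': "edge_basis ?I'"
    by (rule edge_basis_exchange[OF B e]) (use f in \<open>auto simp: N_def d_def\<close>)
  have w: "w extreme_point_of polytrope c" by (rule extreme_point_of_basis[OF wP B' sub])
  then have "edge_basis (incident_facets c w)" using simp by (simp add: simple_polytrope_def)
  \<comment> \<open>Simplicity at \<open>w\<close> excludes that several constraints become tight at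
    once.\<close>
  then have I': "incident_facets c w = ?I'"
    using sub B' by (intro card_subset_eq[symmetric]) (auto simp: edge_basis_def)
  define d' where "d' = dual_vec ?I' f"
  have d'I: "edge_vec g \<bullet> d' = of_bool (g = f)" if "g \<in> ?I'" for g
    using inner_dual_vec[OF B' _ that, of f] by (simp add: d'_def)
  define a b where "a = edge_vec f \<bullet> d" and "b = edge_vec e \<bullet> d'"
  have fI: "f \<notin> ?I" by (rule NI[OF f(1)])
  have d'eq: "d' = b *\<^sub>R d"
  proof (rule span_inner_eqI[of ?I])
    fix g assume g: "g \<in> ?I"
    then show "edge_vec g \<bullet> d' = edge_vec g \<bullet> b *\<^sub>R d"
      using dI[OF g] d'I[of g] fI by (cases "g = e") (auto simp: b_def)
  qed (use B in \<open>simp add: edge_basis_def\<close>)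
  have "edge_vec f \<bullet> d' = 1" using d'I[of f] by simp
  then have ab: "b * a = 1" using d'eq by (simp add: a_def)
  \<comment> \<open>Unimodularity: \<open>a\<close> and \<open>b\<close> are integers with product 1
    and \<open>a\<close> is negative, so both are -1.\<close>
  have "a \<in> \<int>" "b \<in> \<int>" unfolding a_def b_def d_def d'_def
    using edge_vec_inner_dual_Ints[OF B e] edge_vec_inner_dual_Ints[OF B', of f] by auto
  then obtain a' b' :: int where "a = of_int a'" "b = of_int b'" by (auto simp: Ints_def)
  moreover from this have "b' * a' = 1" using ab by (metis of_int_1 of_int_eq_iff of_int_mult)
  moreover have "a < 0" using f by (simp add: a_def N_def)
  ultimately have "b = -1" by (auto simp: zmult_eq_1_iff)
  then have "d' = - d" using d'eq by simp
  then show ?thesis using that[OF s, of f] w I' fI by (simp add: w_def d'_def d_def)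
qed

text \<open>Keeping all constraints but \<open>e\<close> tight leaves only a ray from
  \<open>v\<close>. Of two further points on it, the nearer one would lie strictly between
  \<open>v\<close> and the other one and could not be extreme.\<close>

lemma ridge_unique:
  fixes c :: "real ^ 'n::finite edge"
  assumes simp: "simple_polytrope c"
    and v: "v extreme_point_of polytrope c" "v' extreme_point_of polytrope c" "v'' extreme_point_of polytrope c"
    and e: "e \<in> incident_facets c v"
    and sub: "incident_facets c v - {e} \<subseteq> incident_facets c v'" "incident_facets c v - {e} \<subseteq> incident_facets c v''"
    and ne: "v' \<noteq> v" "v'' \<noteq> v"
  shows "v' = v''"
proof -
  let ?I = "incident_facets c v"
  have B: "edge_basis ?I" using simp v by (simp add: simple_polytrope_def)
  define d where "d = dual_vec ?I e"
  have line: "\<exists>s>0. w = v - s *\<^sub>R d" if w: "w extreme_point_of polytrope c" "?I - {e} \<subseteq> incident_facets c w" "w \<noteq> v" for w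
  proof -
    define s where "s = edge_vec e \<bullet> v - edge_vec e \<bullet> w"
    have eq: "w = v - s *\<^sub>R d"
    proof (rule span_inner_eqI[of ?I])
      fix g assume g: "g \<in> ?I"
      then have "edge_vec g \<bullet> d = of_bool (g = e)"
        using inner_dual_vec[OF B e g] by (simp add: d_def)
      moreover have "g \<noteq> e \<Longrightarrow> edge_vec g \<bullet> w = c $ g" using w(2) g by (auto simp: mem_incident_facets)
      ultimately show "edge_vec g \<bullet> w = edge_vec g \<bullet> (v - s *\<^sub>R d)"
        using g by (cases "g = e") (auto simp: inner_diff_right s_def mem_incident_facets)
    qed (use B in \<open>simp add: edge_basis_def\<close>)
    have "s \<ge> 0" using e w(1) by (auto simp: s_def mem_incident_facets extreme_point_iff_span mem_polytrope)
    moreover have "s \<noteq> 0" using eq w(3) by auto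
    ultimately show ?thesis using eq by (intro exI[of _ s]) auto
  qed
  obtain s s' where s: "s > 0" "v' = v - s *\<^sub>R d" "s' > 0" "v'' = v - s' *\<^sub>R d"
    using line[OF v(2) sub(1) ne(1)] line[OF v(3) sub(2) ne(2)] by blast
  have mid: False if t: "0 < t" "t < t'" "(v - t *\<^sub>R d) extreme_point_of polytrope c" "(v - t' *\<^sub>R d) \<in> polytrope c" for t t'
  proof -
    have "v - t *\<^sub>R d = (1 - t / t') *\<^sub>R v + (t / t') *\<^sub>R (v - t' *\<^sub>R d)"
      using t by (simp add: algebra_simps)
    moreover have "v \<noteq> v - t' *\<^sub>R d"
    proof
      assume "v = v - t' *\<^sub>R d"
      then have "d = 0" using t by simp
      then show False using inner_dual_vec[OF B e e] by (simp add: d_def)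
    qed
    moreover have "0 < t / t'" "t / t' < 1" using t by auto
    ultimately have "v - t *\<^sub>R d \<in> open_segment v (v - t' *\<^sub>R d)"
      unfolding in_segment by blast
    then show False using t v(1) by (auto simp: extreme_point_of_def)
  qed
  show ?thesis
    using mid[of s s'] mid[of s' s] s v by (cases s s' rule: linorder_cases) (auto simp: extreme_point_iff_span)
qed

lemma ridge_neighbour_basis:
  fixes c :: "real ^ 'n::finite edge"
  assumes simp: "simple_polytrope c" and B: "B \<in> vertex_bases c" and e: "e \<in> B"
  obtains f where "f \<notin> B" "insert f (B - {e}) \<in> vertex_bases c"
    "dual_vec (insert f (B - {e})) f = - dual_vec B e"
    "\<And>B'. B' \<in> vertex_bases c \<Longrightarrow> B - {e} \<subseteq> B' \<Longrightarrow> B' = B \<or> B' = insert f (B - {e})"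
proof -
  obtain v where v: "v extreme_point_of polytrope c" "B = incident_facets c v"
    using B by (auto simp: vertex_bases_def)
  obtain s f where sf: "s > 0" "(v - s *\<^sub>R dual_vec B e) extreme_point_of polytrope c"
    "f \<notin> B" "incident_facets c (v - s *\<^sub>R dual_vec B e) = insert f (B - {e})"
    "dual_vec (insert f (B - {e})) f = - dual_vec B e"
    using ridge_neighbour[OF simp v(1), of e] e unfolding v(2)[symmetric] by metis
  show ?thesis
  proof (rule that[OF sf(3)])
    show "insert f (B - {e}) \<in> vertex_bases c"
      using sf(2,4) by (force simp: vertex_bases_def)
    fix B' assume B': "B' \<in> vertex_bases c" "B - {e} \<subseteq> B'"
    then obtain w where w: "w extreme_point_of polytrope c" "B' = incident_facets c w"
      by (auto simp: vertex_bases_def)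
    show "B' = B \<or> B' = insert f (B - {e})"
    proof (cases "w = v")
      case False
      have "v - s *\<^sub>R dual_vec B e \<noteq> v" using sf(3,4) v(2) by force
      then have "v - s *\<^sub>R dual_vec B e = w"
        using ridge_unique[OF simp v(1) sf(2) w(1), of e] e sf(4) B'(2) w(2) v(2) False
        by (metis subset_insertI)
      then show ?thesis using sf(4) w(2) by simp
    qed (use v w in simp)
  qed (use sf in blast)
qed

text \<open>Crossing the ridge opposite to \<open>e\<close> is an involution on the pairs of a
  vertex basis and one of its edges. As \<open>T\<close> changes sign under it, the sum equals its
  own negative.\<close>

lemma ridge_cancel:
  fixes T :: "'n::finite edge set \<Rightarrow> 'n edge \<Rightarrow> real"
  assumes simp: "simple_polytrope c"
    and T: "\<And>B e B' f. B \<in> vertex_bases c \<Longrightarrow> e \<in> B \<Longrightarrow> B' \<in> vertex_bases c \<Longrightarrow> f \<in> B' \<Longrightarrow>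
       B' - {f} = B - {e} \<Longrightarrow> dual_vec B' f = - dual_vec B e \<Longrightarrow> T B' f = - T B e"
  shows "(\<Sum>B\<in>vertex_bases c. \<Sum>e\<in>B. T B e) = 0"
proof -
  let ?R = "Sigma (vertex_bases c) (\<lambda>B. B)"
  have "\<forall>p\<in>?R. \<exists>f. f \<notin> fst p \<and> insert f (fst p - {snd p}) \<in> vertex_bases c \<and>
    dual_vec (insert f (fst p - {snd p})) f = - dual_vec (fst p) (snd p) \<and>
    (\<forall>B'\<in>vertex_bases c. fst p - {snd p} \<subseteq> B' \<longrightarrow> B' = fst p \<or> B' = insert f (fst p - {snd p}))"
  proof
    fix p assume "p \<in> ?R"
    then obtain B e where p: "p = (B, e)" "B \<in> vertex_bases c" "e \<in> B" by (cases p) auto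
    then show "\<exists>f. f \<notin> fst p \<and> insert f (fst p - {snd p}) \<in> vertex_bases c \<and>
      dual_vec (insert f (fst p - {snd p})) f = - dual_vec (fst p) (snd p) \<and>
      (\<forall>B'\<in>vertex_bases c. fst p - {snd p} \<subseteq> B' \<longrightarrow> B' = fst p \<or> B' = insert f (fst p - {snd p}))"
      using ridge_neighbour_basis[OF simp p(2,3)] by (metis fst_conv snd_conv)
  qed
  then obtain F where F: "\<And>p. p \<in> ?R \<Longrightarrow> F p \<notin> fst p \<and> insert (F p) (fst p - {snd p}) \<in> vertex_bases c \<and>
    dual_vec (insert (F p) (fst p - {snd p})) (F p) = - dual_vec (fst p) (snd p) \<and>
    (\<forall>B'\<in>vertex_bases c. fst p - {snd p} \<subseteq> B' \<longrightarrow> B' = fst p \<or> B' = insert (F p) (fst p - {snd p}))"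
    by metis
  define nb where "nb p = (insert (F p) (fst p - {snd p}), F p)" for p
  have nbR: "nb p \<in> ?R" if "p \<in> ?R" for p
    using F[OF that] by (auto simp: nb_def)
  have nbnb: "nb (nb p) = p" if pR: "p \<in> ?R" for p
  proof -
    obtain B e where p: "p = (B, e)" "B \<in> vertex_bases c" "e \<in> B" using pR by (cases p) auto
    note F1 = F[OF pR, unfolded p fst_conv snd_conv]
    define f where "f = F (B, e)"
    define B' where "B' = insert f (B - {e})"
    have n: "nb p = (B', f)" by (simp add: nb_def p f_def B'_def)
    note F2 = F[OF nbR[OF pR], unfolded n fst_conv snd_conv]
    define g where "g = F (B', f)"
    have B'f: "B' - {f} = B - {e}" using F1 by (auto simp: B'_def f_def)
    have "insert g (B - {e}) \<in> vertex_bases c" "g \<notin> B'"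
      using F2 B'f by (auto simp: g_def)
    \<comment> \<open>Only \<open>B\<close> and \<open>B'\<close> contain this ridge, and
      \<open>g\<close> is not in \<open>B'\<close>, so crossing it again leads back to
      \<open>B\<close>.\<close>
    then have "insert g (B - {e}) = B"
      using F1 by (auto simp: B'_def f_def)
    moreover from this have "g = e" using p(3) \<open>g \<notin> B'\<close> by (auto simp: B'_def)
    ultimately show ?thesis unfolding n by (simp add: nb_def p B'f flip: g_def)
  qed
  have bij: "bij_betw nb ?R ?R"
    by (rule bij_betwI[where g = nb]) (use nbR nbnb in auto)
  have neg: "case_prod T (nb p) = - case_prod T p" if pR: "p \<in> ?R" for p
  proof -
    obtain B e where p: "p = (B, e)" "B \<in> vertex_bases c" "e \<in> B" using pR by (cases p) auto
    show ?thesis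
      using T[OF p(2,3), of "fst (nb p)" "snd (nb p)"] F[OF pR] nbR[OF pR]
      by (auto simp: p nb_def)
  qed
  have "sum (case_prod T) ?R = (\<Sum>p\<in>?R. case_prod T (nb p))"
    using sum.reindex_bij_betw[OF bij, of "case_prod T"] by simp
  also have "\<dots> = - sum (case_prod T) ?R" using neg by (simp add: sum_negf)
  finally have "sum (case_prod T) ?R = 0" by simp
  then show ?thesis by (simp add: sum.Sigma)
qed

text \<open>A vector in the span of the common ridge has the same expansion in both bases.\<close>

lemma coord_on_ridge:
  assumes B: "edge_basis B" "edge_basis B'" and ef: "e \<in> B" "f \<in> B'" "B' - {f} = B - {e}"
    and \<zeta>: "\<zeta> \<bullet> dual_vec B e = 0" and g: "g \<in> B - {e}"
  shows "\<zeta> \<bullet> dual_vec B' g = \<zeta> \<bullet> dual_vec B g"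
proof -
  have gB': "g \<in> B'" using g ef by blast
  have "\<zeta> \<bullet> dual_vec B' g = (\<Sum>h\<in>B. (\<zeta> \<bullet> dual_vec B h) * (edge_vec h \<bullet> dual_vec B' g))"
    by (rule inner_expand[OF B(1)])
  also have "\<dots> = (\<Sum>h\<in>B. if h = g then \<zeta> \<bullet> dual_vec B g else 0)"
  proof (rule sum.cong[OF refl])
    fix h assume h: "h \<in> B"
    show "(\<zeta> \<bullet> dual_vec B h) * (edge_vec h \<bullet> dual_vec B' g) = (if h = g then \<zeta> \<bullet> dual_vec B g else 0)"
    proof (cases "h = e")
      case False
      then have "h \<in> B'" using h ef by blast
      then show ?thesis using inner_dual_vec[OF B(2) gB', of h] by auto
    qed (use \<zeta> g in auto)
  qed
  also have "\<dots> = \<zeta> \<bullet> dual_vec B g" using g by simp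
  finally show ?thesis .
qed

section \<open>Decomposition of a simple polytrope into signed cones\<close>

text \<open>A product rule for step functions with distinct jump points: each jump is weighted by
  the other factors at that time. The value of a factor at its own jump is left open, which is
  harmless because the jumps are distinct and avoid the end points.\<close>

lemma prod_step_jumps:
  fixes h :: "'e \<Rightarrow> real \<Rightarrow> real"
  assumes "finite B"
    and "\<And>e t. e \<in> B \<Longrightarrow> J e = 0 \<or> t \<noteq> \<tau> e \<Longrightarrow> h e t = \<alpha> e + J e * of_bool (\<tau> e < t)"
    and "\<And>e f. e \<in> B \<Longrightarrow> f \<in> B \<Longrightarrow> e \<noteq> f \<Longrightarrow> J e \<noteq> 0 \<Longrightarrow> J f \<noteq> 0 \<Longrightarrow> \<tau> e \<noteq> \<tau> f"
    and "a < b" and "\<And>e. e \<in> B \<Longrightarrow> J e \<noteq> 0 \<Longrightarrow> \<tau> e \<noteq> a \<and> \<tau> e \<noteq> b"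
  shows "(\<Prod>e\<in>B. h e b) - (\<Prod>e\<in>B. h e a) =
    (\<Sum>e\<in>B. if a < \<tau> e \<and> \<tau> e < b then J e * (\<Prod>f\<in>B - {e}. h f (\<tau> e)) else 0)"
  using assms
proof (induction B arbitrary: a b rule: finite_induct)
  case empty
  then show ?case by simp
next
  case (insert g B)
  let ?H = "\<lambda>t. \<Prod>e\<in>B. h e t"
  let ?S = "\<lambda>a b. \<Sum>e\<in>B. if a < \<tau> e \<and> \<tau> e < b then J e * (\<Prod>f\<in>B - {e}. h f (\<tau> e)) else 0"
  have IH: "?H b' - ?H a' = ?S a' b'" if "a' < b'" "\<And>e. e \<in> B \<Longrightarrow> J e \<noteq> 0 \<Longrightarrow> \<tau> e \<noteq> a' \<and> \<tau> e \<noteq> b'" for a' b'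
    by (rule insert.IH) (use insert.prems that in auto)
  have hg: "h g t = \<alpha> g + J g * of_bool (\<tau> g < t)" if "J g = 0 \<or> t \<noteq> \<tau> g" for t
    using insert.prems(1) that by blast
  have pg: "(\<Prod>f\<in>insert g B - {e}. h f (\<tau> e)) = h g (\<tau> e) * (\<Prod>f\<in>B - {e}. h f (\<tau> e))" if "e \<in> B" for e
    using that insert.hyps by (subst insert_Diff_if) (auto simp: prod.insert)
  have split: "(\<Sum>e\<in>insert g B. if a < \<tau> e \<and> \<tau> e < b then J e * (\<Prod>f\<in>insert g B - {e}. h f (\<tau> e)) else 0)
    = (if a < \<tau> g \<and> \<tau> g < b then J g * ?H (\<tau> g) else 0) +
      (\<Sum>e\<in>B. if a < \<tau> e \<and> \<tau> e < b then J e * (h g (\<tau> e) * (\<Prod>f\<in>B - {e}. h f (\<tau> e))) else 0)"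
  proof -
    have "(\<Sum>e\<in>B. if a < \<tau> e \<and> \<tau> e < b then J e * (\<Prod>f\<in>insert g B - {e}. h f (\<tau> e)) else 0) =
      (\<Sum>e\<in>B. if a < \<tau> e \<and> \<tau> e < b then J e * (h g (\<tau> e) * (\<Prod>f\<in>B - {e}. h f (\<tau> e))) else 0)"
      by (rule sum.cong[OF refl]) (simp only: pg)
    moreover have "insert g B - {g} = B" using insert.hyps by blast
    ultimately show ?thesis by (subst sum.insert[OF insert.hyps]) (simp only:)
  qed
  show ?case
  proof (cases "J g \<noteq> 0 \<and> a < \<tau> g \<and> \<tau> g < b")
    case False
    have const: "h g t = h g a" if "a \<le> t" "t \<le> b" for t
    proof (cases "J g = 0")
      case True
      then show ?thesis using hg by simp
    next
      case J: False
      then have "\<tau> g < a \<or> b < \<tau> g" using False insert.prems(4)[of g] by auto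
      then show ?thesis using hg[of t] hg[of a] that by auto
    qed
    have "(\<Prod>e\<in>insert g B. h e b) - (\<Prod>e\<in>insert g B. h e a) = h g a * (?H b - ?H a)"
      using insert.hyps const[of b] insert.prems by (simp add: algebra_simps)
    also have "\<dots> = h g a * ?S a b" by (subst IH) (use insert.prems in auto)
    also have "\<dots> = (\<Sum>e\<in>B. if a < \<tau> e \<and> \<tau> e < b then J e * (h g (\<tau> e) * (\<Prod>f\<in>B - {e}. h f (\<tau> e))) else 0)"
      unfolding sum_distrib_left
    proof (rule sum.cong[OF refl])
      fix e
      show "h g a * (if a < \<tau> e \<and> \<tau> e < b then J e * (\<Prod>f\<in>B - {e}. h f (\<tau> e)) else 0) =
        (if a < \<tau> e \<and> \<tau> e < b then J e * (h g (\<tau> e) * (\<Prod>f\<in>B - {e}. h f (\<tau> e))) else 0)"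
        using const[of "\<tau> e"] by auto
    qed
    finally show ?thesis unfolding split using False by auto
  next
    case True
    \<comment> \<open>The interval is split at the jump of the new factor, which is constant on
      either side.\<close>
    define t where "t = \<tau> g"
    have t: "a < t" "t < b" "J g \<noteq> 0" using True by (auto simp: t_def)
    have tne: "\<tau> e \<noteq> t" if "e \<in> B" "J e \<noteq> 0" for e
      using insert.prems(2)[of e g] that insert.hyps t by (auto simp: t_def)
    have 1: "?H b - ?H t = ?S t b" by (rule IH) (use insert.prems t tne in auto)
    have 2: "?H t - ?H a = ?S a t" by (rule IH) (use insert.prems t tne in auto)
    have J: "h g b - h g a = J g" using hg[of a] hg[of b] t by (auto simp: t_def)
    have "(\<Prod>e\<in>insert g B. h e b) - (\<Prod>e\<in>insert g B. h e a) =
       h g b * (?H b - ?H t) + (h g b - h g a) * ?H t + h g a * (?H t - ?H a)"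
      using insert.hyps by (simp add: algebra_simps)
    also have "\<dots> = J g * ?H t + (h g b * ?S t b + h g a * ?S a t)"
      unfolding 1 2 J by simp
    also have "h g b * ?S t b + h g a * ?S a t =
      (\<Sum>e\<in>B. if a < \<tau> e \<and> \<tau> e < b then J e * (h g (\<tau> e) * (\<Prod>f\<in>B - {e}. h f (\<tau> e))) else 0)"
      unfolding sum_distrib_left sum.distrib[symmetric]
    proof (rule sum.cong[OF refl])
      fix e assume e: "e \<in> B"
      show "h g b * (if t < \<tau> e \<and> \<tau> e < b then J e * (\<Prod>f\<in>B - {e}. h f (\<tau> e)) else 0) +
         h g a * (if a < \<tau> e \<and> \<tau> e < t then J e * (\<Prod>f\<in>B - {e}. h f (\<tau> e)) else 0) =
         (if a < \<tau> e \<and> \<tau> e < b then J e * (h g (\<tau> e) * (\<Prod>f\<in>B - {e}. h f (\<tau> e))) else 0)"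
      proof (cases "J e = 0")
        case False
        then have ne: "\<tau> e \<noteq> t" using tne e by blast
        have "h g (\<tau> e) = h g b" if "t < \<tau> e"
          using hg[of "\<tau> e"] hg[of b] that t by (auto simp: t_def)
        moreover have "h g (\<tau> e) = h g a" if "\<tau> e < t"
          using hg[of "\<tau> e"] hg[of a] that t by (auto simp: t_def)
        ultimately show ?thesis using ne t by auto
      qed auto
    qed
    finally show ?thesis unfolding split using True by (simp add: t_def)
  qed
qed

text \<open>Each factor is the indicator of the half-space of \<open>e\<close> or, where the
  coordinate of \<open>\<zeta>\<close> is not positive, minus the indicator of its complement. So
  the product is, up to sign, the indicator of a cone at the vertex on which
  \<open>\<zeta> \<bullet> x\<close> is at most its value at the vertex.\<close>

definition cone_sign :: "real ^ 'n::finite edge \<Rightarrow> real ^ 'n \<Rightarrow> real ^ 'n \<Rightarrow> 'n edge set \<Rightarrow> real" where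
  "cone_sign c x \<zeta> B = (\<Prod>e\<in>B. of_bool (\<zeta> \<bullet> dual_vec B e > 0) - of_bool (\<not> edge_vec e \<bullet> x \<le> c $ e))"

definition generic :: "real ^ 'n::finite edge \<Rightarrow> real ^ 'n \<Rightarrow> bool" where
  "generic c \<zeta> \<longleftrightarrow> (\<forall>B\<in>vertex_bases c. \<forall>e\<in>B. \<zeta> \<bullet> dual_vec B e \<noteq> 0)"

text \<open>
  Along a segment of directions the signed cones change only when a coordinate with respect
  to some vertex basis vanishes, and there the two vertices sharing the ridge cancel.
\<close>

lemma sum_cone_sign_independent:
  fixes c :: "real ^ 'n::finite edge"
  assumes simp: "simple_polytrope c" and gen: "generic c \<xi>" "generic c \<eta>"
    and gen2: "\<And>B e f. B \<in> vertex_bases c \<Longrightarrow> e \<in> B \<Longrightarrow> f \<in> B \<Longrightarrow> e \<noteq> f \<Longrightarrow>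
      (\<xi> \<bullet> dual_vec B e) * (\<eta> \<bullet> dual_vec B f) \<noteq> (\<xi> \<bullet> dual_vec B f) * (\<eta> \<bullet> dual_vec B e)"
  shows "(\<Sum>B\<in>vertex_bases c. cone_sign c x \<xi> B) = (\<Sum>B\<in>vertex_bases c. cone_sign c x \<eta> B)"
proof -
  define X Y where "X B e = \<xi> \<bullet> dual_vec B e" and "Y B e = \<eta> \<bullet> dual_vec B e" for B e
  define p where "p t = (1 - t) *\<^sub>R \<xi> + t *\<^sub>R \<eta>" for t
  define viol where "viol e = (of_bool (\<not> edge_vec e \<bullet> x \<le> c $ e) :: real)" for e
  define h where "h B e t = of_bool (p t \<bullet> dual_vec B e > 0) - viol e" for B e t
  define J :: "'n edge set \<Rightarrow> 'n edge \<Rightarrow> real"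
    where "J B e = of_bool (X B e < 0 \<and> 0 < Y B e) - of_bool (Y B e < 0 \<and> 0 < X B e)" for B e
  \<comment> \<open>The time at which the coordinate of \<open>p t\<close> vanishes. It lies
    strictly between 0 and 1 whenever the sign really changes.\<close>
  define \<tau> where "\<tau> B e = X B e / (X B e - Y B e)" for B e
  define T where "T B e = J B e * (\<Prod>f\<in>B - {e}. h B f (\<tau> B e))" for B e
  have pd: "p t \<bullet> dual_vec B e = X B e - t * (X B e - Y B e)" for t B e
    by (simp add: p_def X_def Y_def inner_add_left algebra_simps)
  have nz: "X B e \<noteq> 0" "Y B e \<noteq> 0" if "B \<in> vertex_bases c" "e \<in> B" for B e
    using gen that by (auto simp: generic_def X_def Y_def)
  have hform: "h B e t = (of_bool (X B e > 0) - viol e) + J B e * of_bool (\<tau> B e < t)"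
    if B: "B \<in> vertex_bases c" "e \<in> B" and t: "0 \<le> t" "t \<le> 1" "J B e = 0 \<or> t \<noteq> \<tau> B e" for B e t
  proof (cases "J B e = 0")
    case True
    then have same: "X B e > 0 \<longleftrightarrow> Y B e > 0" using nz[OF B] by (auto simp: J_def of_bool_def split: if_splits)
    have pd': "p t \<bullet> dual_vec B e = (1 - t) * X B e + t * Y B e" by (simp add: pd algebra_simps)
    have "p t \<bullet> dual_vec B e > 0 \<longleftrightarrow> X B e > 0"
    proof (cases "X B e > 0")
      case True
      then have "Y B e > 0" using same by blast
      then have "(1 - t) * X B e + t * Y B e > 0"
        using True t by (cases "t = 0") (auto intro!: add_nonneg_pos)
      then show ?thesis using True pd' by simp
    next
      case False
      then have "X B e \<le> 0" "Y B e \<le> 0" using same by auto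
      then have "(1 - t) * X B e + t * Y B e \<le> 0"
        using t by (intro add_nonpos_nonpos mult_nonneg_nonpos) auto
      then show ?thesis using False pd' by simp
    qed
    then show ?thesis using True by (simp add: h_def)
  next
    case False
    then have tn: "t \<noteq> \<tau> B e" using t by blast
    consider "X B e < 0" "0 < Y B e" | "Y B e < 0" "0 < X B e"
      using False by (auto simp: J_def of_bool_def split: if_splits)
    then show ?thesis
    proof cases
      case 1
      then have "p t \<bullet> dual_vec B e > 0 \<longleftrightarrow> \<tau> B e < t"
        by (simp add: pd \<tau>_def neg_divide_less_eq)
      then show ?thesis using 1 by (simp add: h_def J_def)
    next
      case 2
      then have "p t \<bullet> dual_vec B e > 0 \<longleftrightarrow> t < \<tau> B e"
        by (simp add: pd \<tau>_def pos_less_divide_eq)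
      then show ?thesis using 2 tn by (auto simp: h_def J_def)
    qed
  qed
  have \<tau>01: "0 < \<tau> B e \<and> \<tau> B e < 1 \<and> p (\<tau> B e) \<bullet> dual_vec B e = 0" if "J B e \<noteq> 0" for B e
    using that unfolding J_def pd
    by (auto simp: \<tau>_def divide_simps of_bool_def split: if_splits)
  \<comment> \<open>This is what the second genericity condition is for: no two coordinates at one
    vertex vanish at the same time.\<close>
  have \<tau>ne: "\<tau> B e \<noteq> \<tau> B f" if "B \<in> vertex_bases c" "e \<in> B" "f \<in> B" "e \<noteq> f" "J B e \<noteq> 0" "J B f \<noteq> 0" for B e f
  proof
    assume eq: "\<tau> B e = \<tau> B f"
    have "X B e - Y B e \<noteq> 0" "X B f - Y B f \<noteq> 0" using that(5,6) by (auto simp: J_def)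
    then have "X B e * (X B f - Y B f) = X B f * (X B e - Y B e)"
      using eq by (simp add: \<tau>_def frac_eq_eq)
    then have "X B e * Y B f = X B f * Y B e" by (simp add: algebra_simps)
    then show False using gen2[OF that(1-4)] by (simp add: X_def Y_def)
  qed
  have main: "cone_sign c x \<eta> B - cone_sign c x \<xi> B = (\<Sum>e\<in>B. T B e)" if B: "B \<in> vertex_bases c" for B
  proof -
    \<comment> \<open>The description of \<open>h\<close> as a step function holds for times in the
      unit interval. Outside it, \<open>g\<close> continues by that description, as
      \<open>prod_step_jumps\<close> asks for all times.\<close>
    define g where "g e t = (if 0 \<le> t \<and> t \<le> 1 then h B e t else
      (of_bool (X B e > 0) - viol e) + J B e * of_bool (\<tau> B e < t))" for e t
    have "(\<Prod>e\<in>B. g e 1) - (\<Prod>e\<in>B. g e 0) =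
      (\<Sum>e\<in>B. if 0 < \<tau> B e \<and> \<tau> B e < 1 then J B e * (\<Prod>f\<in>B - {e}. g f (\<tau> B e)) else 0)"
    proof (rule prod_step_jumps[where \<alpha> = "\<lambda>e. of_bool (X B e > 0) - viol e"])
      show "g e t = of_bool (X B e > 0) - viol e + J B e * of_bool (\<tau> B e < t)"
        if "e \<in> B" "J B e = 0 \<or> t \<noteq> \<tau> B e" for e t
        using hform[OF B that(1) _ _ that(2)] by (auto simp: g_def)
      show "\<tau> B e \<noteq> 0 \<and> \<tau> B e \<noteq> 1" if "e \<in> B" "J B e \<noteq> 0" for e
        using \<tau>01[OF that(2)] by auto
    qed (use \<tau>ne[OF B] in auto)
    also have "\<dots> = (\<Sum>e\<in>B. T B e)"
    proof (rule sum.cong[OF refl])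
      fix e assume "e \<in> B"
      show "(if 0 < \<tau> B e \<and> \<tau> B e < 1 then J B e * (\<Prod>f\<in>B - {e}. g f (\<tau> B e)) else 0) = T B e"
        using \<tau>01[of B e] by (cases "J B e = 0") (auto simp: T_def g_def)
    qed
    also have "(\<Prod>e\<in>B. g e 1) = cone_sign c x \<eta> B"
      by (simp add: cone_sign_def g_def h_def viol_def p_def)
    also have "(\<Prod>e\<in>B. g e 0) = cone_sign c x \<xi> B"
      by (simp add: cone_sign_def g_def h_def viol_def p_def)
    finally show ?thesis .
  qed
  have "(\<Sum>B\<in>vertex_bases c. \<Sum>e\<in>B. T B e) = 0"
  proof (rule ridge_cancel[OF simp])
    fix B e B' f
    assume a: "B \<in> vertex_bases c" "e \<in> B" "B' \<in> vertex_bases c" "f \<in> B'"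
      "B' - {f} = B - {e}" "dual_vec B' f = - dual_vec B e"
    have X: "X B' f = - X B e" "Y B' f = - Y B e" using a(6) by (auto simp: X_def Y_def)
    then have J: "J B' f = - J B e" by (auto simp: J_def)
    have t: "\<tau> B' f = \<tau> B e"
      unfolding \<tau>_def X by (metis minus_diff_minus minus_divide_divide)
    show "T B' f = - T B e"
    proof (cases "J B e = 0")
      case False
      \<comment> \<open>At the common time \<open>p t\<close> lies in the span of the ridge, so the
        remaining factors agree at both vertices, while the jumps are opposite.\<close>
      have "h B' g (\<tau> B e) = h B g (\<tau> B e)" if "g \<in> B - {e}" for g
        unfolding h_def
        by (subst coord_on_ridge[OF _ _ a(2,4,5) _ that])
          (use \<tau>01[OF False] vertex_bases_basis[OF simp] a in auto)
      then show ?thesis unfolding T_def J t a(5) by simp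
    qed (simp add: T_def J)
  qed
  then have "(\<Sum>B\<in>vertex_bases c. cone_sign c x \<eta> B - cone_sign c x \<xi> B) = 0"
    using main by simp
  then show ?thesis by (simp add: sum_subtractf)
qed

section \<open>Optimal vertices and the cone decomposition\<close>

lemma exists_off_hyperplanes:
  fixes U D :: "(real ^ 'n::finite) set"
  assumes "open U" "U \<noteq> {}" "finite D" "0 \<notin> D"
  obtains \<eta> where "\<eta> \<in> U" "\<And>d. d \<in> D \<Longrightarrow> \<eta> \<bullet> d \<noteq> 0"
proof -
  have "negligible (\<Union>d\<in>D. {x. d \<bullet> x = 0})"
    by (intro negligible_Union) (use assms in \<open>auto intro!: negligible_hyperplane\<close>)
  then have "\<not> U \<subseteq> (\<Union>d\<in>D. {x. d \<bullet> x = 0})"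
    using negligible_subset open_not_negligible assms(1,2) by blast
  then obtain \<eta> where "\<eta> \<in> U" "\<eta> \<notin> (\<Union>d\<in>D. {x. d \<bullet> x = 0})" by blast
  then show ?thesis using that[of \<eta>] by (auto simp: inner_commute)
qed

text \<open>At a vertex maximising \<open>\<zeta>\<close>, no step to a neighbour, which goes in
  direction \<open>- dual_vec\<close>, can increase the value.\<close>

lemma exists_maximal_basis:
  assumes simp: "simple_polytrope c" and ne: "vertex_bases c \<noteq> {}"
  obtains v where "v extreme_point_of polytrope c"
    "\<And>e. e \<in> incident_facets c v \<Longrightarrow> \<zeta> \<bullet> dual_vec (incident_facets c v) e \<ge> 0"
proof -
  let ?X = "{v. v extreme_point_of polytrope c}"
  have X: "finite ?X" "?X \<noteq> {}" using ne finite_extreme_points by (auto simp: vertex_bases_def)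
  define M where "M = Max ((\<bullet>) \<zeta> ` ?X)"
  have "M \<in> (\<bullet>) \<zeta> ` ?X" unfolding M_def using X by (intro Max_in) auto
  then obtain v where v: "v \<in> ?X" "\<zeta> \<bullet> v = M" by blast
  have le: "\<zeta> \<bullet> w \<le> M" if "w \<in> ?X" for w unfolding M_def using X that by (intro Max_ge) auto
  show ?thesis
  proof (rule that[of v])
    fix e assume e: "e \<in> incident_facets c v"
    obtain s f where sf: "s > 0" "(v - s *\<^sub>R dual_vec (incident_facets c v) e) extreme_point_of polytrope c"
      using ridge_neighbour[OF simp _ e] v(1) by (metis mem_Collect_eq)
    show "\<zeta> \<bullet> dual_vec (incident_facets c v) e \<ge> 0"
      using le[of "v - s *\<^sub>R dual_vec (incident_facets c v) e"] sf v(2)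
      by (simp add: inner_diff_right zero_le_mult_iff)
  qed (use v in simp)
qed

lemma inner_vertex:
  assumes "edge_basis (incident_facets c v)"
  shows "\<zeta> \<bullet> v = (\<Sum>e\<in>incident_facets c v. (\<zeta> \<bullet> dual_vec (incident_facets c v) e) * c $ e)"
  by (subst inner_expand[OF assms]) (auto simp: mem_incident_facets intro: sum.cong)

text \<open>Complementary slackness: a vertex whose coordinates of \<open>\<xi>\<close> are all
  positive is the only maximiser of \<open>\<xi>\<close> on the polytrope.\<close>

lemma positive_basis_unique:
  fixes c :: "real ^ 'n::finite edge"
  assumes simp: "simple_polytrope c" and B: "B \<in> vertex_bases c" and B': "B' \<in> vertex_bases c"
    and pos: "\<And>e. e \<in> B \<Longrightarrow> \<xi> \<bullet> dual_vec B e > 0"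
    and pos': "\<And>e. e \<in> B' \<Longrightarrow> \<xi> \<bullet> dual_vec B' e > 0"
  shows "B = B'"
proof (rule ccontr)
  assume ne: "B \<noteq> B'"
  obtain v w where v: "v extreme_point_of polytrope c" "B = incident_facets c v"
    and w: "w extreme_point_of polytrope c" "B' = incident_facets c w"
    using B B' by (auto simp: vertex_bases_def)
  have bas: "edge_basis B" "edge_basis B'" using vertex_bases_basis[OF simp] B B' by auto
  have wP: "w \<in> polytrope c" "v \<in> polytrope c" using w v by (auto simp: extreme_point_iff_span)
  have "\<xi> \<bullet> v = (\<Sum>e\<in>B'. (\<xi> \<bullet> dual_vec B' e) * (edge_vec e \<bullet> v))"
    by (rule inner_expand[OF bas(2)])
  also have "\<dots> \<le> (\<Sum>e\<in>B'. (\<xi> \<bullet> dual_vec B' e) * c $ e)"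
    using wP pos' by (intro sum_mono mult_left_mono) (auto simp: mem_polytrope less_imp_le)
  also have "\<dots> = \<xi> \<bullet> w" using inner_vertex[of c w \<xi>] bas w by simp
  finally have le: "\<xi> \<bullet> v \<le> \<xi> \<bullet> w" .
  have "\<exists>e\<in>B. edge_vec e \<bullet> w < c $ e"
  proof (rule ccontr)
    assume "\<not> ?thesis"
    then have "B \<subseteq> incident_facets c w"
      using wP by (meson antisym mem_incident_facets mem_polytrope not_less subsetI)
    then have "v = w" using extreme_point_incident_inj[OF v(1) wP(1)] v(2) by blast
    then show False using ne v w by simp
  qed
  then obtain e where e: "e \<in> B" "edge_vec e \<bullet> w < c $ e" by blast
  have "\<xi> \<bullet> w = (\<Sum>e\<in>B. (\<xi> \<bullet> dual_vec B e) * (edge_vec e \<bullet> w))"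
    by (rule inner_expand[OF bas(1)])
  also have "\<dots> < (\<Sum>e\<in>B. (\<xi> \<bullet> dual_vec B e) * c $ e)"
  proof (rule sum_strict_mono_ex1)
    show "\<forall>e\<in>B. (\<xi> \<bullet> dual_vec B e) * (edge_vec e \<bullet> w) \<le> (\<xi> \<bullet> dual_vec B e) * c $ e"
      using wP pos by (auto simp: mem_polytrope less_imp_le intro!: mult_left_mono)
    show "\<exists>e\<in>B. (\<xi> \<bullet> dual_vec B e) * (edge_vec e \<bullet> w) < (\<xi> \<bullet> dual_vec B e) * c $ e"
      using e pos by (intro bexI[of _ e]) auto
  qed simp
  also have "\<dots> = \<xi> \<bullet> v" using inner_vertex[of c v \<xi>] bas v by simp
  finally show False using le by simp
qed

text \<open>At a point of the polytrope nothing is violated, so only the vertex with all coordinates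
  positive contributes. For a point outside, the direction is replaced by one for which the point
  lies beyond all vertices; then no cone reaches it.\<close>

lemma sum_cone_sign:
  fixes c :: "real ^ 'n::finite edge"
  assumes simp: "simple_polytrope c" and ne: "vertex_bases c \<noteq> {}" and gen: "generic c \<xi>"
  shows "(\<Sum>B\<in>vertex_bases c. cone_sign c x \<xi> B) = indicator (polytrope c) x"
proof (cases "x \<in> polytrope c")
  case True
  obtain v where v: "v extreme_point_of polytrope c"
    and nn: "\<And>e. e \<in> incident_facets c v \<Longrightarrow> \<xi> \<bullet> dual_vec (incident_facets c v) e \<ge> 0"
    using exists_maximal_basis[OF simp ne] by blast
  let ?B = "incident_facets c v"
  have B: "?B \<in> vertex_bases c" using v by (auto simp: vertex_bases_def)
  have pos: "\<xi> \<bullet> dual_vec ?B e > 0" if "e \<in> ?B" for e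
    using nn[OF that] gen B that by (force simp: generic_def)
  have cs: "cone_sign c x \<xi> B' = (if B' = ?B then 1 else 0)" if B': "B' \<in> vertex_bases c" for B'
  proof (cases "B' = ?B")
    case True
    then show ?thesis using pos \<open>x \<in> polytrope c\<close> by (simp add: cone_sign_def mem_polytrope)
  next
    case False
    obtain w where w: "w extreme_point_of polytrope c" "B' = incident_facets c w"
      using B' by (auto simp: vertex_bases_def)
    have bas: "edge_basis ?B" "edge_basis B'" using vertex_bases_basis[OF simp] B B' by auto
    have "\<exists>e\<in>B'. \<not> \<xi> \<bullet> dual_vec B' e > 0"
      using positive_basis_unique[OF simp B B', of \<xi>] pos False by blast
    then obtain e where e: "e \<in> B'" "\<not> \<xi> \<bullet> dual_vec B' e > 0" by blast
    have "cone_sign c x \<xi> B' = 0"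
      unfolding cone_sign_def by (rule prod_zero)
        (use e \<open>x \<in> polytrope c\<close> in \<open>auto simp: mem_polytrope intro!: bexI[of _ e]\<close>)
    then show ?thesis using False by simp
  qed
  then show ?thesis using B True by (simp add: cs)
next
  case False
  let ?X = "{v. v extreme_point_of polytrope c}"
  obtain a b where ab: "a \<bullet> x < b" "\<And>y. y \<in> polytrope c \<Longrightarrow> a \<bullet> y > b"
    using separating_hyperplane_closed_point[OF convex_polytrope _ False]
      compact_imp_closed[OF compact_polytrope] by blast
  \<comment> \<open>The directions in which \<open>x\<close> lies strictly beyond every
    vertex.\<close>
  define U where "U = (\<Inter>v\<in>?X. {\<eta>. \<eta> \<bullet> (x - v) > 0})"
  have "open {\<eta>. \<eta> \<bullet> (x - v) > 0}" for v
    using open_halfspace_gt[of 0 "x - v"] by (simp add: inner_commute)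
  then have "open U" unfolding U_def using finite_extreme_points by (intro open_INT) auto
  moreover have "- a \<in> U"
    using ab by (fastforce simp: U_def extreme_point_iff_span inner_diff_right)
  \<comment> \<open>Avoiding the hyperplanes orthogonal to \<open>D\<close> ensures both genericity
    conditions for passing from \<open>\<xi>\<close> to \<open>\<eta>\<close>: no coordinate
    vanishes, and no two vanish simultaneously on the way.\<close>
  moreover define D where "D = (\<Union>B\<in>vertex_bases c. dual_vec B ` B \<union>
    (\<lambda>(e, f). (\<xi> \<bullet> dual_vec B e) *\<^sub>R dual_vec B f - (\<xi> \<bullet> dual_vec B f) *\<^sub>R dual_vec B e) ` (B \<times> B - Id))"
  have "0 \<notin> D"
  proof
    assume "0 \<in> D"
    then obtain B where B: "B \<in> vertex_bases c"
      and alt: "(\<exists>e\<in>B. dual_vec B e = 0) \<or> (\<exists>e\<in>B. \<exists>f\<in>B. e \<noteq> f \<and>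
        (\<xi> \<bullet> dual_vec B e) *\<^sub>R dual_vec B f - (\<xi> \<bullet> dual_vec B f) *\<^sub>R dual_vec B e = 0)"
      by (fastforce simp: D_def)
    have bas: "edge_basis B" using vertex_bases_basis[OF simp B] .
    from alt show False
    proof (elim disjE bexE conjE)
      fix e assume e: "e \<in> B" "dual_vec B e = 0"
      then show False using inner_dual_vec[OF bas e(1) e(1)] by simp
    next
      fix e f assume ef: "e \<in> B" "f \<in> B" "e \<noteq> f"
        "(\<xi> \<bullet> dual_vec B e) *\<^sub>R dual_vec B f - (\<xi> \<bullet> dual_vec B f) *\<^sub>R dual_vec B e = 0"
      then have "edge_vec f \<bullet> ((\<xi> \<bullet> dual_vec B e) *\<^sub>R dual_vec B f - (\<xi> \<bullet> dual_vec B f) *\<^sub>R dual_vec B e) = 0"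
        by simp
      then have "\<xi> \<bullet> dual_vec B e = 0"
        using inner_dual_vec[OF bas ef(2,2)] inner_dual_vec[OF bas ef(1,2)] ef(3)
        by (simp add: inner_diff_right)
      then show False using gen B ef(1) by (simp add: generic_def)
    qed
  qed
  moreover have "finite D" by (auto simp: D_def)
  ultimately obtain \<eta> where \<eta>: "\<eta> \<in> U" "\<And>d. d \<in> D \<Longrightarrow> \<eta> \<bullet> d \<noteq> 0"
    using exists_off_hyperplanes[of U D] by blast
  have "generic c \<eta>" using \<eta>(2) by (auto simp: generic_def D_def)
  moreover have "(\<xi> \<bullet> dual_vec B e) * (\<eta> \<bullet> dual_vec B f) \<noteq> (\<xi> \<bullet> dual_vec B f) * (\<eta> \<bullet> dual_vec B e)"
    if "B \<in> vertex_bases c" "e \<in> B" "f \<in> B" "e \<noteq> f" for B e f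
  proof -
    have "(\<xi> \<bullet> dual_vec B e) *\<^sub>R dual_vec B f - (\<xi> \<bullet> dual_vec B f) *\<^sub>R dual_vec B e \<in> D"
      using that unfolding D_def by force
    from \<eta>(2)[OF this] show ?thesis by (simp add: inner_diff_right)
  qed
  ultimately have "(\<Sum>B\<in>vertex_bases c. cone_sign c x \<xi> B) = (\<Sum>B\<in>vertex_bases c. cone_sign c x \<eta> B)"
    by (intro sum_cone_sign_independent[OF simp gen])
  also have "\<dots> = 0"
  proof (rule sum.neutral, rule ballI, rule ccontr)
    fix B assume B: "B \<in> vertex_bases c" and nz: "cone_sign c x \<eta> B \<noteq> 0"
    obtain v where v: "v \<in> ?X" "B = incident_facets c v" using B by (auto simp: vertex_bases_def)
    have bas: "edge_basis B" using vertex_bases_basis[OF simp B] .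
    have "(\<eta> \<bullet> dual_vec B e) * (edge_vec e \<bullet> x) \<le> (\<eta> \<bullet> dual_vec B e) * c $ e" if "e \<in> B" for e
    proof -
      have "of_bool (\<eta> \<bullet> dual_vec B e > 0) - of_bool (\<not> edge_vec e \<bullet> x \<le> c $ e) \<noteq> (0::real)"
        using nz that unfolding cone_sign_def by (metis (mono_tags, lifting) finite prod_zero)
      then show ?thesis
        by (cases "\<eta> \<bullet> dual_vec B e > 0"; cases "edge_vec e \<bullet> x \<le> c $ e")
          (auto simp: mult_left_mono mult_left_mono_neg not_less)
    qed
    then have "\<eta> \<bullet> x \<le> \<eta> \<bullet> v"
      using inner_vertex[of c v \<eta>] inner_expand[OF bas, of \<eta> x] bas v by (auto intro!: sum_mono)
    moreover have "\<eta> \<bullet> (x - v) > 0" using \<eta>(1) v(1) by (auto simp: U_def)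
    ultimately show False by (simp add: inner_diff_right)
  qed
  finally show ?thesis using False by simp
qed

section \<open>The volume of a simple polytrope\<close>

lemma det_Ints:
  fixes A :: "real ^ 'n::finite ^ 'n"
  assumes "\<And>i j. A $ i $ j \<in> \<int>" shows "det A \<in> \<int>"
  unfolding det_def using assms by (intro Ints_sum Ints_mult Ints_prod) auto

lemma abs_det_unimodular:
  fixes A U :: "real ^ 'n::finite ^ 'n"
  assumes "\<And>i j. A $ i $ j \<in> \<int>" "\<And>i j. U $ i $ j \<in> \<int>" "U ** A = mat 1"
  shows "\<bar>det A\<bar> = 1"
proof -
  have "det U * det A = 1" using assms(3) det_mul[of U A] by simp
  moreover have "det U \<in> \<int>" "det A \<in> \<int>" using assms by (auto intro: det_Ints)
  ultimately obtain m k :: int where mk: "det U = of_int m" "det A = of_int k" "m * k = 1"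
    by (metis Ints_cases of_int_eq_1_iff of_int_mult)
  then have "k = 1 \<or> k = -1" by (auto simp: zmult_eq_1_iff)
  then show ?thesis using mk(2) by auto
qed

text \<open>
  The change of variables theorems of the library need a well-ordered index type, so the
  index type is replaced by a well-ordered copy.
\<close>

typedef 'a wo_copy = "UNIV :: 'a set" morphisms of_copy to_copy ..

definition copy_index :: "'a::finite \<Rightarrow> nat" where
  "copy_index = (SOME f. inj f)"

lemma inj_copy_index: "inj (copy_index :: 'a::finite \<Rightarrow> nat)"
proof -
  obtain f :: "'a \<Rightarrow> nat" where "inj f"
    using finite_imp_inj_to_nat_seg[OF finite_class.finite_UNIV] by blast
  then show ?thesis unfolding copy_index_def by (rule someI[where P = inj])
qed

instance wo_copy :: (finite) finite
proof
  have "UNIV = to_copy ` (UNIV :: 'a set)" by (metis UNIV_I of_copy_inverse surjI)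
  then show "finite (UNIV :: 'a wo_copy set)" by (metis finite finite_imageI)
qed

instantiation wo_copy :: (finite) wellorder
begin

definition less_eq_wo_copy :: "'a wo_copy \<Rightarrow> 'a wo_copy \<Rightarrow> bool" where
  "less_eq_wo_copy x y \<longleftrightarrow> copy_index (of_copy x) \<le> copy_index (of_copy y)"

definition less_wo_copy :: "'a wo_copy \<Rightarrow> 'a wo_copy \<Rightarrow> bool" where
  "less_wo_copy x y \<longleftrightarrow> copy_index (of_copy x) < copy_index (of_copy y)"

instance
proof
  fix P :: "'a wo_copy \<Rightarrow> bool" and a
  assume step: "\<And>x. (\<And>y. y < x \<Longrightarrow> P y) \<Longrightarrow> P x"
  show "P a"
    by (induction a rule: measure_induct_rule[where f = "\<lambda>x. copy_index (of_copy x)"])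
      (rule step, simp add: less_wo_copy_def)
qed (auto simp: less_eq_wo_copy_def less_wo_copy_def of_copy_inject dest: injD[OF inj_copy_index])

end

lemma bij_of_copy: "bij (of_copy :: 'a wo_copy \<Rightarrow> 'a)"
  by (rule bijI') (auto simp: of_copy_inject intro: to_copy_inverse[symmetric])

definition from_copy :: "real ^ 'n::finite wo_copy \<Rightarrow> real ^ 'n" where
  "from_copy y = (\<chi> k. y $ to_copy k)"

definition into_copy :: "real ^ 'n::finite \<Rightarrow> real ^ 'n wo_copy" where
  "into_copy x = (\<chi> k. x $ of_copy k)"

lemma from_into_copy [simp]: "from_copy (into_copy x) = x" "into_copy (from_copy y) = y"
  by (simp_all add: from_copy_def into_copy_def vec_eq_iff to_copy_inverse of_copy_inverse)

lemma prod_Basis_cart: "(\<Prod>b\<in>Basis. (x :: real ^ 'n::finite) \<bullet> b) = (\<Prod>k\<in>UNIV. x $ k)"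
proof -
  have B: "(Basis :: (real ^ 'n) set) = (\<lambda>k. axis k 1) ` UNIV" by (auto simp: Basis_vec_def)
  have "inj (\<lambda>k::'n. axis k (1::real))" by (auto simp: inj_def axis_eq_axis)
  then show ?thesis unfolding B by (subst prod.reindex) (auto simp: inner_axis)
qed

lemma linear_copy: "linear from_copy" "linear into_copy"
  by (auto intro!: linearI simp: from_copy_def into_copy_def vec_eq_iff)

lemma compact_linear_image:
  fixes f :: "'a::euclidean_space \<Rightarrow> 'b::euclidean_space"
  shows "linear f \<Longrightarrow> compact S \<Longrightarrow> compact (f ` S)"
  by (intro compact_continuous_image linear_continuous_on) (simp_all add: linear_conv_bounded_linear)

lemma from_copy_measurable: "from_copy \<in> borel_measurable (lborel :: (real ^ 'n::finite wo_copy) measure)"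
  using borel_measurable_continuous_onI[OF linear_continuous_on[OF linear_conv_bounded_linear[THEN iffD1, OF linear_copy(1)]]]
  by simp

lemma lborel_from_copy: "lborel = distr lborel borel (from_copy :: real ^ 'n::finite wo_copy \<Rightarrow> _)"
proof (rule lborel_eqI)
  fix l u :: "real ^ 'n"
  assume lu: "\<And>b. b \<in> Basis \<Longrightarrow> l \<bullet> b \<le> u \<bullet> b"
  have lu': "l $ k \<le> u $ k" for k using lu[of "axis k 1"] by (auto simp: inner_axis Basis_vec_def)
  have all: "(\<forall>k. P k (to_copy k)) \<longleftrightarrow> (\<forall>k. P (of_copy k) k)" for P :: "'n \<Rightarrow> 'n wo_copy \<Rightarrow> bool"
    by (metis UNIV_I of_copy_inverse to_copy_inverse)
  have "from_copy -` box l u = box (into_copy l) (into_copy u)"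
    using all[of "\<lambda>i k. l $ i < x $ k \<and> x $ k < u $ i" for x]
    by (auto simp: mem_box_cart from_copy_def into_copy_def)
  then have "emeasure (distr lborel borel from_copy) (box l u) = emeasure lborel (box (into_copy l) (into_copy u))"
    by (subst emeasure_distr[OF from_copy_measurable]) auto
  also have "\<dots> = (\<Prod>b\<in>Basis. (into_copy u - into_copy l) \<bullet> b)"
    using lu' by (intro emeasure_lborel_box) (auto simp: Basis_vec_def inner_axis into_copy_def)
  also have "(\<Prod>b\<in>Basis. (into_copy u - into_copy l) \<bullet> b) = (\<Prod>k\<in>UNIV. (u - l) $ of_copy k)"
    by (simp add: prod_Basis_cart into_copy_def)
  also have "\<dots> = (\<Prod>k\<in>UNIV. (u - l) $ k)"
    by (rule prod.reindex_bij_betw[OF bij_of_copy])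
  also have "\<dots> = (\<Prod>b\<in>Basis. (u - l) \<bullet> b)" by (simp only: prod_Basis_cart)
  finally show "emeasure (distr lborel borel from_copy) (box l u) = (\<Prod>b\<in>Basis. (u - l) \<bullet> b)" .
qed simp

lemma measure_from_copy:
  fixes S :: "(real ^ 'n::finite) set"
  assumes "compact S"
  shows "measure lebesgue S = measure lebesgue (into_copy ` S)"
proof -
  have "compact (into_copy ` S)"
    by (rule compact_linear_image[OF linear_copy(2) assms])
  then have borel: "S \<in> sets borel" "into_copy ` S \<in> sets borel"
    using assms by (auto intro: borel_compact)
  have "from_copy -` S = into_copy ` S" by (auto simp: image_iff) (metis from_into_copy(2))
  moreover have "measure lborel S = measure (distr lborel borel (from_copy :: real ^ 'n wo_copy \<Rightarrow> _)) S"
    by (subst lborel_from_copy) simp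
  ultimately have "measure lborel S = measure lborel (into_copy ` S)"
    using borel by (simp add: measure_distr[OF from_copy_measurable])
  then show ?thesis using borel by simp
qed

lemma measure_unimodular_image:
  fixes A U :: "real ^ 'n::finite ^ 'n"
  assumes A: "\<And>i j. A $ i $ j \<in> \<int>" and U: "\<And>i j. U $ i $ j \<in> \<int>" and UA: "U ** A = mat 1"
    and S: "compact S"
  shows "measure lebesgue ((*v) A ` S) = measure lebesgue S"
proof -
  define A' :: "real ^ 'n wo_copy ^ 'n wo_copy" where "A' = (\<chi> i j. A $ of_copy i $ of_copy j)"
  define U' :: "real ^ 'n wo_copy ^ 'n wo_copy" where "U' = (\<chi> i j. U $ of_copy i $ of_copy j)"
  have reidx: "(\<Sum>k\<in>UNIV. f (of_copy k)) = (\<Sum>k\<in>UNIV. f k)" for f :: "'n \<Rightarrow> real"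
    by (rule sum.reindex_bij_betw[OF bij_of_copy])
  have "(U' ** A') $ i $ j = (U ** A) $ of_copy i $ of_copy j" for i j
    using reidx[of "\<lambda>k. U $ of_copy i $ k * A $ k $ of_copy j"]
    by (simp add: U'_def A'_def matrix_matrix_mult_def)
  then have "U' ** A' = mat 1" unfolding UA by (auto simp: vec_eq_iff mat_def of_copy_inject)
  then have det: "\<bar>det A'\<bar> = 1"
    by (rule abs_det_unimodular[rotated 2]) (auto simp: A'_def U'_def A U)
  have conj: "into_copy (A *v x) = A' *v into_copy x" for x
    using reidx[of "\<lambda>k. A $ _ $ k * x $ k"]
    by (simp add: into_copy_def A'_def matrix_vector_mult_def vec_eq_iff)
  have cS: "compact (into_copy ` S)"
    by (rule compact_linear_image[OF linear_copy(2) S])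
  have "compact ((*v) A ` S)"
    by (rule compact_linear_image[OF matrix_vector_mul_linear S])
  then have "measure lebesgue ((*v) A ` S) = measure lebesgue (into_copy ` (*v) A ` S)"
    by (rule measure_from_copy)
  also have "into_copy ` (*v) A ` S = (*v) A' ` into_copy ` S"
    by (simp add: image_image conj)
  also have "measure lebesgue \<dots> = \<bar>det A'\<bar> * measure lebesgue (into_copy ` S)"
    by (subst measure_linear_image) (auto intro: lmeasurable_compact cS)
  also have "\<dots> = measure lebesgue S" using measure_from_copy[OF S] det by simp
  finally show ?thesis .
qed

section \<open>Volumes of truncated cones and of the polytrope\<close>

lemma std_simplex_cart:
  "convex hull (insert 0 Basis) = {y :: real ^ 'n::finite. (\<forall>k. 0 \<le> y $ k) \<and> (\<Sum>k\<in>UNIV. y $ k) \<le> 1}"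
proof -
  have B: "(Basis :: (real ^ 'n) set) = (\<lambda>k. axis k 1) ` UNIV" by (auto simp: Basis_vec_def)
  have "inj (\<lambda>k::'n. axis k (1::real))" by (auto simp: inj_def axis_eq_axis)
  then have sB: "sum ((\<bullet>) y) Basis = (\<Sum>k\<in>UNIV. y $ k)" for y :: "real ^ 'n"
    unfolding B by (subst sum.reindex) (auto simp: inner_axis)
  have "(\<forall>i\<in>Basis. 0 \<le> y \<bullet> i) \<longleftrightarrow> (\<forall>k. 0 \<le> y $ k)" for y :: "real ^ 'n"
    unfolding B by (simp add: inner_axis)
  then show ?thesis unfolding std_simplex sB by simp
qed

text \<open>The truncated cone is an affine image of the standard simplex. The linear part is a
  diagonal scaling followed by the matrix of dual vectors; the latter is unimodular, so only the
  scaling enters the volume.\<close>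

lemma truncated_cone_measure:
  fixes c :: "real ^ 'n::finite edge"
  assumes B: "edge_basis B" and v: "\<And>e. e \<in> B \<Longrightarrow> edge_vec e \<bullet> v = c $ e"
    and \<xi>: "\<And>e. e \<in> B \<Longrightarrow> \<xi> \<bullet> dual_vec B e \<noteq> 0" and T: "T > 0"
  defines "S \<equiv> {x. (\<forall>e\<in>B. (\<xi> \<bullet> dual_vec B e) * (c $ e - edge_vec e \<bullet> x) \<ge> 0) \<and> \<xi> \<bullet> x \<ge> \<xi> \<bullet> v - T}"
  shows "S \<in> lmeasurable" "measure lebesgue S = T ^ CARD('n) / (fact CARD('n) * (\<Prod>e\<in>B. \<bar>\<xi> \<bullet> dual_vec B e\<bar>))"
proof -
  have "card B = CARD('n)" using B by (simp add: edge_basis_def)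
  then obtain b where b: "bij_betw b (UNIV :: 'n set) B"
    by (metis finite_same_card_bij finite_class.finite_UNIV finite_vertex_bases(2))
  have bB: "b k \<in> B" for k using b by (auto simp: bij_betw_def)
  have binj: "b k = b l \<longleftrightarrow> k = l" for k l using b by (auto simp: bij_betw_def inj_def)
  have Bb: "\<exists>k. e = b k" if "e \<in> B" for e using b that by (auto simp: bij_betw_def)
  define z where "z k = \<xi> \<bullet> dual_vec B (b k)" for k
  have z: "z k \<noteq> 0" for k using \<xi>[OF bB] by (simp add: z_def)
  define Dm where "Dm = (\<chi> i k. dual_vec B (b k) $ i)"
  define Um where "Um = (\<chi> k i. edge_vec (b k) $ i)"
  \<comment> \<open>With the factors \<open>- (T / z k)\<close> the cone conditions become
    \<open>y $ k \<ge> 0\<close> and the cutting half-space becomes the condition that the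
    coordinates sum to at most 1.\<close>
  define Sm :: "real ^ 'n ^ 'n" where "Sm = (\<chi> k l. if k = l then - (T / z k) else 0)"
  have UD: "Um ** Dm = mat 1"
    using inner_dual_vec[OF B bB bB]
    by (simp add: Um_def Dm_def matrix_matrix_mult_def mat_def vec_eq_iff binj inner_vec_def of_bool_def)
  have Um: "Um $ i $ j \<in> \<int>" for i j by (auto simp: Um_def edge_vec_def vertex_vec_def)
  have Dm: "Dm $ i $ j \<in> \<int>" for i j
    using coord_dual_vec_Ints[OF B bB, of j "Some i"] by (simp add: Dm_def)
  define A where "A = Dm ** Sm"
  have uA: "edge_vec (b k) \<bullet> (A *v y) = - (T / z k) * y $ k" for k y
  proof -
    have "edge_vec (b k) \<bullet> (A *v y) = (Um *v (A *v y)) $ k"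
      by (simp add: Um_def matrix_vector_mult_def inner_vec_def)
    also have "\<dots> = (Sm *v y) $ k"
      by (simp add: A_def matrix_vector_mul_assoc matrix_mul_assoc UD)
    also have "\<dots> = - (T / z k) * y $ k"
      by (simp add: Sm_def matrix_vector_mult_def if_distrib[of "\<lambda>x. x * _"] cong: if_cong)
    finally show ?thesis .
  qed
  let ?\<Delta> = "convex hull (insert 0 Basis) :: (real ^ 'n) set"
  have mem: "v + A *v y \<in> S \<longleftrightarrow> y \<in> ?\<Delta>" for y
  proof -
    have "(\<forall>e\<in>B. (\<xi> \<bullet> dual_vec B e) * (c $ e - edge_vec e \<bullet> (v + A *v y)) \<ge> 0) \<longleftrightarrow>
        (\<forall>k. z k * (c $ b k - edge_vec (b k) \<bullet> (v + A *v y)) \<ge> 0)"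
      unfolding z_def using bB Bb by metis
    also have "\<dots> \<longleftrightarrow> (\<forall>k. 0 \<le> y $ k)"
      using T z by (simp add: inner_add_right v[OF bB] uA zero_le_mult_iff)
    finally have 1: "(\<forall>e\<in>B. (\<xi> \<bullet> dual_vec B e) * (c $ e - edge_vec e \<bullet> (v + A *v y)) \<ge> 0) \<longleftrightarrow> (\<forall>k. 0 \<le> y $ k)" .
    have "\<xi> \<bullet> (A *v y) = (\<Sum>e\<in>B. (\<xi> \<bullet> dual_vec B e) * (edge_vec e \<bullet> (A *v y)))"
      by (rule inner_expand[OF B])
    also have "\<dots> = (\<Sum>k\<in>UNIV. z k * (edge_vec (b k) \<bullet> (A *v y)))"
      unfolding z_def by (rule sum.reindex_bij_betw[OF b, symmetric])
    also have "\<dots> = - T * (\<Sum>k\<in>UNIV. y $ k)"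
      unfolding uA sum_distrib_left using z by (intro sum.cong) auto
    finally have "\<xi> \<bullet> (v + A *v y) \<ge> \<xi> \<bullet> v - T \<longleftrightarrow> (\<Sum>k\<in>UNIV. y $ k) \<le> 1"
      using T by (simp add: inner_add_right)
    then show ?thesis unfolding S_def std_simplex_cart using 1 by auto
  qed
  have surj: "\<exists>y. x = v + A *v y" for x
  proof -
    define y where "y = (\<chi> k. z k * (c $ b k - edge_vec (b k) \<bullet> x) / T)"
    have "x = v + A *v y"
    proof (rule span_inner_eqI[of B])
      fix e assume "e \<in> B"
      then obtain k where "e = b k" using Bb by blast
      then show "edge_vec e \<bullet> x = edge_vec e \<bullet> (v + A *v y)"
        using z[of k] T v[OF bB[of k]] by (simp add: inner_add_right uA y_def)
    qed (use B in \<open>simp add: edge_basis_def\<close>)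
    then show ?thesis by blast
  qed
  have Seq: "S = (+) v ` ((*v) A ` ?\<Delta>)"
    using mem surj by (fastforce simp: image_iff)
  have \<Delta>: "compact ?\<Delta>" by (intro finite_imp_compact_convex_hull) simp
  let ?\<Delta>' = "(\<lambda>y. \<chi> k. - (T / z k) * y $ k) ` ?\<Delta>"
  have "linear (\<lambda>y :: real ^ 'n. \<chi> k. - (T / z k) * y $ k)"
    by (auto intro!: linearI simp: vec_eq_iff algebra_simps add_divide_distrib)
  then have \<Delta>': "compact ?\<Delta>'"
    by (rule compact_linear_image[OF _ \<Delta>])
  have "Sm *v y = (\<chi> k. - (T / z k) * y $ k)" for y
    by (simp add: Sm_def matrix_vector_mult_def if_distrib[of "\<lambda>x. x * _"] vec_eq_iff cong: if_cong)
  then have im: "(*v) A ` ?\<Delta> = (*v) Dm ` ?\<Delta>'"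
    unfolding image_image A_def by (simp flip: matrix_vector_mul_assoc)
  have "compact ((*v) A ` ?\<Delta>)"
    by (rule compact_linear_image[OF matrix_vector_mul_linear \<Delta>])
  then have "compact S" unfolding Seq by (rule compact_translation)
  then show "S \<in> lmeasurable" by (rule lmeasurable_compact)
  have "measure lebesgue S = measure lebesgue ((*v) A ` ?\<Delta>)"
    unfolding Seq by (rule measure_translation)
  also have "\<dots> = measure lebesgue ?\<Delta>'"
    unfolding im by (rule measure_unimodular_image[OF Dm Um UD \<Delta>'])
  also have "\<dots> = \<bar>\<Prod>k\<in>UNIV. - (T / z k)\<bar> * measure lebesgue ?\<Delta>"
    by (rule measure_stretch[OF lmeasurable_compact[OF \<Delta>]])
  also have "measure lebesgue ?\<Delta> = measure lborel ?\<Delta>"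
    by (intro measure_completion) (simp add: borel_compact \<Delta>)
  also have "\<dots> = 1 / fact CARD('n)" by (simp add: content_std_simplex)
  also have "\<bar>\<Prod>k\<in>UNIV. - (T / z k)\<bar> = T ^ CARD('n) / (\<Prod>k\<in>UNIV. \<bar>z k\<bar>)"
    using T by (simp add: abs_prod prod_dividef)
  also have "(\<Prod>k\<in>UNIV. \<bar>z k\<bar>) = (\<Prod>e\<in>B. \<bar>\<xi> \<bullet> dual_vec B e\<bar>)"
    unfolding z_def by (rule prod.reindex_bij_betw[OF b])
  finally show "measure lebesgue S = T ^ CARD('n) / (fact CARD('n) * (\<Prod>e\<in>B. \<bar>\<xi> \<bullet> dual_vec B e\<bar>))"
    by (simp add: field_simps)
qed

lemma measure_polytrope_lebesgue: "measure lborel (polytrope c) = measure lebesgue (polytrope c)"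
  by (rule measure_completion[symmetric]) (simp add: borel_compact compact_polytrope)

text \<open>If \<open>B\<close> is the vertex basis at \<open>v\<close>, this is
  \<open>\<xi> \<bullet> v\<close>. It is kept as a linear form in the weights, since later the
  weights vary while the bases stay fixed.\<close>

definition dual_sum :: "real ^ 'n::finite edge \<Rightarrow> real ^ 'n \<Rightarrow> 'n edge set \<Rightarrow> real" where
  "dual_sum c \<xi> B = (\<Sum>e\<in>B. (\<xi> \<bullet> dual_vec B e) * c $ e)"

text \<open>
  Integrate the cone decomposition over the half-space \<open>\<xi> \<bullet> x \<ge> - t\<close>, which contains the
  polytrope and cuts each signed cone down to a simplex.
\<close>

lemma volume_truncated:
  fixes c :: "real ^ 'n::finite edge"
  assumes simp: "simple_polytrope c" and ne: "vertex_bases c \<noteq> {}" and gen: "generic c \<xi>"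
    and t: "\<And>x. x \<in> polytrope c \<Longrightarrow> - t < \<xi> \<bullet> x"
  shows "fact CARD('n) * measure lborel (polytrope c) =
    (\<Sum>B\<in>vertex_bases c. (dual_sum c \<xi> B + t) ^ CARD('n) / (\<Prod>e\<in>B. \<xi> \<bullet> dual_vec B e))"
proof -
  let ?X = "\<lambda>B e. \<xi> \<bullet> dual_vec B e"
  define S where "S B = {x. (\<forall>e\<in>B. ?X B e * (c $ e - edge_vec e \<bullet> x) \<ge> 0) \<and> \<xi> \<bullet> x \<ge> - t}" for B
  define sg where "sg B = (\<Prod>e\<in>B. sgn (?X B e))" for B
  have nz: "?X B e \<noteq> 0" if "B \<in> vertex_bases c" "e \<in> B" for B e
    using gen that by (simp add: generic_def)
  have S: "S B \<in> lmeasurable \<and> measure lebesgue (S B) =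
     (dual_sum c \<xi> B + t) ^ CARD('n) / (fact CARD('n) * (\<Prod>e\<in>B. \<bar>?X B e\<bar>))"
    if B: "B \<in> vertex_bases c" for B
  proof -
    obtain v where v: "v extreme_point_of polytrope c" "B = incident_facets c v"
      using B by (auto simp: vertex_bases_def)
    have bas: "edge_basis B" by (rule vertex_bases_basis[OF simp B])
    have ds: "\<xi> \<bullet> v = dual_sum c \<xi> B"
      using inner_vertex[of c v \<xi>] bas v by (simp add: dual_sum_def)
    have vP: "v \<in> polytrope c" using v by (simp add: extreme_point_iff_span)
    have "dual_sum c \<xi> B + t > 0" using t[OF vP] ds by simp
    from truncated_cone_measure[OF bas _ nz[OF B] this, of v c]
    show ?thesis using v(2) by (simp add: S_def ds mem_incident_facets)
  qed
  \<comment> \<open>Reversed half-spaces are open in \<open>cone_sign\<close> but closed in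
    \<open>S\<close>. The two versions differ only on these hyperplanes.\<close>
  let ?N = "\<Union>e. {x. edge_vec e \<bullet> x = c $ e}"
  have neg: "negligible ?N" by (intro negligible_Union) (auto intro!: negligible_hyperplane)
  have ind: "indicator (polytrope c) x = (\<Sum>B\<in>vertex_bases c. sg B * indicator (S B) x)"
    if x: "x \<notin> ?N" for x
  proof (cases "\<xi> \<bullet> x \<ge> - t")
    case True
    have "cone_sign c x \<xi> B = sg B * indicator (S B) x" if B: "B \<in> vertex_bases c" for B
    proof -
      have "cone_sign c x \<xi> B = (\<Prod>e\<in>B. sgn (?X B e) * of_bool (?X B e * (c $ e - edge_vec e \<bullet> x) \<ge> 0))"
        unfolding cone_sign_def
      proof (rule prod.cong[OF refl])
        fix e assume "e \<in> B"
        then have "?X B e \<noteq> 0" using nz[OF B] by blast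
        moreover have "edge_vec e \<bullet> x \<noteq> c $ e" using x by blast
        ultimately show "of_bool (0 < ?X B e) - of_bool (\<not> edge_vec e \<bullet> x \<le> c $ e) =
          sgn (?X B e) * of_bool (?X B e * (c $ e - edge_vec e \<bullet> x) \<ge> 0)"
          by (auto simp: zero_le_mult_iff sgn_if)
      qed
      also have "\<dots> = sg B * (\<Prod>e\<in>B. of_bool (?X B e * (c $ e - edge_vec e \<bullet> x) \<ge> 0))"
        by (simp add: sg_def prod.distrib)
      also have "(\<Prod>e\<in>B. of_bool (?X B e * (c $ e - edge_vec e \<bullet> x) \<ge> 0)) = (indicator (S B) x :: real)"
      proof (cases "x \<in> S B")
        case True
        then show ?thesis by (simp add: S_def)
      next
        case False
        then obtain e where "e \<in> B" "\<not> ?X B e * (c $ e - edge_vec e \<bullet> x) \<ge> 0"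
          using \<open>\<xi> \<bullet> x \<ge> - t\<close> by (auto simp: S_def)
        then have "(\<Prod>e\<in>B. of_bool (?X B e * (c $ e - edge_vec e \<bullet> x) \<ge> 0)) = (0::real)"
          by (intro prod_zero) auto
        then show ?thesis using False by simp
      qed
      finally show ?thesis .
    qed
    then show ?thesis using sum_cone_sign[OF simp ne gen, of x] by simp
  next
    case False
    then have "x \<notin> polytrope c" using t[of x] by auto
    moreover have "x \<notin> S B" for B using False by (simp add: S_def)
    ultimately show ?thesis by simp
  qed
  have "((\<lambda>x. \<Sum>B\<in>vertex_bases c. sg B * indicator (S B) x) has_integral
    (\<Sum>B\<in>vertex_bases c. sg B * measure lebesgue (S B))) UNIV"
    using S lmeasurable_iff_has_integral
    by (intro has_integral_sum has_integral_mult_right finite_vertex_bases) blast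
  then have "(indicator (polytrope c) has_integral (\<Sum>B\<in>vertex_bases c. sg B * measure lebesgue (S B))) UNIV"
    by (rule has_integral_spike[OF neg, rotated]) (erule DiffE, erule ind)
  moreover have "(indicator (polytrope c) has_integral measure lebesgue (polytrope c)) UNIV"
    using lmeasurable_compact[OF compact_polytrope] by (simp flip: lmeasurable_iff_has_integral)
  ultimately have "measure lebesgue (polytrope c) = (\<Sum>B\<in>vertex_bases c. sg B * measure lebesgue (S B))"
    by (metis has_integral_unique)
  also have "fact CARD('n) * \<dots> =
     (\<Sum>B\<in>vertex_bases c. (dual_sum c \<xi> B + t) ^ CARD('n) / (\<Prod>e\<in>B. ?X B e))"
    unfolding sum_distrib_left
  proof (rule sum.cong[OF refl])
    fix B assume B: "B \<in> vertex_bases c"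
    have "(\<Prod>e\<in>B. ?X B e) = sg B * (\<Prod>e\<in>B. \<bar>?X B e\<bar>)"
      unfolding sg_def prod.distrib[symmetric] by (intro prod.cong) (auto simp: sgn_mult_abs)
    moreover have "sg B * sg B = 1"
      unfolding sg_def prod.distrib[symmetric] using nz[OF B] by (intro prod.neutral) (auto simp: sgn_if)
    moreover have "(\<Prod>e\<in>B. \<bar>?X B e\<bar>) \<noteq> 0" using nz[OF B] by simp
    ultimately have r: "(\<Prod>e\<in>B. ?X B e) = sg B * (\<Prod>e\<in>B. \<bar>?X B e\<bar>)"
      and sg2: "sg B * sg B = 1" by blast+
    then have inv: "1 / sg B = sg B" by (metis nonzero_eq_divide_eq mult_zero_left zero_neq_one)
    have "fact CARD('n) * (sg B * measure lebesgue (S B)) =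
      sg B * ((dual_sum c \<xi> B + t) ^ CARD('n) / (\<Prod>e\<in>B. \<bar>?X B e\<bar>))"
      using S[OF B] by simp
    also have "\<dots> = (1 / sg B) * ((dual_sum c \<xi> B + t) ^ CARD('n) / (\<Prod>e\<in>B. \<bar>?X B e\<bar>))"
      by (simp only: inv)
    also have "\<dots> = (dual_sum c \<xi> B + t) ^ CARD('n) / (\<Prod>e\<in>B. ?X B e)"
      by (simp add: r)
    finally show "fact CARD('n) * (sg B * measure lebesgue (S B)) =
      (dual_sum c \<xi> B + t) ^ CARD('n) / (\<Prod>e\<in>B. ?X B e)" .
  qed
  finally show ?thesis unfolding measure_polytrope_lebesgue .
qed

section \<open>Independence of the truncation level\<close>

lemma pderiv_sum_fun: "pderiv (\<Sum>x\<in>A. f x) = (\<Sum>x\<in>A. pderiv (f x))"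
  by (induction A rule: infinite_finite_induct) (simp_all add: pderiv_add)

text \<open>A polynomial in \<open>t\<close> that is constant for large \<open>t\<close> is
  constant. The conclusions are its value and its derivative at 0.\<close>

lemma shifted_powers_constant:
  fixes a w :: "'b \<Rightarrow> real"
  assumes "\<And>t. t \<ge> t0 \<Longrightarrow> (\<Sum>x\<in>A. (a x + t) ^ N * w x) = C"
  shows "(\<Sum>x\<in>A. a x ^ N * w x) = C" and "real N * (\<Sum>x\<in>A. a x ^ (N - 1) * w x) = 0"
proof -
  define p where "p = (\<Sum>x\<in>A. smult (w x) ([:a x, 1:] ^ N))"
  have pt: "poly p t = (\<Sum>x\<in>A. (a x + t) ^ N * w x)" for t
    by (simp add: p_def poly_sum mult.commute)
  have "p - [:C:] = 0"
  proof (rule ccontr)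
    assume "p - [:C:] \<noteq> 0"
    then have "finite {t. poly (p - [:C:]) t = 0}" by (rule poly_roots_finite)
    moreover have "{t0..} \<subseteq> {t. poly (p - [:C:]) t = 0}" using assms by (auto simp: pt)
    ultimately show False using infinite_Ici finite_subset by blast
  qed
  then have p: "p = [:C:]" by simp
  then show "(\<Sum>x\<in>A. a x ^ N * w x) = C" using pt[of 0] by simp
  have "poly (pderiv p) 0 = real N * (\<Sum>x\<in>A. a x ^ (N - 1) * w x)"
    by (simp add: p_def pderiv_sum_fun pderiv_smult pderiv_power pderiv_pCons poly_sum sum_distrib_left mult_ac)
  then show "real N * (\<Sum>x\<in>A. a x ^ (N - 1) * w x) = 0" by (simp add: p pderiv_pCons)
qed

text \<open>The truncated volumes sum to the same value for every sufficiently low cut. As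
  polynomials in the level they have this value as constant term, and their linear term
  vanishes.\<close>

theorem volume_simple_polytrope:
  fixes c :: "real ^ 'n::finite edge"
  assumes simp: "simple_polytrope c" and ne: "vertex_bases c \<noteq> {}" and gen: "generic c \<xi>"
  shows "fact CARD('n) * measure lborel (polytrope c) =
      (\<Sum>B\<in>vertex_bases c. dual_sum c \<xi> B ^ CARD('n) / (\<Prod>e\<in>B. \<xi> \<bullet> dual_vec B e))"
    and "(\<Sum>B\<in>vertex_bases c. dual_sum c \<xi> B ^ (CARD('n) - 1) / (\<Prod>e\<in>B. \<xi> \<bullet> dual_vec B e)) = 0"
proof -
  obtain b where b: "\<And>x. x \<in> polytrope c \<Longrightarrow> norm x \<le> b" using bounded_polytrope[of c] unfolding bounded_iff by blast
  have "- t < \<xi> \<bullet> x" if "x \<in> polytrope c" "t \<ge> norm \<xi> * b + 1" for t x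
  proof -
    have "\<bar>\<xi> \<bullet> x\<bar> \<le> norm \<xi> * b"
      using Cauchy_Schwarz_ineq2[of \<xi> x] mult_left_mono[OF b[OF that(1)], of "norm \<xi>"] by simp
    then show ?thesis using that(2) by linarith
  qed
  then have *: "(\<Sum>B\<in>vertex_bases c. (dual_sum c \<xi> B + t) ^ CARD('n) * (1 / (\<Prod>e\<in>B. \<xi> \<bullet> dual_vec B e)))
    = fact CARD('n) * measure lborel (polytrope c)" if "t \<ge> norm \<xi> * b + 1" for t
    using volume_truncated[OF simp ne gen, of t] that by simp
  show "fact CARD('n) * measure lborel (polytrope c) =
      (\<Sum>B\<in>vertex_bases c. dual_sum c \<xi> B ^ CARD('n) / (\<Prod>e\<in>B. \<xi> \<bullet> dual_vec B e))"
    using shifted_powers_constant(1)[OF *] by simp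
  show "(\<Sum>B\<in>vertex_bases c. dual_sum c \<xi> B ^ (CARD('n) - 1) / (\<Prod>e\<in>B. \<xi> \<bullet> dual_vec B e)) = 0"
    using shifted_powers_constant(2)[OF *] by simp
qed

section \<open>The polytrope region\<close>

interpretation complete_digraph: wf_digraph complete_digraph
  by standard (simp_all add: complete_digraph_def)

lemma complete_digraph_simps [simp]:
  "verts complete_digraph = UNIV" "arcs complete_digraph = UNIV"
  "tail complete_digraph = src" "head complete_digraph = tgt"
  by (simp_all add: complete_digraph_def)

lemma awalk_complete_digraph: "complete_digraph.awalk u p v \<longleftrightarrow> complete_digraph.cas u p v"
  by (simp add: complete_digraph.awalk_def)

text \<open>The conditions on walks of two edges. Closed ones are listed separately because there is
  no diagonal weight to compare with.\<close>

definition triangle_ineqs :: "real ^ 'n::finite edge \<Rightarrow> bool" where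
  "triangle_ineqs c \<longleftrightarrow> (\<forall>e. 0 \<le> c $ e + c $ rev_edge e) \<and>
     (\<forall>e f g. src e = src g \<and> tgt e = src f \<and> tgt f = tgt g \<longrightarrow> c $ g \<le> c $ e + c $ f)"

lemma walk_cost_ge:
  assumes "triangle_ineqs c" "complete_digraph.cas u p v"
  shows "(if u = v then 0 else c $ Edge (u, v)) \<le> complete_digraph.awalk_cost (($) c) p"
  using assms(2)
proof (induction p arbitrary: u)
  case Nil
  then show ?case by simp
next
  case (Cons e p)
  from Cons.prems have e: "src e = u" and p: "complete_digraph.cas (tgt e) p v" by auto
  note IH = Cons.IH[OF p]
  have "(if u = v then 0 else c $ Edge (u, v)) \<le> c $ e + (if tgt e = v then 0 else c $ Edge (tgt e, v))"
  proof (cases "u = v")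
    case True
    then have "rev_edge e = Edge (tgt e, v)" using e by (simp add: rev_edge_def)
    moreover have "tgt e \<noteq> v" using e True src_neq_tgt(2) by metis
    ultimately show ?thesis using assms(1) True by (auto simp: triangle_ineqs_def dest: spec[of _ e])
  next
    case False
    show ?thesis
    proof (cases "tgt e = v")
      case True
      then have "Edge (u, v) = e" using e by (metis Edge_src_tgt)
      then show ?thesis using True False by simp
    next
      case ne: False
      then have "c $ Edge (u, v) \<le> c $ e + c $ Edge (tgt e, v)"
        using assms(1)[unfolded triangle_ineqs_def, THEN conjunct2, rule_format,
          of e "Edge (u, v)" "Edge (tgt e, v)"] e False by simp
      then show ?thesis using ne False by simp
    qed
  qed
  then show ?case using IH by simp
qed

lemma polytrope_region_iff:
  fixes c :: "real ^ 'n::finite edge"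
  shows "c \<in> polytrope_region \<longleftrightarrow> triangle_ineqs c"
proof
  assume c: "c \<in> polytrope_region"
  have cyc: "0 \<le> complete_digraph.awalk_cost (($) c) p" if "complete_digraph.cycle p" for p
    using c that by (simp add: polytrope_region_def)
  have mu: "ereal (c $ e) \<le> ereal (complete_digraph.awalk_cost (($) c) p)"
    if "complete_digraph.cas (src e) p (tgt e)" for e p
  proof -
    have "ereal (c $ e) = complete_digraph.\<mu> (($) c) (src e) (tgt e)"
      using c by (simp add: polytrope_region_def)
    also have "\<dots> \<le> ereal (complete_digraph.awalk_cost (($) c) p)"
      unfolding complete_digraph.\<mu>_def by (rule INF_lower) (simp add: awalk_complete_digraph that)
    finally show ?thesis .
  qed
  show "triangle_ineqs c" unfolding triangle_ineqs_def
  proof (intro conjI allI impI)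
    fix e :: "'n edge"
    have "complete_digraph.cycle [e, rev_edge e]"
      unfolding complete_digraph.cycle_def
      by (rule exI[of _ "src e"]) (simp add: awalk_complete_digraph)
    from cyc[OF this] show "0 \<le> c $ e + c $ rev_edge e" by simp
  next
    fix e f g :: "'n edge" assume "src e = src g \<and> tgt e = src f \<and> tgt f = tgt g"
    then show "c $ g \<le> c $ e + c $ f" using mu[of g "[e, f]"] by simp
  qed
next
  assume c: "triangle_ineqs c"
  show "c \<in> polytrope_region" unfolding polytrope_region_def mem_Collect_eq
  proof (intro conjI allI impI)
    fix p :: "'n edge list" assume "complete_digraph.cycle p"
    then obtain u where "complete_digraph.cas u p u"
      by (auto simp: complete_digraph.cycle_def awalk_complete_digraph)
    from walk_cost_ge[OF c this] show "0 \<le> complete_digraph.awalk_cost (($) c) p" by simp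
  next
    fix e :: "'n edge"
    show "ereal (c $ e) = complete_digraph.\<mu> (($) c) (src e) (tgt e)"
      unfolding complete_digraph.\<mu>_def
    proof (rule antisym)
      show "ereal (c $ e) \<le> (INF p\<in>{p. complete_digraph.awalk (src e) p (tgt e)}. ereal (complete_digraph.awalk_cost (($) c) p))"
        using walk_cost_ge[OF c, of "src e" _ "tgt e"]
        by (intro INF_greatest) (simp add: awalk_complete_digraph)
      have "complete_digraph.awalk (src e) [e] (tgt e)" by (simp add: awalk_complete_digraph)
      then have "(INF p\<in>{p. complete_digraph.awalk (src e) p (tgt e)}. ereal (complete_digraph.awalk_cost (($) c) p))
        \<le> ereal (complete_digraph.awalk_cost (($) c) [e])"
        by (intro INF_lower) simp
      then show "(INF p\<in>{p. complete_digraph.awalk (src e) p (tgt e)}. ereal (complete_digraph.awalk_cost (($) c) p)) \<le> ereal (c $ e)"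
        by simp
    qed
  qed
qed

text \<open>
  The columns of the weight matrix are themselves points of the polytrope, which makes every
  inequality tight somewhere.
\<close>

lemma region_edge_tight:
  fixes c :: "real ^ 'n::finite edge"
  assumes c: "triangle_ineqs c"
  obtains v where "v extreme_point_of polytrope c" "e \<in> incident_facets c v"
proof -
  define a where "a k = (if k = tgt e then 0 else c $ Edge (k, tgt e))" for k
  \<comment> \<open>Subtracting the entry at \<open>None\<close> normalises the last coordinate to 0
    without changing differences.\<close>
  define y :: "real ^ 'n" where "y = (\<chi> k. a (Some k) - a None)"
  have cy: "coord y k = a k - a None" for k by (cases k) (auto simp: y_def)
  have le: "a (src f) - a (tgt f) \<le> c $ f" for f
  proof -
    consider "src f = tgt e" | "tgt f = tgt e" "src f \<noteq> tgt e" | "src f \<noteq> tgt e" "tgt f \<noteq> tgt e" by blast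
    then show ?thesis
    proof cases
      case 1
      then have "a (tgt f) = c $ rev_edge f" by (auto simp: a_def rev_edge_def) (metis src_neq_tgt(1))
      moreover have "0 \<le> c $ f + c $ rev_edge f" using c by (simp add: triangle_ineqs_def)
      ultimately show ?thesis using 1 by (simp add: a_def)
    next
      case 2
      then show ?thesis by (simp add: a_def) (metis Edge_src_tgt order_refl)
    next
      case 3
      then show ?thesis
        using c[unfolded triangle_ineqs_def, THEN conjunct2, rule_format,
          of f "Edge (src f, tgt e)" "Edge (tgt f, tgt e)"] by (simp add: a_def)
    qed
  qed
  have yP: "y \<in> polytrope c" unfolding mem_polytrope inner_edge_vec cy using le by simp
  have ye: "edge_vec e \<bullet> y = c $ e" unfolding inner_edge_vec cy by (simp add: a_def)
  define F where "F = polytrope c \<inter> {x. edge_vec e \<bullet> x = c $ e}"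
  have F: "F face_of polytrope c" unfolding F_def
    by (rule face_of_Int_supporting_hyperplane_le[OF convex_polytrope]) (simp add: mem_polytrope)
  have "compact F" "convex F"
    using face_of_imp_compact[OF convex_polytrope compact_polytrope F] face_of_imp_convex[OF F] by auto
  moreover have "F \<noteq> {}" using yP ye by (auto simp: F_def)
  ultimately obtain v where "v extreme_point_of F"
    using Krein_Milman_Minkowski[of F] by (metis (no_types, lifting) Collect_empty_eq convex_hull_empty)
  then have "v extreme_point_of polytrope c" "v \<in> F" using extreme_point_of_face[OF F] by auto
  then show ?thesis using that by (simp add: F_def mem_incident_facets)
qed

lemma maximal_polytropeD:
  fixes c :: "real ^ 'n::finite edge"
  assumes "maximal_polytrope c"
  shows "simple_polytrope c" "vertex_bases c \<noteq> {}" "\<exists>x. \<forall>e. edge_vec e \<bullet> x < c $ e"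
    "card {v. v extreme_point_of polytrope c} = (2 * CARD('n)) choose CARD('n)"
proof -
  show crd: "card {v. v extreme_point_of polytrope c} = (2 * CARD('n)) choose CARD('n)"
    using assms by (simp add: maximal_polytrope_def)
  then show "simple_polytrope c" by (rule maximal_imp_simple)
  have "{v. v extreme_point_of polytrope c} \<noteq> {}"
  proof
    assume "{v. v extreme_point_of polytrope c} = {}"
    then have "(2 * CARD('n)) choose CARD('n) = 0" using crd by (metis card.empty)
    then show False by simp
  qed
  then show "vertex_bases c \<noteq> {}" by (auto simp: vertex_bases_def)
  have "aff_dim (polytrope c) = int DIM(real ^ 'n)" using assms by (simp add: maximal_polytrope_def)
  then have "affine hull (polytrope c) = UNIV" by (simp only: aff_dim_eq_full)
  moreover from this have "polytrope c \<noteq> {}" by force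
  ultimately have "interior (polytrope c) \<noteq> {}"
    using rel_interior_eq_empty[OF convex_polytrope[of c]] rel_interior_interior by metis
  then obtain x where x: "x \<in> interior (polytrope c)" by blast
  have "edge_vec e \<bullet> x < c $ e" for e
  proof -
    have "polytrope c \<subseteq> {x. edge_vec e \<bullet> x \<le> c $ e}" by (auto simp: mem_polytrope)
    then have "x \<in> interior {x. edge_vec e \<bullet> x \<le> c $ e}" using x interior_mono by blast
    then show ?thesis by (simp add: interior_halfspace_le)
  qed
  then show "\<exists>x. \<forall>e. edge_vec e \<bullet> x < c $ e" by blast
qed

lemma inj_incident_facets: "inj_on (incident_facets c) {v. v extreme_point_of polytrope c}"
  by (rule inj_onI) (metis extreme_point_iff_span extreme_point_incident_inj mem_Collect_eq order_refl)

lemma card_vertex_bases: "card (vertex_bases c) = card {v. v extreme_point_of polytrope c}"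
  unfolding vertex_bases_def by (rule card_image[OF inj_incident_facets])

section \<open>Chambers\<close>

text \<open>Finitely many strict inequalities keep the interior point, the triangle inequalities and
  every vertex of \<open>c\<close>. The bound on the number of vertices then leaves no room for new
  vertices.\<close>

lemma open_chamber:
  fixes c :: "real ^ 'n::finite edge"
  assumes reg: "c \<in> polytrope_region" and max: "maximal_polytrope c"
  obtains U where "open U" "c \<in> U"
    "\<And>c'. c' \<in> U \<Longrightarrow> c' \<in> polytrope_region \<and> maximal_polytrope c' \<and> vertex_bases c' = vertex_bases c"
proof -
  have tri: "triangle_ineqs c" using reg by (simp add: polytrope_region_iff)
  note simp = maximal_polytropeD(1)[OF max]
  obtain x where x: "\<And>e. edge_vec e \<bullet> x < c $ e" using maximal_polytropeD(3)[OF max] by blast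
  \<comment> \<open>The vertex with basis \<open>B\<close> as a linear function of the
    weights.\<close>
  define vtx where "vtx c' B = (\<Sum>e\<in>B. (c' $ e) *\<^sub>R dual_vec B e)" for c' :: "real ^ 'n edge" and B
  define T where "T = {(e, f, g). src e = src g \<and> tgt e = src f \<and> tgt f = tgt (g :: 'n edge)}"
  define U where "U = (\<Inter>e. {c'. edge_vec e \<bullet> x < c' $ e}) \<inter>
    (\<Inter>(e, f, g)\<in>T. {c'. c' $ g < c' $ e + c' $ f}) \<inter>
    (\<Inter>(B, f)\<in>Sigma (vertex_bases c) (\<lambda>B. - B). {c'. edge_vec f \<bullet> vtx c' B < c' $ f})"
  show ?thesis
  proof (rule that[of U])
    have "open {c'. edge_vec f \<bullet> vtx c' B < c' $ f}" for f B
      unfolding vtx_def by (intro open_Collect_less continuous_intros)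
    moreover have "open {c' :: real ^ 'n edge. c' $ g < c' $ e + c' $ f}" for e f g
      by (intro open_Collect_less continuous_intros)
    moreover have "open {c' :: real ^ 'n edge. edge_vec e \<bullet> x < c' $ e}" for e
      by (intro open_Collect_less continuous_intros)
    ultimately show "open U"
      unfolding U_def by (intro open_Int open_INT) (auto simp: split_beta)
    \<comment> \<open>Equality would make \<open>e\<close> and \<open>f\<close> tight wherever
      \<open>g\<close> is, but the three edge vectors are dependent and tight edges at a simple
      vertex are not.\<close>
    have "c $ g < c $ e + c $ f" if efg: "(e, f, g) \<in> T" for e f g
    proof (rule ccontr)
      assume "\<not> ?thesis"
      then have eq: "c $ e + c $ f \<le> c $ g" by simp
      obtain v where v: "v extreme_point_of polytrope c" "g \<in> incident_facets c v"
        using region_edge_tight[OF tri] by blast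
      have ug: "edge_vec g = edge_vec e + edge_vec f"
        using efg by (auto simp: T_def edge_vec_def)
      have "edge_vec e \<bullet> v \<le> c $ e" "edge_vec f \<bullet> v \<le> c $ f" "edge_vec g \<bullet> v = c $ g" "v \<in> polytrope c"
        using v by (auto simp: mem_incident_facets mem_polytrope)
      then have ef: "e \<in> incident_facets c v" "f \<in> incident_facets c v"
        using eq ug by (auto simp: mem_incident_facets inner_add_left)
      have bas: "edge_basis (incident_facets c v)" using simp v by (simp add: simple_polytrope_def)
      have "e \<noteq> g" using efg src_neq_tgt(1)[of f] by (auto simp: T_def simp del: src_neq_tgt)
      moreover have "f \<noteq> g" using efg src_neq_tgt(1)[of e] by (auto simp: T_def simp del: src_neq_tgt)
      ultimately have "edge_vec g \<bullet> dual_vec (incident_facets c v) g = 0"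
        unfolding ug inner_add_left
        using inner_dual_vec[OF bas v(2) ef(1)] inner_dual_vec[OF bas v(2) ef(2)] by simp
      then show False using inner_dual_vec[OF bas v(2) v(2)] by simp
    qed
    moreover have "edge_vec f \<bullet> vtx c B < c $ f" if B: "B \<in> vertex_bases c" and f: "f \<notin> B" for B f
    proof -
      obtain v where v: "v extreme_point_of polytrope c" "B = incident_facets c v"
        using B by (auto simp: vertex_bases_def)
      have "v = (\<Sum>e\<in>B. (edge_vec e \<bullet> v) *\<^sub>R dual_vec B e)"
        using dual_vec_expand[OF vertex_bases_basis[OF simp B]] by simp
      also have "\<dots> = vtx c B" unfolding vtx_def
        using v(2) by (intro sum.cong) (auto simp: mem_incident_facets)
      finally have "vtx c B = v" by simp
      then show ?thesis using f v by (auto simp: mem_incident_facets extreme_point_iff_span mem_polytrope order_less_le)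
    qed
    ultimately show "c \<in> U" using x by (auto simp: U_def)
    fix c' assume c': "c' \<in> U"
    have x': "edge_vec e \<bullet> x < c' $ e" for e using c' by (auto simp: U_def)
    have "triangle_ineqs c'" unfolding triangle_ineqs_def
    proof (intro conjI allI impI)
      \<comment> \<open>The strict inequalities at \<open>x\<close> for an edge and its reverse add
        up to this.\<close>
      show "0 \<le> c' $ e + c' $ rev_edge e" for e
        using x'[of e] x'[of "rev_edge e"] by simp
      fix e f g :: "'n edge" assume "src e = src g \<and> tgt e = src f \<and> tgt f = tgt g"
      then have "(e, f, g) \<in> T" by (simp add: T_def)
      then have "c' $ g < c' $ e + c' $ f" using c' by (auto simp: U_def)
      then show "c' $ g \<le> c' $ e + c' $ f" by simp
    qed
    then have reg': "c' \<in> polytrope_region" by (simp add: polytrope_region_iff)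
    have sub: "vertex_bases c \<subseteq> vertex_bases c'"
    proof
      fix B assume B: "B \<in> vertex_bases c"
      have bas: "edge_basis B" by (rule vertex_bases_basis[OF simp B])
      have eq: "edge_vec e \<bullet> vtx c' B = c' $ e" if "e \<in> B" for e
        unfolding vtx_def inner_sum_right using that
        by (subst sum.remove[OF _ that]) (auto simp: inner_dual_vec[OF bas])
      have lt: "edge_vec f \<bullet> vtx c' B < c' $ f" if "f \<notin> B" for f
        using c' B that by (auto simp: U_def)
      have P: "vtx c' B \<in> polytrope c'" unfolding mem_polytrope
      proof
        fix e show "edge_vec e \<bullet> vtx c' B \<le> c' $ e"
          using eq[of e] lt[of e] by (cases "e \<in> B") auto
      qed
      then have I: "incident_facets c' (vtx c' B) = B" using eq lt by (force simp: mem_incident_facets)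
      then have "vtx c' B extreme_point_of polytrope c'"
        using extreme_point_of_basis[OF P bas] by simp
      then show "B \<in> vertex_bases c'" using I by (force simp: vertex_bases_def)
    qed
    have "card (vertex_bases c') \<le> card (vertex_bases c)"
      unfolding card_vertex_bases maximal_polytropeD(4)[OF max] by (rule card_extreme_points_le)
    then have eq: "vertex_bases c' = vertex_bases c"
      using card_seteq[OF finite_vertex_bases(1) sub] by simp
    have "{y. \<forall>e. edge_vec e \<bullet> y < c' $ e} = (\<Inter>e. {y. edge_vec e \<bullet> y < c' $ e})" by auto
    moreover have "open \<dots>" by (intro open_INT) (auto intro: open_halfspace_lt)
    ultimately have "open {y. \<forall>e. edge_vec e \<bullet> y < c' $ e}" by simp
    then have "{y. \<forall>e. edge_vec e \<bullet> y < c' $ e} \<subseteq> interior (polytrope c')"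
      by (intro interior_maximal) (auto simp: mem_polytrope less_imp_le)
    then have "interior (polytrope c') \<noteq> {}" using x' by blast
    then have "aff_dim (polytrope c') = int CARD('n)" by (simp add: aff_dim_nonempty_interior)
    then have "maximal_polytrope c'"
      using maximal_polytropeD(4)[OF max] eq by (simp add: maximal_polytrope_def flip: card_vertex_bases)
    then show "c' \<in> polytrope_region \<and> maximal_polytrope c' \<and> vertex_bases c' = vertex_bases c"
      using reg' eq by blast
  qed
qed

section \<open>Normal fans\<close>

text \<open>Faces of a polytope are exposed, and the normal cone of the face maximising
  \<open>w\<close> is the intersection of the vertex cones that contain \<open>w\<close>. Thus the
  fan is determined by the set of its vertex cones.\<close>

lemma normal_fan_vertices:
  fixes P :: "'a::euclidean_space set"
  assumes P: "polytope P" "P \<noteq> {}"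
  shows "normal_fan P = range (\<lambda>w. \<Inter>{C \<in> (\<lambda>v. normal_cone P {v}) ` {v. v extreme_point_of P}. w \<in> C})"
    (is "_ = range ?N")
proof -
  have cvx: "convex P" and cpt: "compact P"
    using P polytope_imp_convex polytope_imp_compact by auto
  have main: "normal_cone P F = ?N a"
    if F: "F = P \<inter> {x. a \<bullet> x = b}" "F face_of P" "F \<noteq> {}" and le: "\<And>x. x \<in> P \<Longrightarrow> a \<bullet> x \<le> b" for F a b
  proof -
    let ?X = "{v. v extreme_point_of P}"
    have mem: "a \<in> normal_cone P {v} \<longleftrightarrow> v \<in> F" if "v \<in> ?X" for v
    proof
      have vP: "v \<in> P" using that by (simp add: extreme_point_of_def)
      assume "a \<in> normal_cone P {v}"
      moreover obtain x where "x \<in> F" using F(3) by blast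
      ultimately have "b \<le> a \<bullet> v" using F(1) by (auto simp: normal_cone_def)
      then show "v \<in> F" using le[OF vP] vP F(1) by auto
    qed (use F(1) le in \<open>auto simp: normal_cone_def\<close>)
    have "w \<in> normal_cone P F" if w: "\<And>v. v \<in> ?X \<Longrightarrow> v \<in> F \<Longrightarrow> w \<in> normal_cone P {v}" for w
    proof -
      have "convex {x. \<forall>y\<in>P. w \<bullet> y \<le> w \<bullet> x}"
      proof -
        have "{x. \<forall>y\<in>P. w \<bullet> y \<le> w \<bullet> x} = (\<Inter>y\<in>P. {x. w \<bullet> x \<ge> w \<bullet> y})" by auto
        also have "convex \<dots>" by (intro convex_INT) (rule convex_halfspace_ge)
        finally show ?thesis .
      qed
      moreover have "{v. v extreme_point_of F} \<subseteq> {x. \<forall>y\<in>P. w \<bullet> y \<le> w \<bullet> x}"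
        using w extreme_point_of_face[OF F(2)] by (auto simp: normal_cone_def)
      ultimately have "convex hull {v. v extreme_point_of F} \<subseteq> {x. \<forall>y\<in>P. w \<bullet> y \<le> w \<bullet> x}"
        by (rule hull_minimal[rotated])
      moreover have "F = convex hull {v. v extreme_point_of F}"
        by (intro Krein_Milman_Minkowski face_of_imp_compact[OF cvx cpt F(2)] face_of_imp_convex[OF F(2)])
      ultimately show ?thesis by (auto simp: normal_cone_def)
    qed
    moreover have "w \<in> normal_cone P {v}" if "w \<in> normal_cone P F" "v \<in> F" for w v
      using that by (auto simp: normal_cone_def)
    ultimately show ?thesis using mem by auto
  qed
  show ?thesis
  proof (intro equalityI subsetI)
    fix C assume "C \<in> normal_fan P"
    then obtain F where F: "C = normal_cone P F" "F face_of P" "F \<noteq> {}" by (auto simp: normal_fan_def)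
    then have "F exposed_face_of P"
      using exposed_face_of_polyhedron polytope_imp_polyhedron P(1) by blast
    then obtain a b where "P \<subseteq> {x. a \<bullet> x \<le> b}" "F = P \<inter> {x. a \<bullet> x = b}"
      by (auto simp: exposed_face_of_def)
    then have "C = ?N a" using main[of F a b] F by auto
    then show "C \<in> range ?N" by blast
  next
    fix C assume "C \<in> range ?N"
    then obtain w where C: "C = ?N w" by blast
    obtain x where x: "x \<in> P" "\<And>y. y \<in> P \<Longrightarrow> w \<bullet> y \<le> w \<bullet> x"
      using continuous_attains_sup[OF cpt P(2) continuous_on_inner[OF continuous_on_const continuous_on_id], of w]
      by blast
    define F where "F = P \<inter> {y. w \<bullet> y = w \<bullet> x}"
    have F: "F face_of P" unfolding F_def
      by (rule face_of_Int_supporting_hyperplane_le[OF cvx x(2)])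
    moreover have "F \<noteq> {}" using x by (auto simp: F_def)
    moreover from this have "normal_cone P F = ?N w" using main[OF F_def F _ x(2)] by simp
    ultimately show "C \<in> normal_fan P" unfolding C normal_fan_def by blast
  qed
qed

text \<open>Necessity comes from comparing \<open>v\<close> with its neighbours, sufficiency from
  expanding \<open>w\<close> in the tight edge vectors.\<close>

lemma normal_cone_vertex:
  fixes c :: "real ^ 'n::finite edge"
  assumes simp: "simple_polytrope c" and v: "v extreme_point_of polytrope c"
  shows "normal_cone (polytrope c) {v} = {w. \<forall>e\<in>incident_facets c v. w \<bullet> dual_vec (incident_facets c v) e \<ge> 0}"
proof (intro equalityI subsetI)
  let ?B = "incident_facets c v"
  have bas: "edge_basis ?B" using simp v by (simp add: simple_polytrope_def)
  {
    fix w assume w: "w \<in> normal_cone (polytrope c) {v}"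
    have "w \<bullet> dual_vec ?B e \<ge> 0" if e: "e \<in> ?B" for e
    proof -
      obtain s f where sf: "s > 0" "(v - s *\<^sub>R dual_vec ?B e) extreme_point_of polytrope c"
        using ridge_neighbour[OF simp v e] by metis
      then have "v - s *\<^sub>R dual_vec ?B e \<in> polytrope c" by (simp add: extreme_point_iff_span)
      then have "w \<bullet> (v - s *\<^sub>R dual_vec ?B e) \<le> w \<bullet> v" using w by (simp add: normal_cone_def)
      then show ?thesis using sf(1) by (simp add: inner_diff_right zero_le_mult_iff)
    qed
    then show "w \<in> {w. \<forall>e\<in>?B. w \<bullet> dual_vec ?B e \<ge> 0}" by blast
  next
    fix w assume w: "w \<in> {w. \<forall>e\<in>?B. w \<bullet> dual_vec ?B e \<ge> 0}"
    have "w \<bullet> y \<le> w \<bullet> v" if "y \<in> polytrope c" for y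
      unfolding inner_vertex[OF bas, of w] inner_expand[OF bas, of w y]
      using that w by (intro sum_mono mult_left_mono) (auto simp: mem_polytrope)
    then show "w \<in> normal_cone (polytrope c) {v}" by (simp add: normal_cone_def)
  }
qed

lemma polytrope_nonempty: "vertex_bases c \<noteq> {} \<Longrightarrow> polytrope c \<noteq> {}"
  by (auto simp: vertex_bases_def extreme_point_of_def)

lemma normal_fan_vertex_bases:
  assumes "simple_polytrope c" "vertex_bases c \<noteq> {}"
  shows "normal_fan (polytrope c) =
    range (\<lambda>w. \<Inter>{C \<in> (\<lambda>B. {w. \<forall>e\<in>B. w \<bullet> dual_vec B e \<ge> 0}) ` vertex_bases c. w \<in> C})"
proof -
  have "(\<lambda>v. normal_cone (polytrope c) {v}) ` {v. v extreme_point_of polytrope c} =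
    (\<lambda>B. {w. \<forall>e\<in>B. w \<bullet> dual_vec B e \<ge> 0}) ` vertex_bases c"
    unfolding vertex_bases_def image_image using normal_cone_vertex[OF assms(1)] by auto
  then show ?thesis
    using normal_fan_vertices[OF polytope_polytrope polytrope_nonempty[OF assms(2)]] by simp
qed

text \<open>Since every edge inequality is tight somewhere, the tight edges at a vertex are exactly
  those whose vectors lie in its normal cone, so they can be recovered from the fan.\<close>

lemma normal_fan_imp_vertex_bases_subset:
  fixes c c' :: "real ^ 'n::finite edge"
  assumes c: "triangle_ineqs c" "simple_polytrope c" "vertex_bases c \<noteq> {}"
    and c': "triangle_ineqs c'" "simple_polytrope c'"
    and sub: "normal_fan (polytrope c') \<subseteq> normal_fan (polytrope c)"
  shows "vertex_bases c' \<subseteq> vertex_bases c"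
proof
  have rec: "incident_facets d v = {e. edge_vec e \<in> normal_cone (polytrope d) {v}}"
    if d: "triangle_ineqs d" and v: "v extreme_point_of polytrope d" for d :: "real ^ 'n edge" and v
  proof -
    have "e \<in> incident_facets d v \<longleftrightarrow> edge_vec e \<in> normal_cone (polytrope d) {v}" for e
    proof -
      obtain w where w: "w extreme_point_of polytrope d" "e \<in> incident_facets d w"
        using region_edge_tight[OF d] .
      have vP: "v \<in> polytrope d" using v by (simp add: extreme_point_of_def)
      show ?thesis
      proof
        assume "e \<in> incident_facets d v"
        then show "edge_vec e \<in> normal_cone (polytrope d) {v}"
          by (simp add: normal_cone_def mem_incident_facets mem_polytrope)
      next
        assume "edge_vec e \<in> normal_cone (polytrope d) {v}"
        then have "d $ e \<le> edge_vec e \<bullet> v"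
          using w by (auto simp: normal_cone_def mem_incident_facets)
        moreover have "edge_vec e \<bullet> v \<le> d $ e" using vP by (simp add: mem_polytrope)
        ultimately show "e \<in> incident_facets d v" using vP by (simp add: mem_incident_facets)
      qed
    qed
    then show ?thesis by blast
  qed
  fix B assume B: "B \<in> vertex_bases c'"
  then obtain v' where v': "v' extreme_point_of polytrope c'" "B = incident_facets c' v'"
    by (auto simp: vertex_bases_def)
  have bas: "edge_basis B" by (rule vertex_bases_basis[OF c'(2) B])
  have "normal_cone (polytrope c') {v'} \<in> normal_fan (polytrope c')"
    using v'(1) by (auto simp: normal_fan_def simp flip: face_of_singleton)
  then have "normal_cone (polytrope c') {v'} \<in> normal_fan (polytrope c)" using sub by blast
  then obtain F where F: "normal_cone (polytrope c') {v'} = normal_cone (polytrope c) F"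
    "F face_of polytrope c" "F \<noteq> {}"
    unfolding normal_fan_def by blast
  \<comment> \<open>The fan does not record which faces its cones come from. This cone contains a
    basis of functionals that are constant on \<open>F\<close>, so \<open>F\<close> is a single
    vertex.\<close>
  have eq: "x = y" if "x \<in> F" "y \<in> F" for x y
  proof (rule span_inner_eqI[of B])
    fix e assume "e \<in> B"
    then have "edge_vec e \<in> normal_cone (polytrope c) F"
      using rec[OF c'(1) v'(1)] v'(2) F(1) by blast
    moreover have "x \<in> polytrope c" "y \<in> polytrope c" using that face_of_imp_subset[OF F(2)] by auto
    ultimately show "edge_vec e \<bullet> x = edge_vec e \<bullet> y"
      using that by (auto simp: normal_cone_def intro: antisym)
  qed (use bas in \<open>simp add: edge_basis_def\<close>)
  obtain v where "v \<in> F" using F(3) by blast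
  then have "F = {v}" using eq by auto
  then have v: "v extreme_point_of polytrope c" using F(2) by (simp add: face_of_singleton)
  then have "B = incident_facets c v"
    using rec[OF c'(1) v'(1)] rec[OF c(1) v] F(1) v'(2) \<open>F = {v}\<close> by simp
  then show "B \<in> vertex_bases c" using v by (auto simp: vertex_bases_def)
qed

lemma normal_fan_eq_iff:
  fixes c c' :: "real ^ 'n::finite edge"
  assumes "c \<in> polytrope_region" "maximal_polytrope c" "c' \<in> polytrope_region" "maximal_polytrope c'"
  shows "normal_fan (polytrope c') = normal_fan (polytrope c) \<longleftrightarrow> vertex_bases c' = vertex_bases c"
proof
  assume eq: "normal_fan (polytrope c') = normal_fan (polytrope c)"
  show "vertex_bases c' = vertex_bases c"
    using normal_fan_imp_vertex_bases_subset[of c c'] normal_fan_imp_vertex_bases_subset[of c' c]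
      maximal_polytropeD(1,2)[OF assms(2)] maximal_polytropeD(1,2)[OF assms(4)] assms(1,3) eq
    by (auto simp: polytrope_region_iff)
next
  assume "vertex_bases c' = vertex_bases c"
  then show "normal_fan (polytrope c') = normal_fan (polytrope c)"
    by (simp only: normal_fan_vertex_bases[OF maximal_polytropeD(1,2)[OF assms(2)]]
        normal_fan_vertex_bases[OF maximal_polytropeD(1,2)[OF assms(4)]])
qed

section \<open>Monomials and words\<close>

definition mono_eval :: "('e::finite \<Rightarrow> 'a::comm_semiring_1) \<Rightarrow> ('e \<Rightarrow>\<^sub>0 nat) \<Rightarrow> 'a" where
  "mono_eval h m = (\<Prod>e\<in>UNIV. h e ^ Poly_Mapping.lookup m e)"

lemma mono_eval_zero [simp]: "mono_eval h 0 = 1"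
  by (simp add: mono_eval_def)

lemma mono_eval_add: "mono_eval h (m + m') = mono_eval h m * mono_eval h m'"
  by (simp add: mono_eval_def lookup_add power_add prod.distrib)

lemma mono_eval_single [simp]: "mono_eval h (Poly_Mapping.single e k) = h e ^ k"
proof -
  have "mono_eval h (Poly_Mapping.single e k) = (\<Prod>f\<in>UNIV. if f = e then h e ^ k else 1)"
    unfolding mono_eval_def by (intro prod.cong) (auto simp: lookup_single)
  then show ?thesis by simp
qed

lemma mono_eval_mult: "mono_eval (\<lambda>e. g e * h e) m = mono_eval g m * mono_eval h m"
  by (simp add: mono_eval_def power_mult_distrib prod.distrib)

text \<open>Words list the terms of an expanded power one by one, which avoids multinomial
  coefficients.\<close>

definition words :: "nat \<Rightarrow> (nat \<Rightarrow> 'e::finite) set" where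
  "words k = PiE {..<k} (\<lambda>_. UNIV)"

definition word_mono :: "nat \<Rightarrow> (nat \<Rightarrow> 'e::finite) \<Rightarrow> ('e \<Rightarrow>\<^sub>0 nat)" where
  "word_mono k w = (\<Sum>i<k. Poly_Mapping.single (w i) 1)"

lemma finite_words [simp]: "finite (words k)"
  by (simp add: words_def finite_PiE)

lemma mono_eval_word_mono: "mono_eval h (word_mono k w) = (\<Prod>i<k. h (w i))"
  unfolding word_mono_def by (induction k) (simp_all add: mono_eval_add)

lemma power_sum_words: "(\<Sum>e\<in>UNIV. h e) ^ k = (\<Sum>w\<in>words k. mono_eval h (word_mono k w))"
proof -
  have "(\<Sum>e\<in>UNIV. h e) ^ k = (\<Prod>i<k. \<Sum>e\<in>UNIV. h e)" by simp
  also have "\<dots> = (\<Sum>w\<in>words k. mono_eval h (word_mono k w))"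
    unfolding words_def mono_eval_word_mono by (rule prod_sum_PiE) auto
  finally show ?thesis .
qed

lemma total_degree_add [simp]: "total_degree (m + m') = total_degree m + total_degree m'"
  by (simp add: total_degree_def lookup_add sum.distrib)

lemma total_degree_zero [simp]: "total_degree 0 = 0"
  by (simp add: total_degree_def)

lemma total_degree_single [simp]: "total_degree (Poly_Mapping.single e k) = k"
proof -
  have "total_degree (Poly_Mapping.single e k) = (\<Sum>f\<in>UNIV. if f = e then k else 0)"
    unfolding total_degree_def by (intro sum.cong) (auto simp: lookup_single)
  then show ?thesis by simp
qed

lemma total_degree_word_mono: "total_degree (word_mono k w) = k"
  unfolding word_mono_def by (induction k) simp_all

lemma monomial_split:
  fixes m :: "'e \<Rightarrow>\<^sub>0 nat"
  assumes "e \<in> Poly_Mapping.keys m"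
  obtains m' where "m = m' + Poly_Mapping.single e 1"
proof
  show "m = (m - Poly_Mapping.single e 1) + Poly_Mapping.single e 1"
    using assms by (intro poly_mapping_eqI) (auto simp: lookup_add lookup_minus lookup_single when_def in_keys_iff)
qed

lemma monomial_is_word:
  fixes m :: "'n::finite monomial"
  assumes "total_degree m = k"
  shows "\<exists>w\<in>words k. word_mono k w = m"
  using assms
proof (induction k arbitrary: m)
  case 0
  then have "m = 0" by (intro poly_mapping_eqI) (simp add: total_degree_def)
  then show ?case by (auto simp: words_def word_mono_def)
next
  case (Suc k)
  then have "m \<noteq> 0" by auto
  then obtain e where "e \<in> Poly_Mapping.keys m" by (metis ex_in_conv keys_eq_empty)
  then obtain m' where m: "m = m' + Poly_Mapping.single e 1" by (rule monomial_split)
  then have "total_degree m' = k" using Suc.prems by simp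
  then obtain w where w: "w \<in> words k" "word_mono k w = m'" using Suc.IH by blast
  have "w(k := e) \<in> words (Suc k)"
    using w(1) by (auto simp: words_def PiE_def extensional_def)
  moreover have "word_mono (Suc k) (w(k := e)) = m"
    using w(2) m by (simp add: word_mono_def)
  ultimately show ?case by blast
qed

section \<open>Polynomials vanishing on an open set\<close>

text \<open>Induction over the variables: with the others fixed, a polynomial in one variable has
  infinitely many roots, so each of its coefficients vanishes. Indexing the terms by an abstract set
  lets the induction restrict to terms with a given exponent.\<close>

lemma polynomial_zero_on_grid:
  fixes a :: "'s \<Rightarrow> real" and m :: "'s \<Rightarrow> 'e \<Rightarrow> nat"
  assumes "finite A" "finite S"
    and "\<And>s t. s \<in> S \<Longrightarrow> t \<in> S \<Longrightarrow> (\<forall>e\<in>A. m s e = m t e) \<Longrightarrow> s = t"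
    and "\<And>e. e \<in> A \<Longrightarrow> infinite (X e)"
    and "\<And>c. (\<forall>e\<in>A. c e \<in> X e) \<Longrightarrow> (\<Sum>s\<in>S. a s * (\<Prod>e\<in>A. c e ^ m s e)) = 0"
  shows "\<forall>s\<in>S. a s = 0"
  using assms
proof (induction A arbitrary: S rule: finite_induct)
  case empty
  show ?case
  proof
    fix s assume s: "s \<in> S"
    then have "S = {s}" using empty.prems(2) by blast
    then show "a s = 0" using empty.prems(4) by simp
  qed
next
  case (insert e A)
  have "\<forall>s\<in>{s\<in>S. m s e = k}. a s = 0" for k
  proof (rule insert.IH)
    fix s t assume "s \<in> {s \<in> S. m s e = k}" "t \<in> {s \<in> S. m s e = k}" "\<forall>e\<in>A. m s e = m t e"
    then show "s = t" using insert.prems(2)[of s t] by auto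
  next
    fix c assume c: "\<forall>e\<in>A. c e \<in> X e"
    define b where "b s = a s * (\<Prod>f\<in>A. c f ^ m s f)" for s
    define p where "p = (\<Sum>s\<in>S. monom (b s) (m s e))"
    have "poly p x = 0" if x: "x \<in> X e" for x
    proof -
      have "(\<Prod>f\<in>A. (c(e := x)) f ^ m s f) = (\<Prod>f\<in>A. c f ^ m s f)" for s
        using insert.hyps by (intro prod.cong) auto
      then have "poly p x = (\<Sum>s\<in>S. a s * (\<Prod>f\<in>insert e A. (c(e := x)) f ^ m s f))"
        using insert.hyps by (simp add: p_def b_def poly_sum poly_monom mult_ac)
      also have "\<dots> = 0" using c x by (intro insert.prems(4)) auto
      finally show ?thesis .
    qed
    then have "X e \<subseteq> {x. poly p x = 0}" by blast
    then have "p = 0" using poly_roots_finite insert.prems(3)[of e] finite_subset by blast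
    then have "coeff p k = 0" by simp
    also have "coeff p k = (\<Sum>s\<in>S. if m s e = k then b s else 0)"
      by (simp add: p_def coeff_sum)
    also have "\<dots> = (\<Sum>s\<in>{s\<in>S. m s e = k}. b s)"
      by (rule sum.inter_filter[OF insert.prems(1), symmetric])
    finally show "(\<Sum>s\<in>{s\<in>S. m s e = k}. a s * (\<Prod>f\<in>A. c f ^ m s f)) = 0" by (simp add: b_def)
  qed (use insert.prems in auto)
  then show ?case by blast
qed

lemma polynomial_zero_on_open:
  fixes U :: "(real ^ 'e::finite) set" and a :: "('e \<Rightarrow>\<^sub>0 nat) \<Rightarrow> real"
  assumes U: "open U" "c0 \<in> U" and S: "finite S"
    and zero: "\<And>c. c \<in> U \<Longrightarrow> (\<Sum>m\<in>S. a m * mono_eval (($) c) m) = 0"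
  shows "\<forall>m\<in>S. a m = 0"
proof -
  obtain l u where lu: "box l u \<subseteq> U" "c0 \<in> box l u" by (rule open_contains_box[OF U])
  show ?thesis
  proof (rule polynomial_zero_on_grid[where m = Poly_Mapping.lookup and A = UNIV and X = "\<lambda>e. {l $ e <..< u $ e}"])
    show "infinite {l $ e <..< u $ e}" for e
    proof -
      have "l $ e < c0 $ e" "c0 $ e < u $ e" using lu(2) by (auto simp: mem_box_cart)
      then show ?thesis by (simp add: infinite_Ioo)
    qed
    show "(\<Sum>m\<in>S. a m * (\<Prod>e\<in>UNIV. c e ^ Poly_Mapping.lookup m e)) = 0"
      if c: "\<forall>e\<in>UNIV. c e \<in> {l $ e <..< u $ e}" for c
    proof -
      have "(\<chi> e. c e) \<in> U" using lu(1) c by (auto simp: mem_box_cart)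
      from zero[OF this] show ?thesis by (simp add: mono_eval_def)
    qed
  qed (use S in \<open>auto intro: poly_mapping_eqI\<close>)
qed

section \<open>The localized degree\<close>

definition coord_on :: "real ^ 'n::finite \<Rightarrow> 'n edge set \<Rightarrow> 'n edge \<Rightarrow> real" where
  "coord_on \<xi> B e = (if e \<in> B then \<xi> \<bullet> dual_vec B e else 0)"

text \<open>
  Evaluation of the piecewise polynomial function given by a monomial at the generic point
  \<open>\<xi>\<close>, as in the localization formula for the degree on the cohomology of a toric variety.
\<close>

definition localized :: "real ^ 'n::finite edge \<Rightarrow> real ^ 'n \<Rightarrow> 'n monomial \<Rightarrow> real" where
  "localized c \<xi> m = (\<Sum>B\<in>vertex_bases c. mono_eval (coord_on \<xi> B) m / (\<Prod>e\<in>B. \<xi> \<bullet> dual_vec B e))"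

lemma sum_coord_on: "(\<Sum>e\<in>UNIV. f e * coord_on \<xi> B e) = (\<Sum>e\<in>B. (\<xi> \<bullet> dual_vec B e) * f e)"
  by (rule sum.mono_neutral_cong_right) (auto simp: coord_on_def)

text \<open>After exchanging the sums, the words at each vertex assemble the power of one linear
  form.\<close>

lemma sum_words_localized:
  "(\<Sum>w\<in>words k. mono_eval (($) c') (word_mono k w) * localized c \<xi> (word_mono k w)) =
   (\<Sum>B\<in>vertex_bases c. dual_sum c' \<xi> B ^ k / (\<Prod>e\<in>B. \<xi> \<bullet> dual_vec B e))"
proof -
  have "(\<Sum>w\<in>words k. mono_eval (($) c') (word_mono k w) * localized c \<xi> (word_mono k w)) =
     (\<Sum>B\<in>vertex_bases c. \<Sum>w\<in>words k. mono_eval (\<lambda>e. c' $ e * coord_on \<xi> B e) (word_mono k w) / (\<Prod>e\<in>B. \<xi> \<bullet> dual_vec B e))"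
    unfolding localized_def sum_distrib_left mono_eval_mult
    by (subst sum.swap) simp
  also have "\<dots> = (\<Sum>B\<in>vertex_bases c. dual_sum c' \<xi> B ^ k / (\<Prod>e\<in>B. \<xi> \<bullet> dual_vec B e))"
    by (simp add: dual_sum_def flip: sum_coord_on sum_divide_distrib power_sum_words)
  finally show ?thesis .
qed

lemma localized_eq_zero:
  assumes "\<And>B. B \<in> vertex_bases c \<Longrightarrow> \<not> Poly_Mapping.keys m \<subseteq> B"
  shows "localized c \<xi> m = 0"
  unfolding localized_def
proof (rule sum.neutral, rule ballI)
  fix B assume "B \<in> vertex_bases c"
  then obtain e where "e \<in> Poly_Mapping.keys m" "e \<notin> B" using assms by blast
  then have "mono_eval (coord_on \<xi> B) m = 0"
    unfolding mono_eval_def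
    by (intro prod_zero) (auto simp: coord_on_def in_keys_iff intro!: bexI[of _ e])
  then show "mono_eval (coord_on \<xi> B) m / (\<Prod>e\<in>B. \<xi> \<bullet> dual_vec B e) = 0" by simp
qed

definition basis_mono :: "'n::finite edge set \<Rightarrow> 'n monomial" where
  "basis_mono B = (\<Sum>e\<in>B. Poly_Mapping.single e 1)"

lemma mono_eval_basis_mono: "mono_eval h (basis_mono B) = (\<Prod>e\<in>B. h e)"
proof -
  have "mono_eval h (\<Sum>e\<in>B. Poly_Mapping.single e 1) = (\<Prod>e\<in>B. h e)" if "finite B"
    using that by induction (simp_all add: mono_eval_add)
  then show ?thesis by (simp add: basis_mono_def)
qed

lemma lookup_basis_mono: "Poly_Mapping.lookup (basis_mono B) e = of_bool (e \<in> B)"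
  by (simp add: basis_mono_def lookup_sum lookup_single when_def)

lemma keys_basis_mono [simp]: "Poly_Mapping.keys (basis_mono B) = B"
  by (auto simp: in_keys_iff lookup_basis_mono)

lemma total_degree_basis_mono [simp]: "total_degree (basis_mono B) = card B"
  by (simp add: total_degree_def lookup_basis_mono of_bool_def sum.If_cases)

text \<open>Bases have equal size, so no other vertex basis contains \<open>B\<close> and only its
  own summand survives.\<close>

lemma localized_basis_mono:
  fixes c :: "real ^ 'n::finite edge"
  assumes simp: "simple_polytrope c" and B: "B \<in> vertex_bases c" and gen: "generic c \<xi>"
  shows "localized c \<xi> (basis_mono B) = 1"
proof -
  have "mono_eval (coord_on \<xi> B') (basis_mono B) / (\<Prod>e\<in>B'. \<xi> \<bullet> dual_vec B' e) = (if B' = B then 1 else 0)"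
    if B': "B' \<in> vertex_bases c" for B'
  proof (cases "B' = B")
    case True
    have "mono_eval (coord_on \<xi> B) (basis_mono B) = (\<Prod>e\<in>B. \<xi> \<bullet> dual_vec B e)"
      unfolding mono_eval_basis_mono by (intro prod.cong) (auto simp: coord_on_def)
    moreover have "(\<Prod>e\<in>B. \<xi> \<bullet> dual_vec B e) \<noteq> 0" using gen B by (simp add: generic_def)
    ultimately show ?thesis using True by simp
  next
    case False
    have "card B = card B'"
      using vertex_bases_basis[OF simp B] vertex_bases_basis[OF simp B'] by (simp add: edge_basis_def)
    then have "\<not> B \<subseteq> B'" using False card_subset_eq[of B' B] by auto
    then obtain e where "e \<in> B" "e \<notin> B'" by blast
    then have "(\<Prod>e\<in>B. coord_on \<xi> B' e) = 0"
      by (intro prod_zero) (auto simp: coord_on_def intro!: bexI[of _ e])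
    then show ?thesis using False by (simp add: mono_eval_basis_mono)
  qed
  then show ?thesis unfolding localized_def using B by simp
qed

text \<open>
  The sum in the second part of \<open>volume_simple_polytrope\<close> is a polynomial in the weights whose
  coefficients are positive multiples of the localized degrees of the monomials of degree
  \<open>n - 2\<close>; it vanishes on the whole chamber.
\<close>

lemma localized_low_degree:
  fixes c :: "real ^ 'n::finite edge"
  assumes reg: "c \<in> polytrope_region" and max: "maximal_polytrope c" and gen: "generic c \<xi>"
    and deg: "total_degree m = CARD('n) - 1"
  shows "localized c \<xi> m = 0"
proof -
  let ?k = "CARD('n) - 1"
  obtain U where U: "open U" "c \<in> U"
    "\<And>c'. c' \<in> U \<Longrightarrow> c' \<in> polytrope_region \<and> maximal_polytrope c' \<and> vertex_bases c' = vertex_bases c"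
    using open_chamber[OF reg max] by metis
  let ?W = "words ?k :: (nat \<Rightarrow> 'n edge) set" and ?h = "word_mono ?k"
  define a where "a m = real (card {w \<in> ?W. ?h w = m}) * localized c \<xi> m" for m :: "'n monomial"
  have "\<forall>m\<in>?h ` ?W. a m = 0"
  proof (rule polynomial_zero_on_open[OF U(1,2)])
    fix c' assume c': "c' \<in> U"
    note U' = U(3)[OF c']
    have gen': "generic c' \<xi>" using gen U' by (simp add: generic_def)
    have "(\<Sum>m\<in>?h ` ?W. a m * mono_eval (($) c') m) =
      (\<Sum>m\<in>?h ` ?W. \<Sum>w\<in>{w \<in> ?W. ?h w = m}. mono_eval (($) c') (?h w) * localized c \<xi> (?h w))"
      by (rule sum.cong) (simp_all add: a_def)
    also have "\<dots> = (\<Sum>w\<in>?W. mono_eval (($) c') (?h w) * localized c \<xi> (?h w))"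
      by (rule sum.image_gen[symmetric]) simp
    also have "\<dots> = (\<Sum>B\<in>vertex_bases c'. dual_sum c' \<xi> B ^ ?k / (\<Prod>e\<in>B. \<xi> \<bullet> dual_vec B e))"
      using U' by (simp add: sum_words_localized)
    also have "\<dots> = 0"
      using volume_simple_polytrope(2)[OF _ _ gen'] maximal_polytropeD(1,2)[of c'] U' by blast
    finally show "(\<Sum>m\<in>?h ` ?W. a m * mono_eval (($) c') m) = 0" .
  qed simp
  moreover obtain w where w: "w \<in> ?W" "?h w = m" using monomial_is_word[OF deg] by blast
  ultimately have "a m = 0" by blast
  moreover have "real (card {w \<in> ?W. ?h w = m}) \<noteq> 0" using w by auto
  ultimately show ?thesis unfolding a_def mult_eq_0_iff by blast
qed

text \<open>At every vertex the coordinates of \<open>\<xi>\<close>, weighted by the linear form of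
  \<open>y\<close>, sum to the same number \<open>\<xi> \<bullet> y\<close>. It factors out and
  leaves the localized degree of \<open>m\<close>, which is one degree too low to be
  nonzero.\<close>

lemma localized_linear_relation:
  fixes c :: "real ^ 'n::finite edge"
  assumes reg: "c \<in> polytrope_region" and max: "maximal_polytrope c" and gen: "generic c \<xi>"
    and deg: "total_degree m = CARD('n) - 1"
  shows "(\<Sum>e\<in>UNIV. (edge_vec e \<bullet> y) * localized c \<xi> (m + Poly_Mapping.single e 1)) = 0"
proof -
  have "(\<Sum>e\<in>UNIV. (edge_vec e \<bullet> y) * localized c \<xi> (m + Poly_Mapping.single e 1)) =
    (\<Sum>B\<in>vertex_bases c. \<Sum>e\<in>UNIV. mono_eval (coord_on \<xi> B) m / (\<Prod>e\<in>B. \<xi> \<bullet> dual_vec B e) * ((edge_vec e \<bullet> y) * coord_on \<xi> B e))"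
    unfolding localized_def sum_distrib_left by (subst sum.swap) (simp add: mono_eval_add mult_ac)
  also have "\<dots> = (\<Sum>B\<in>vertex_bases c. mono_eval (coord_on \<xi> B) m / (\<Prod>e\<in>B. \<xi> \<bullet> dual_vec B e) * (\<xi> \<bullet> y))"
  proof (rule sum.cong[OF refl])
    fix B assume "B \<in> vertex_bases c"
    then have "edge_basis B" using vertex_bases_basis maximal_polytropeD(1)[OF max] by blast
    then show "(\<Sum>e\<in>UNIV. mono_eval (coord_on \<xi> B) m / (\<Prod>e\<in>B. \<xi> \<bullet> dual_vec B e) * ((edge_vec e \<bullet> y) * coord_on \<xi> B e))
       = mono_eval (coord_on \<xi> B) m / (\<Prod>e\<in>B. \<xi> \<bullet> dual_vec B e) * (\<xi> \<bullet> y)"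
      unfolding sum_distrib_left[symmetric] sum_coord_on by (simp flip: inner_expand)
  qed
  also have "\<dots> = localized c \<xi> m * (\<xi> \<bullet> y)" by (simp add: localized_def sum_distrib_right)
  finally show ?thesis using localized_low_degree[OF assms] by simp
qed

text \<open>Generic directions form a nonempty open set, which meets the dense set of rational
  points. Rationality makes the localized degrees usable as constants of the weight field.\<close>

lemma exists_rational_generic:
  fixes c :: "real ^ 'n::finite edge"
  assumes simp: "simple_polytrope c"
  obtains \<xi> where "generic c \<xi>" "\<And>k. \<xi> $ k \<in> \<rat>"
proof -
  define D where "D = (\<Union>B\<in>vertex_bases c. dual_vec B ` B)"
  have D0: "0 \<notin> D"
  proof
    assume "0 \<in> D"
    then obtain B e where B: "B \<in> vertex_bases c" "e \<in> B" "dual_vec B e = 0" by (auto simp: D_def)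
    then show False using inner_dual_vec[OF vertex_bases_basis[OF simp B(1)] B(2,2)] by simp
  qed
  have finD: "finite D" by (auto simp: D_def)
  obtain \<eta> where \<eta>: "\<And>d. d \<in> D \<Longrightarrow> \<eta> \<bullet> d \<noteq> 0"
    using exists_off_hyperplanes[OF open_UNIV _ finD D0] by (metis UNIV_not_empty)
  define U where "U = (\<Inter>d\<in>D. {x. x \<bullet> d \<noteq> 0})"
  have "open {x. x \<bullet> d \<noteq> 0}" for d :: "real ^ 'n"
    by (intro open_Collect_neq continuous_intros)
  then have "open U" unfolding U_def using finD by (intro open_INT) auto
  moreover have "\<eta> \<in> U" using \<eta> by (auto simp: U_def)
  moreover define S :: "(real ^ 'n) set" where "S = (\<Union>f\<in>Basis \<rightarrow> \<rat>. {\<Sum>i\<in>Basis. f i *\<^sub>R i})"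
  have "closure S = UNIV" unfolding S_def by (rule closure_rational_coordinates)
  ultimately have "U \<inter> S \<noteq> {}" using open_Int_closure_eq_empty[of U S] by auto
  then obtain f where \<xi>: "(\<Sum>i\<in>Basis. f i *\<^sub>R i) \<in> U" "f \<in> Basis \<rightarrow> \<rat>" by (auto simp: S_def)
  show ?thesis
  proof (rule that)
    show "generic c (\<Sum>i\<in>Basis. f i *\<^sub>R i)" using \<xi>(1) unfolding generic_def U_def D_def by blast
    fix k :: 'n
    have k: "axis k (1::real) \<in> Basis" by (auto simp: Basis_vec_def)
    then have "(\<Sum>i\<in>Basis. f i *\<^sub>R i) $ k = f (axis k 1)"
      by (simp only: cart_eq_inner_axis inner_sum_left_Basis)
    then show "(\<Sum>i\<in>Basis. f i *\<^sub>R i) $ k \<in> \<rat>" using \<xi>(2) k by auto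
  qed
qed

lemma localized_rational:
  fixes c :: "real ^ 'n::finite edge"
  assumes simp: "simple_polytrope c" and \<xi>: "\<And>k. \<xi> $ k \<in> \<rat>"
  shows "localized c \<xi> m \<in> \<rat>"
proof -
  have d: "\<xi> \<bullet> dual_vec B e \<in> \<rat>" if "B \<in> vertex_bases c" "e \<in> B" for B e
  proof -
    have "dual_vec B e $ k \<in> \<rat>" for k
      using coord_dual_vec_Ints[OF vertex_bases_basis[OF simp that(1)] that(2), of "Some k"] Ints_subset_Rats by auto
    then show ?thesis using \<xi> unfolding inner_vec_def inner_real_def by (intro Rats_sum Rats_mult)
  qed
  have "mono_eval (coord_on \<xi> B) m \<in> \<rat>" if "B \<in> vertex_bases c" for B
  proof -
    have "coord_on \<xi> B e \<in> \<rat>" for e using d[OF that] by (simp add: coord_on_def)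
    then show ?thesis unfolding mono_eval_def by (intro Rats_prod Rats_power)
  qed
  then show ?thesis using d unfolding localized_def
    by (intro Rats_sum Rats_divide Rats_prod) auto
qed

section \<open>The volume polynomial\<close>

lemma weight_poly_eval_superset:
  assumes "finite S" "Poly_Mapping.keys V \<subseteq> S"
  shows "weight_poly_eval V c = (\<Sum>m\<in>S. of_rat (Poly_Mapping.lookup V m) * mono_eval (($) c) m)"
  unfolding weight_poly_eval_def mono_eval_def
  by (rule sum.mono_neutral_left) (use assms in \<open>auto simp: in_keys_iff\<close>)

lemma weight_poly_eval_add: "weight_poly_eval (V + W) c = weight_poly_eval V c + weight_poly_eval W c"
proof -
  let ?S = "Poly_Mapping.keys V \<union> Poly_Mapping.keys W"
  have "weight_poly_eval (V + W) c = (\<Sum>m\<in>?S. of_rat (Poly_Mapping.lookup (V + W) m) * mono_eval (($) c) m)"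
    by (rule weight_poly_eval_superset) (use keys_add[of V W] in auto)
  also have "\<dots> = (\<Sum>m\<in>?S. of_rat (Poly_Mapping.lookup V m) * mono_eval (($) c) m) +
     (\<Sum>m\<in>?S. of_rat (Poly_Mapping.lookup W m) * mono_eval (($) c) m)"
    by (simp add: lookup_add of_rat_add distrib_right sum.distrib)
  finally show ?thesis
    using weight_poly_eval_superset[of ?S V c] weight_poly_eval_superset[of ?S W c] by simp
qed

lemma weight_poly_eval_single:
  "weight_poly_eval (Poly_Mapping.single m r) c = of_rat r * mono_eval (($) c) m"
  by (subst weight_poly_eval_superset[of "{m}"]) auto

lemma weight_poly_eval_zero [simp]: "weight_poly_eval 0 c = 0"
  by (simp add: weight_poly_eval_def)

lemma weight_poly_eval_sum:
  "weight_poly_eval (\<Sum>x\<in>A. f x) c = (\<Sum>x\<in>A. weight_poly_eval (f x) c)"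
  by (induction A rule: infinite_finite_induct) (simp_all add: weight_poly_eval_add)

text \<open>Two candidates agree on a whole neighbourhood of \<open>c\<close>, hence in all
  coefficients.\<close>

lemma volume_polynomial_unique:
  assumes reg: "c \<in> polytrope_region" and max: "maximal_polytrope c"
    and V: "is_volume_polynomial c V" "is_volume_polynomial c W"
  shows "V = W"
proof -
  obtain U where U: "open U" "c \<in> U"
    "\<And>c'. c' \<in> U \<Longrightarrow> c' \<in> polytrope_region \<and> maximal_polytrope c' \<and> vertex_bases c' = vertex_bases c"
    using open_chamber[OF reg max] by metis
  let ?S = "Poly_Mapping.keys V \<union> Poly_Mapping.keys W"
  have "\<forall>m\<in>?S. of_rat (Poly_Mapping.lookup V m) - of_rat (Poly_Mapping.lookup W m) = (0::real)"
  proof (rule polynomial_zero_on_open[OF U(1,2)])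
    fix c' assume "c' \<in> U"
    note c' = U(3)[OF this]
    then have "normal_fan (polytrope c') = normal_fan (polytrope c)"
      using normal_fan_eq_iff[OF reg max] by blast
    then have "weight_poly_eval V c' = weight_poly_eval W c'"
      using V c' by (simp add: is_volume_polynomial_def)
    then show "(\<Sum>m\<in>?S. (of_rat (Poly_Mapping.lookup V m) - of_rat (Poly_Mapping.lookup W m)) * mono_eval (($) c') m) = 0"
      using weight_poly_eval_superset[of ?S V c'] weight_poly_eval_superset[of ?S W c']
      by (simp add: left_diff_distrib sum_subtractf)
  qed simp
  then have "\<forall>m\<in>?S. Poly_Mapping.lookup V m = Poly_Mapping.lookup W m" by simp
  then show ?thesis by (intro poly_mapping_eqI) (metis UnI1 UnI2 in_keys_iff)
qed

lemma is_volume_polynomial_localized: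
  fixes c :: "real ^ 'n::finite edge"
  assumes reg: "c \<in> polytrope_region" and max: "maximal_polytrope c" and gen: "generic c \<xi>"
    and r: "\<And>m. total_degree m = CARD('n) \<Longrightarrow> of_rat (r m) = localized c \<xi> m"
  shows "is_volume_polynomial c
    (\<Sum>w\<in>words CARD('n). Poly_Mapping.single (word_mono CARD('n) w) (r (word_mono CARD('n) w)))"
    (is "is_volume_polynomial c ?V")
  unfolding is_volume_polynomial_def
proof (intro ballI impI, elim conjE)
  fix c' assume c': "c' \<in> polytrope_region" "maximal_polytrope c'" "normal_fan (polytrope c') = normal_fan (polytrope c)"
  then have vb: "vertex_bases c' = vertex_bases c" using normal_fan_eq_iff[OF reg max] by blast
  then have gen': "generic c' \<xi>" using gen by (simp add: generic_def)
  have "weight_poly_eval ?V c' =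
     (\<Sum>w\<in>words CARD('n). mono_eval (($) c') (word_mono CARD('n) w) * localized c \<xi> (word_mono CARD('n) w))"
    unfolding weight_poly_eval_sum weight_poly_eval_single
    by (intro sum.cong) (simp_all add: r total_degree_word_mono mult.commute)
  also have "\<dots> = (\<Sum>B\<in>vertex_bases c'. dual_sum c' \<xi> B ^ CARD('n) / (\<Prod>e\<in>B. \<xi> \<bullet> dual_vec B e))"
    by (simp add: sum_words_localized vb)
  also have "\<dots> = fact CARD('n) * measure lborel (polytrope c')"
    using volume_simple_polytrope(1)[OF _ _ gen'] maximal_polytropeD(1,2)[OF c'(2)] by simp
  finally show "weight_poly_eval ?V c' = fact CARD('n) * measure lborel (polytrope c')" .
qed

section \<open>Monomial orders and normal forms\<close>

interpretation ring_module: module "(*) :: 'a::comm_ring_1 \<Rightarrow> 'a \<Rightarrow> 'a"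
  by standard (simp_all add: algebra_simps)

section \<open>Dickson's lemma\<close>

lemma nat_seq_mono_subseq:
  fixes s :: "nat \<Rightarrow> nat"
  obtains r :: "nat \<Rightarrow> nat" where "strict_mono r" "\<And>i j. i \<le> j \<Longrightarrow> s (r i) \<le> s (r j)"
proof -
  obtain r :: "nat \<Rightarrow> nat" where r: "strict_mono r" "monoseq (\<lambda>n. s (r n))"
    using seq_monosub[of s] by blast
  from r(2) consider "\<forall>m n. m \<le> n \<longrightarrow> s (r m) \<le> s (r n)" | "\<forall>m n. m \<le> n \<longrightarrow> s (r n) \<le> s (r m)"
    by (auto simp: monoseq_def)
  then show ?thesis
  proof cases
    case 1
    then show ?thesis using that r by blast
  next
    case 2
    \<comment> \<open>A nonincreasing sequence of naturals is constant from the index on at which it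
      attains its minimum.\<close>
    obtain k where k: "\<And>n. s (r k) \<le> s (r n)"
      using ex_has_least_nat[of "\<lambda>_. True" _ "\<lambda>n. s (r n)"] by auto
    have "strict_mono (\<lambda>n. r (k + n))" using r(1) by (auto simp: strict_mono_def)
    moreover have "s (r (k + i)) \<le> s (r (k + j))" for i j
      using 2[rule_format, of k "k + i"] k[of "k + j"] by simp
    ultimately show ?thesis using that[of "\<lambda>n. r (k + n)"] by blast
  qed
qed

lemma dickson_subseq:
  fixes f :: "nat \<Rightarrow> 'e \<Rightarrow> nat"
  assumes "finite A"
  shows "\<exists>r :: nat \<Rightarrow> nat. strict_mono r \<and> (\<forall>e\<in>A. \<forall>i j. i \<le> j \<longrightarrow> f (r i) e \<le> f (r j) e)"
  using assms
proof (induction A rule: finite_induct)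
  case empty
  show ?case by (intro exI[of _ id]) (simp add: strict_mono_def)
next
  case (insert e A)
  then obtain r :: "nat \<Rightarrow> nat" where r: "strict_mono r"
    "\<forall>e\<in>A. \<forall>i j. i \<le> j \<longrightarrow> f (r i) e \<le> f (r j) e" by blast
  obtain t :: "nat \<Rightarrow> nat" where t: "strict_mono t" "\<And>i j. i \<le> j \<Longrightarrow> f (r (t i)) e \<le> f (r (t j)) e"
    using nat_seq_mono_subseq[of "\<lambda>i. f (r i) e"] by metis
  have "strict_mono (\<lambda>i. r (t i))" using r(1) t(1) by (simp add: strict_mono_def)
  moreover have "t i \<le> t j" if "i \<le> j" for i j using t(1) that by (simp add: strict_mono_less_eq)
  ultimately show ?case using r(2) t(2) by (intro exI[of _ "\<lambda>i. r (t i)"]) simp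
qed

lemma poly_mapping_sum_single:
  "f = (\<Sum>m\<in>Poly_Mapping.keys f. Poly_Mapping.single m (Poly_Mapping.lookup f m))"
proof (rule poly_mapping_eqI)
  fix k
  have "Poly_Mapping.lookup (\<Sum>m\<in>Poly_Mapping.keys f. Poly_Mapping.single m (Poly_Mapping.lookup f m)) k
    = (\<Sum>m\<in>Poly_Mapping.keys f. if m = k then Poly_Mapping.lookup f k else 0)"
    unfolding lookup_sum by (intro sum.cong) (auto simp: lookup_single)
  also have "\<dots> = Poly_Mapping.lookup f k"
    by (simp add: not_in_keys_iff_lookup_eq_zero)
  finally show "Poly_Mapping.lookup f k = Poly_Mapping.lookup (\<Sum>m\<in>Poly_Mapping.keys f. Poly_Mapping.single m (Poly_Mapping.lookup f m)) k"
    by simp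
qed

lemma lookup_single_mult:
  fixes g :: "('a::cancel_comm_monoid_add) \<Rightarrow>\<^sub>0 ('k::comm_semiring_1)"
  shows "Poly_Mapping.lookup (Poly_Mapping.single s c * g) (s + t) = c * Poly_Mapping.lookup g t"
proof -
  have eq: "Poly_Mapping.single s c * g =
    (\<Sum>m\<in>Poly_Mapping.keys g. Poly_Mapping.single (s + m) (c * Poly_Mapping.lookup g m))"
    by (subst poly_mapping_sum_single[of g]) (simp add: sum_distrib_left mult_single)
  have "Poly_Mapping.lookup (Poly_Mapping.single s c * g) (s + t) =
    (\<Sum>m\<in>Poly_Mapping.keys g. if m = t then c * Poly_Mapping.lookup g t else 0)"
    unfolding eq lookup_sum by (rule sum.cong) (auto simp: lookup_single)
  also have "\<dots> = c * Poly_Mapping.lookup g t"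
    by (simp add: not_in_keys_iff_lookup_eq_zero)
  finally show ?thesis .
qed

lemma keys_single_mult:
  fixes g :: "('a::cancel_comm_monoid_add) \<Rightarrow>\<^sub>0 ('k::comm_semiring_1)"
  shows "Poly_Mapping.keys (Poly_Mapping.single s c * g) \<subseteq> (+) s ` Poly_Mapping.keys g"
  using keys_mult[of "Poly_Mapping.single s c" g] by (auto split: if_splits)

text \<open>Monomial ideals: a set of monomials closed under multiples yields an ideal. It bounds
  leading ideals, the ideal \<open>M\<close> and the ideals of variables from above.\<close>

lemma subspace_keys:
  assumes "\<And>a b. P b \<Longrightarrow> P (a + b)"
  shows "module.subspace (*) {f :: ('m::comm_monoid_add) \<Rightarrow>\<^sub>0 ('k::comm_ring_1). \<forall>m\<in>Poly_Mapping.keys f. P m}"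
    (is "module.subspace (*) ?T")
proof (rule ring_module.subspaceI)
  show "x + y \<in> ?T" if "x \<in> ?T" "y \<in> ?T" for x y
    using that keys_add[of x y] by blast
  show "r * x \<in> ?T" if "x \<in> ?T" for r x
    using that keys_mult[of r x] assms by fastforce
qed simp

section \<open>Division with respect to a monomial order\<close>

locale monom_order =
  fixes le :: "'n::finite monomial \<Rightarrow> 'n monomial \<Rightarrow> bool"
  assumes order: "monomial_order le"
begin

abbreviation lt where "lt s t \<equiv> le s t \<and> s \<noteq> t"

lemma le_linorder: "class.linorder le lt"
  using order by (simp add: monomial_order_def)

lemma le_refl [simp]: "le s s"
  and le_trans: "le s t \<Longrightarrow> le t u \<Longrightarrow> le s u"
  and le_antisym: "le s t \<Longrightarrow> le t s \<Longrightarrow> s = t"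
  and le_total: "le s t \<or> le t s"
proof -
  note ax = le_linorder[unfolded class.linorder_def class.linorder_axioms_def class.order_def
      class.order_axioms_def class.preorder_def]
  have "\<forall>x. le x x" using ax by (elim conjE) assumption
  then show "le s s" by blast
  have "\<forall>x y z. le x y \<longrightarrow> le y z \<longrightarrow> le x z" using ax by (elim conjE) assumption
  then show "le s t \<Longrightarrow> le t u \<Longrightarrow> le s u" by blast
  have "\<forall>x y. le x y \<longrightarrow> le y x \<longrightarrow> x = y" using ax by (elim conjE) assumption
  then show "le s t \<Longrightarrow> le t s \<Longrightarrow> s = t" by blast
  have "\<forall>x y. le x y \<or> le y x" using ax by (elim conjE) assumption
  then show "le s t \<or> le t s" by blast
qed

lemma le_zero [simp]: "le 0 s" and le_add: "le s t \<Longrightarrow> le (s + u) (t + u)"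
  using order by (auto simp: monomial_order_def)

text \<open>By Dickson's lemma an infinite descending chain has an earlier term that divides a later
  one, but a divisor is never larger than its multiple.\<close>

lemma wf_lt: "wfp lt"
  unfolding wfp_def wf_iff_no_infinite_down_chain
proof
  assume "\<exists>f. \<forall>i. (f (Suc i), f i) \<in> {(x, y). lt x y}"
  then obtain f where f: "\<And>i. lt (f (Suc i)) (f i)" by auto
  have dec: "le (f (i + k)) (f i)" for i k
    by (induction k) (use f le_trans in \<open>auto simp: add_Suc_right\<close>)
  obtain r :: "nat \<Rightarrow> nat" where r: "strict_mono r"
    "\<And>e i j. i \<le> j \<Longrightarrow> Poly_Mapping.lookup (f (r i)) e \<le> Poly_Mapping.lookup (f (r j)) e"
    using dickson_subseq[of UNIV "\<lambda>i. Poly_Mapping.lookup (f i)"] by auto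
  have "r 0 < r 1" using r(1) by (simp add: strict_mono_def)
  then obtain k where k: "r 1 = Suc (r 0) + k" using less_iff_Suc_add by auto
  have "f (r 1) = (f (r 1) - f (r 0)) + f (r 0)"
    using r(2)[of 0 1] by (intro poly_mapping_eqI) (simp add: lookup_add lookup_minus)
  then have "le (f (r 0)) (f (r 1))" using le_add[OF le_zero, of "f (r 0)" "f (r 1) - f (r 0)"] by simp
  moreover have "le (f (r 1)) (f (Suc (r 0)))" unfolding k by (rule dec)
  ultimately have "le (f (r 0)) (f (Suc (r 0)))" by (rule le_trans)
  then show False using f[of "r 0"] le_antisym by blast
qed

lemma finite_has_max: "finite S \<Longrightarrow> S \<noteq> {} \<Longrightarrow> \<exists>m\<in>S. \<forall>m'\<in>S. le m' m"
proof (induction S rule: finite_ne_induct)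
  case (insert x S)
  then obtain m where m: "m \<in> S" "\<forall>m'\<in>S. le m' m" by blast
  show ?case
  proof (cases "le x m")
    case True
    then show ?thesis using m by auto
  next
    case False
    then have "le m x" using le_total by blast
    then show ?thesis using m le_trans by (intro bexI[of _ x]) auto
  qed
qed simp

abbreviation lm where "lm \<equiv> leading_monomial le"

lemma lm:
  fixes f :: "'n monomial \<Rightarrow>\<^sub>0 'k::field"
  assumes "f \<noteq> 0"
  shows "lm f \<in> Poly_Mapping.keys f" "m \<in> Poly_Mapping.keys f \<Longrightarrow> le m (lm f)"
proof -
  have "\<exists>!m. m \<in> Poly_Mapping.keys f \<and> (\<forall>m'\<in>Poly_Mapping.keys f. le m' m)"
    using finite_has_max[of "Poly_Mapping.keys f"] assms le_antisym by auto
  from theI'[OF this] show "lm f \<in> Poly_Mapping.keys f" "m \<in> Poly_Mapping.keys f \<Longrightarrow> le m (lm f)"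
    by (auto simp: leading_monomial_def)
qed

lemma leading_coeff_nonzero: "f \<noteq> 0 \<Longrightarrow> leading_coeff le f \<noteq> 0"
  using lm(1)[of f] by (simp add: leading_coeff_def in_keys_iff)

lemma lm_single_mult:
  fixes f :: "'n monomial \<Rightarrow>\<^sub>0 'k::field"
  assumes "f \<noteq> 0"
  shows "Poly_Mapping.single s 1 * f \<noteq> 0" "lm (Poly_Mapping.single s 1 * f) = s + lm f"
proof -
  let ?g = "Poly_Mapping.single s 1 * f"
  have "Poly_Mapping.lookup ?g (s + lm f) \<noteq> 0"
    using lm(1)[OF assms] by (simp add: lookup_single_mult in_keys_iff)
  then have k: "s + lm f \<in> Poly_Mapping.keys ?g" by (simp add: in_keys_iff)
  then show nz: "?g \<noteq> 0" by auto
  obtain t where t: "t \<in> Poly_Mapping.keys f" "lm ?g = s + t"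
    using keys_single_mult[of s 1 f] lm(1)[OF nz] by blast
  have "le (t + s) (lm f + s)" using lm(2)[OF assms t(1)] by (rule le_add)
  then have "le (lm ?g) (s + lm f)" using t(2) by (simp add: add.commute)
  then show "lm ?g = s + lm f" by (rule le_antisym) (rule lm(2)[OF nz k])
qed

lemma leading_ideal_keys:
  fixes J :: "('n monomial \<Rightarrow>\<^sub>0 'k::field) set"
  assumes "f \<in> leading_ideal le J" "m \<in> Poly_Mapping.keys f"
  obtains g s where "g \<in> J" "g \<noteq> 0" "m = s + lm g"
proof -
  define T where "T = {f :: 'n monomial \<Rightarrow>\<^sub>0 'k. \<forall>m\<in>Poly_Mapping.keys f. \<exists>g\<in>J. g \<noteq> 0 \<and> (\<exists>s. m = s + lm g)}"
  have "module.subspace (*) T"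
    unfolding T_def by (rule subspace_keys) (metis add.assoc)
  moreover have "leading_term le ` J \<subseteq> T"
  proof
    fix h assume "h \<in> leading_term le ` J"
    then obtain g where g: "g \<in> J" "h = leading_term le g" by blast
    show "h \<in> T"
    proof (cases "g = 0")
      case True
      then have "h = 0" using g by (simp add: leading_term_def leading_coeff_def)
      then show ?thesis by (simp add: T_def)
    next
      case False
      then show ?thesis
        using g unfolding T_def leading_term_def
        by (auto intro!: bexI[of _ g] exI[of _ 0])
    qed
  qed
  ultimately have "leading_ideal le J \<subseteq> T"
    unfolding leading_ideal_def by (rule ring_module.span_minimal[rotated])
  then show ?thesis using assms that unfolding T_def by blast
qed

text \<open>In an ideal the leading monomials are already closed under multiples, so the leading
  ideal contributes no further monomials.\<close>

lemma standard_monomial_iff: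
  fixes J :: "('n monomial \<Rightarrow>\<^sub>0 'k::field) set"
  assumes J: "module.subspace (*) J"
  shows "standard_monomial le J m \<longleftrightarrow> \<not> (\<exists>f\<in>J. f \<noteq> 0 \<and> lm f = m)"
proof -
  have "Poly_Mapping.single m 1 \<in> leading_ideal le J \<longleftrightarrow> (\<exists>f\<in>J. f \<noteq> 0 \<and> lm f = m)"
  proof
    assume "Poly_Mapping.single m 1 \<in> leading_ideal le J"
    then obtain g s where g: "g \<in> J" "g \<noteq> 0" "m = s + lm g"
      by (rule leading_ideal_keys[where m = m]) auto
    have "Poly_Mapping.single s 1 * g \<in> J" using J g(1) by (rule ring_module.subspace_scale)
    then show "\<exists>f\<in>J. f \<noteq> 0 \<and> lm f = m" using lm_single_mult[OF g(2), of s] g(3) by blast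
  next
    assume "\<exists>f\<in>J. f \<noteq> 0 \<and> lm f = m"
    then obtain f where f: "f \<in> J" "f \<noteq> 0" "lm f = m" by blast
    have "Poly_Mapping.single 0 (1 / leading_coeff le f) * leading_term le f \<in> leading_ideal le J"
      unfolding leading_ideal_def using f(1)
      by (intro ring_module.span_scale ring_module.span_base) blast
    then show "Poly_Mapping.single m 1 \<in> leading_ideal le J"
      using leading_coeff_nonzero[OF f(2)] f(3) by (simp add: leading_term_def mult_single)
  qed
  then show ?thesis by (simp add: standard_monomial_def)
qed

lemma standard_in_ideal_zero:
  fixes J :: "('n monomial \<Rightarrow>\<^sub>0 'k::field) set"
  assumes J: "module.subspace (*) J" and f: "f \<in> J" "\<And>m. m \<in> Poly_Mapping.keys f \<Longrightarrow> standard_monomial le J m"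
  shows "f = 0"
proof (rule ccontr)
  assume nz: "f \<noteq> 0"
  then have "standard_monomial le J (lm f)" using f(2) lm(1) by blast
  then show False using f(1) nz standard_monomial_iff[OF J] by blast
qed

lemma reduces_to_ideal:
  fixes J :: "('n monomial \<Rightarrow>\<^sub>0 'k::field) set"
  assumes "module.subspace (*) J" "G \<subseteq> J" "(reduces_to le G)\<^sup>*\<^sup>* f r"
  shows "f - r \<in> J"
  using assms(3)
proof (induction rule: rtranclp_induct)
  case base
  show ?case using ring_module.subspace_0[OF assms(1)] by simp
next
  case (step y z)
  then obtain g p where "g \<in> G" "z = y - p * g" by (auto simp: reduces_to_def)
  then have "y - z \<in> J" using assms(1,2) ring_module.subspace_scale[of J g p] by auto
  then have "(f - y) + (y - z) \<in> J" by (rule ring_module.subspace_add[OF assms(1) step.IH])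
  then show ?case by simp
qed

lemma normal_form_props:
  fixes J :: "('n monomial \<Rightarrow>\<^sub>0 'k::field) set"
  assumes J: "module.subspace (*) J" and G: "groebner_basis le J G" and nf: "normal_form le G f r"
  shows "f - r \<in> J" "m \<in> Poly_Mapping.keys r \<Longrightarrow> standard_monomial le J m"
proof -
  show "f - r \<in> J"
    using reduces_to_ideal[OF J, of G f r] G nf by (simp add: groebner_basis_def normal_form_def)
  assume m: "m \<in> Poly_Mapping.keys r"
  show "standard_monomial le J m"
  proof (rule ccontr)
    assume "\<not> ?thesis"
    then have "Poly_Mapping.single m 1 \<in> leading_ideal le G"
      using G by (simp add: standard_monomial_def groebner_basis_def)
    then obtain g s where g: "g \<in> G" "g \<noteq> 0" "m = s + lm g"
      by (rule leading_ideal_keys[where m = m]) auto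
    then have "\<exists>h. reduces_to le G r h" using m unfolding reduces_to_def by blast
    then show False using nf by (simp add: normal_form_def)
  qed
qed

definition reducible_keys where
  "reducible_keys G f = {m \<in> Poly_Mapping.keys f. \<exists>g\<in>G. g \<noteq> 0 \<and> (\<exists>s. m = s + lm g)}"

text \<open>Reducing at the largest reducible monomial removes it and creates only smaller ones,
  which turns termination into an induction along the order.\<close>

lemma reduce_at_max:
  fixes f :: "'n monomial \<Rightarrow>\<^sub>0 'k::field"
  assumes "reducible_keys G f \<noteq> {}"
  obtains m h where "m \<in> reducible_keys G f" "reduces_to le G f h" "\<And>k. k \<in> reducible_keys G h \<Longrightarrow> lt k m"
proof -
  have "finite (reducible_keys G f)" by (simp add: reducible_keys_def)
  from finite_has_max[OF this assms] obtain m where m: "m \<in> reducible_keys G f"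
    "\<And>m'. m' \<in> reducible_keys G f \<Longrightarrow> le m' m" by blast
  then obtain g s where g: "g \<in> G" "g \<noteq> 0" "m = s + lm g" "m \<in> Poly_Mapping.keys f"
    by (auto simp: reducible_keys_def)
  let ?p = "Poly_Mapping.single s (Poly_Mapping.lookup f m / leading_coeff le g) * g"
  define h where "h = f - ?p"
  have red: "reduces_to le G f h"
    unfolding reduces_to_def h_def using g by blast
  have "lt k m" if k: "k \<in> reducible_keys G h" for k
  proof -
    have "k \<noteq> m"
    proof
      assume "k = m"
      have "Poly_Mapping.lookup ?p m = Poly_Mapping.lookup f m"
        unfolding g(3) lookup_single_mult using leading_coeff_nonzero[OF g(2)] by (simp add: leading_coeff_def)
      then have "Poly_Mapping.lookup h m = 0" by (simp add: h_def lookup_minus)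
      then show False using k \<open>k = m\<close> by (simp add: reducible_keys_def in_keys_iff)
    qed
    moreover have "le k m"
    proof (cases "k \<in> Poly_Mapping.keys ?p")
      case True
      then obtain t where t: "t \<in> Poly_Mapping.keys g" "k = s + t" using keys_single_mult by blast
      then show ?thesis using le_add[OF lm(2)[OF g(2) t(1)], of s] g(3) by (simp add: add.commute)
    next
      case False
      then have "Poly_Mapping.lookup h k = Poly_Mapping.lookup f k"
        by (simp add: h_def lookup_minus not_in_keys_iff_lookup_eq_zero)
      then have "k \<in> reducible_keys G f" using k by (simp add: reducible_keys_def in_keys_iff)
      then show ?thesis by (rule m(2))
    qed
    ultimately show ?thesis by blast
  qed
  then show ?thesis using that m(1) red by blast
qed

lemma normal_form_exists: "\<exists>r. normal_form le G f r" for f :: "'n monomial \<Rightarrow>\<^sub>0 'k::field"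
proof -
  have irr: "normal_form le G f f" if "reducible_keys G f = {}" for f :: "'n monomial \<Rightarrow>\<^sub>0 'k"
    using that by (auto simp: normal_form_def reduces_to_def reducible_keys_def)
  \<comment> \<open>The induction runs over a bound \<open>b\<close> for the reducible monomials;
    one reduction at the top lowers it.\<close>
  have bounded: "\<exists>r. normal_form le G f r" if "\<And>k. k \<in> reducible_keys G f \<Longrightarrow> le k b"
    for b and f :: "'n monomial \<Rightarrow>\<^sub>0 'k"
    using that
  proof (induction b arbitrary: f rule: wfp_induct_rule[OF wf_lt])
    case (1 b)
    show ?case
    proof (cases "reducible_keys G f = {}")
      case False
      then obtain m h where m: "m \<in> reducible_keys G f" "reduces_to le G f h"
        "\<And>k. k \<in> reducible_keys G h \<Longrightarrow> lt k m" using reduce_at_max by metis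
      have "\<exists>r. normal_form le G h r"
      proof (cases "reducible_keys G h = {}")
        case ne: False
        have "finite (reducible_keys G h)" by (simp add: reducible_keys_def)
        from finite_has_max[OF this ne] obtain k where k: "k \<in> reducible_keys G h"
          "\<And>k'. k' \<in> reducible_keys G h \<Longrightarrow> le k' k" by blast
        have "lt k b" using m(3)[OF k(1)] "1.prems"[OF m(1)] le_trans le_antisym by blast
        then show ?thesis using "1.IH"[of k h] k(2) by blast
      qed (use irr in blast)
      then obtain r where "normal_form le G h r" by blast
      then have "normal_form le G f r"
        using m(2) by (auto simp: normal_form_def intro: converse_rtranclp_into_rtranclp)
      then show ?thesis by blast
    qed (use irr in blast)
  qed
  show ?thesis
  proof (cases "reducible_keys G f = {}")
    case False
    have "finite (reducible_keys G f)" by (simp add: reducible_keys_def)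
    from finite_has_max[OF this False] show ?thesis using bounded by blast
  qed (use irr in blast)
qed

end

section \<open>Linear functionals on polynomials\<close>

definition lin :: "('m \<Rightarrow> 'k) \<Rightarrow> ('m \<Rightarrow>\<^sub>0 'k::comm_ring_1) \<Rightarrow> 'k" where
  "lin \<phi> f = (\<Sum>m\<in>Poly_Mapping.keys f. Poly_Mapping.lookup f m * \<phi> m)"

lemma lin_superset:
  "finite S \<Longrightarrow> Poly_Mapping.keys f \<subseteq> S \<Longrightarrow> lin \<phi> f = (\<Sum>m\<in>S. Poly_Mapping.lookup f m * \<phi> m)"
  unfolding lin_def by (rule sum.mono_neutral_left) (auto simp: in_keys_iff)

lemma lin_zero [simp]: "lin \<phi> 0 = 0"
  by (simp add: lin_def)

lemma lin_add: "lin \<phi> (f + g) = lin \<phi> f + lin \<phi> g"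
proof -
  let ?S = "Poly_Mapping.keys f \<union> Poly_Mapping.keys g"
  have "lin \<phi> (f + g) = (\<Sum>m\<in>?S. Poly_Mapping.lookup (f + g) m * \<phi> m)"
    by (rule lin_superset) (use keys_add[of f g] in auto)
  also have "\<dots> = (\<Sum>m\<in>?S. Poly_Mapping.lookup f m * \<phi> m) + (\<Sum>m\<in>?S. Poly_Mapping.lookup g m * \<phi> m)"
    by (simp add: lookup_add distrib_right sum.distrib)
  finally show ?thesis using lin_superset[of ?S f \<phi>] lin_superset[of ?S g \<phi>] by simp
qed

lemma lin_single [simp]: "lin \<phi> (Poly_Mapping.single m a) = a * \<phi> m"
  by (simp add: lin_def)

lemma lin_one [simp]: "lin \<phi> 1 = \<phi> (0 :: 'm::zero)"
  by (simp add: lin_def)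

lemma lin_diff: "lin \<phi> (f - g) = lin \<phi> f - lin \<phi> g"
  using lin_add[of \<phi> "f - g" g] by simp

lemma lin_sum: "lin \<phi> (\<Sum>x\<in>A. f x) = (\<Sum>x\<in>A. lin \<phi> (f x))"
  by (induction A rule: infinite_finite_induct) (simp_all add: lin_add)

lemma lin_mult:
  fixes c f :: "('m::comm_monoid_add) \<Rightarrow>\<^sub>0 ('k::comm_ring_1)"
  shows "lin \<phi> (c * f) = (\<Sum>s\<in>Poly_Mapping.keys c. Poly_Mapping.lookup c s * lin (\<lambda>m. \<phi> (s + m)) f)"
proof -
  have eq: "c * f = (\<Sum>s\<in>Poly_Mapping.keys c. \<Sum>m\<in>Poly_Mapping.keys f.
      Poly_Mapping.single (s + m) (Poly_Mapping.lookup c s * Poly_Mapping.lookup f m))"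
    by (subst poly_mapping_sum_single[of c], subst poly_mapping_sum_single[of f])
      (simp add: sum_product mult_single)
  show ?thesis
    by (simp only: eq lin_sum lin_single) (simp only: lin_def sum_distrib_left mult.assoc)
qed

text \<open>Shifting \<open>\<phi>\<close> by \<open>s\<close> absorbs multiplication by a monomial,
  so it is enough to test monomial multiples of the generators.\<close>

lemma lin_ideal_zero:
  fixes f :: "('m::comm_monoid_add) \<Rightarrow>\<^sub>0 ('k::comm_ring_1)"
  assumes "\<And>g s. g \<in> T \<Longrightarrow> lin (\<lambda>m. \<phi> (s + m)) g = 0" and "f \<in> ideal_of T"
  shows "lin \<phi> f = 0"
proof -
  let ?Z = "{f. \<forall>s. lin (\<lambda>m. \<phi> (s + m)) f = 0}"
  have "module.subspace (*) ?Z"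
  proof (rule ring_module.subspaceI)
    show "c * x \<in> ?Z" if "x \<in> ?Z" for c x
    proof -
      have "lin (\<lambda>m. \<phi> (s + (t + m))) x = 0" for s t
        using that by (simp add: add.assoc[symmetric])
      then show ?thesis by (simp add: lin_mult)
    qed
  qed (simp_all add: lin_add)
  then have "ideal_of T \<subseteq> ?Z" using assms(1) by (intro ring_module.span_minimal) auto
  then have "lin (\<lambda>m. \<phi> (0 + m)) f = 0" using assms(2) by blast
  then show ?thesis by simp
qed

section \<open>The toric ideal\<close>

lemma edge_vec_Edge: "i \<noteq> j \<Longrightarrow> edge_vec (Edge (i, j)) = vertex_vec i - vertex_vec j"
  by (simp add: edge_vec_def)

text \<open>The exponent of the image of a monomial under the toric parametrisation that sends
  \<open>x_var e\<close> to the quotient of the torus coordinates at the source and the target of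
  \<open>e\<close>, with coordinate 1 at \<open>None\<close>.\<close>

definition mono_image :: "'n::finite monomial \<Rightarrow> real ^ 'n" where
  "mono_image m = (\<Sum>e\<in>UNIV. real (Poly_Mapping.lookup m e) *\<^sub>R edge_vec e)"

lemma mono_image_zero [simp]: "mono_image 0 = 0"
  by (simp add: mono_image_def)

lemma mono_image_add [simp]: "mono_image (m + m') = mono_image m + mono_image m'"
  by (simp add: mono_image_def lookup_add scaleR_add_left sum.distrib)

lemma mono_image_single [simp]: "mono_image (Poly_Mapping.single e k) = real k *\<^sub>R edge_vec e"
proof -
  have "mono_image (Poly_Mapping.single e k) = (\<Sum>f\<in>UNIV. if f = e then real k *\<^sub>R edge_vec e else 0)"
    unfolding mono_image_def by (intro sum.cong) (auto simp: lookup_single)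
  then show ?thesis by simp
qed

lemma mono_image_sum: "mono_image (\<Sum>x\<in>A. f x) = (\<Sum>x\<in>A. mono_image (f x))"
  by (induction A rule: infinite_finite_induct) simp_all

lemma x_var_mult: "x_var e * x_var f = (Poly_Mapping.single (Poly_Mapping.single e 1 + Poly_Mapping.single f 1) 1
   :: 'n::finite ring)"
  by (simp add: x_var_def mult_single)

text \<open>Each generator is a difference of two monomials with the same image, and this persists
  under monomial multiples.\<close>

lemma I_ideal_fibre_sum:
  fixes f :: "'n::finite ring"
  assumes "f \<in> I_ideal"
  shows "lin (\<lambda>m. of_bool (mono_image m = w)) f = 0"
  using _ assms unfolding I_ideal_def
proof (rule lin_ideal_zero)
  fix g :: "'n ring" and s
  assume "g \<in> {x_var (Edge (i, j)) * x_var (Edge (j, i)) - 1 | i j. i \<noteq> j} \<union>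
      {x_var (Edge (i, j)) * x_var (Edge (j, k)) - x_var (Edge (i, k)) | i j k. i \<noteq> j \<and> j \<noteq> k \<and> i \<noteq> k}"
  then consider i j where "i \<noteq> j" "g = x_var (Edge (i, j)) * x_var (Edge (j, i)) - 1"
    | i j k where "i \<noteq> j" "j \<noteq> k" "i \<noteq> k" "g = x_var (Edge (i, j)) * x_var (Edge (j, k)) - x_var (Edge (i, k))"
    by auto
  then show "lin (\<lambda>m. of_bool (mono_image (s + m) = w)) g = 0"
  proof cases
    case 1
    then show ?thesis unfolding x_var_mult by (simp add: lin_diff edge_vec_Edge)
  next
    case 2
    then show ?thesis unfolding x_var_mult by (simp add: lin_diff x_var_def edge_vec_Edge)
  qed
qed

text \<open>Flow conservation at the node \<open>tgt e\<close>: what enters along \<open>e\<close>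
  has to leave.\<close>

lemma flow_successor:
  fixes m :: "'n::finite monomial"
  assumes "mono_image m = 0" "e \<in> Poly_Mapping.keys m"
  obtains f where "f \<in> Poly_Mapping.keys m" "src f = tgt e"
proof -
  let ?t = "\<lambda>g. real (Poly_Mapping.lookup m g) * (of_bool (tgt g = tgt e) - of_bool (src g = tgt e))"
  have "\<exists>f\<in>Poly_Mapping.keys m. src f = tgt e"
  proof (rule ccontr)
    assume none: "\<not> ?thesis"
    have "mono_image m \<bullet> node_vec (tgt e) = 0" using assms(1) by simp
    then have "(\<Sum>g\<in>UNIV. ?t g) = 0"
      by (simp add: mono_image_def inner_sum_left edge_vec_inner_node_vec right_diff_distrib sum_subtractf)
    moreover have "?t g \<ge> 0" for g
      using none by (cases "src g = tgt e") (auto simp: not_in_keys_iff_lookup_eq_zero)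
    ultimately have "\<forall>g\<in>UNIV. ?t g = 0" using sum_nonneg_eq_0_iff[OF finite, of UNIV ?t] by blast
    then have "?t e = 0" by blast
    then show False using assms(2) by (simp add: in_keys_iff)
  qed
  then show ?thesis using that by blast
qed

lemma I_ideal_generators:
  "i \<noteq> j \<Longrightarrow> x_var (Edge (i, j)) * x_var (Edge (j, i)) - 1 \<in> (I_ideal :: 'n::finite ring set)"
  "i \<noteq> j \<Longrightarrow> j \<noteq> k \<Longrightarrow> i \<noteq> k \<Longrightarrow>
    x_var (Edge (i, j)) * x_var (Edge (j, k)) - x_var (Edge (i, k)) \<in> (I_ideal :: 'n::finite ring set)"
  unfolding I_ideal_def by (rule ring_module.span_base, blast)+

text \<open>A circulation is contracted along two consecutive edges at a time.\<close>

lemma circulation_in_I_ideal: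
  fixes m :: "'n::finite monomial"
  assumes "mono_image m = 0"
  shows "Poly_Mapping.single m 1 - 1 \<in> (I_ideal :: 'n ring set)"
  using assms
proof (induction "total_degree m" arbitrary: m rule: less_induct)
  case less
  let ?X = "\<lambda>m. Poly_Mapping.single m 1 :: 'n ring"
  have sub: "module.subspace (*) (I_ideal :: 'n ring set)"
    unfolding I_ideal_def by (rule ring_module.subspace_span)
  show ?case
  proof (cases "m = 0")
    case True
    then show ?thesis using ring_module.subspace_0[OF sub] by simp
  next
    case False
    then obtain e where e: "e \<in> Poly_Mapping.keys m" by (metis ex_in_conv keys_eq_empty)
    obtain f where f: "f \<in> Poly_Mapping.keys m" "src f = tgt e" using flow_successor[OF less.prems e] .
    obtain m1 where m1: "m = m1 + Poly_Mapping.single e 1" using monomial_split[OF e] .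
    have "f \<noteq> e" using f(2) src_neq_tgt(1)[of e] by metis
    then have "f \<in> Poly_Mapping.keys m1"
      using f(1) m1 by (simp add: in_keys_iff lookup_add lookup_single)
    then obtain m2 where m2: "m1 = m2 + Poly_Mapping.single f 1" by (rule monomial_split)
    have m: "m = m2 + (Poly_Mapping.single e 1 + Poly_Mapping.single f 1)"
      by (simp add: m1 m2 ac_simps)
    have uu: "edge_vec e + edge_vec f = vertex_vec (src e) - vertex_vec (tgt f)"
      using f(2) by (simp add: edge_vec_def)
    \<comment> \<open>Here \<open>t\<close> is the contraction of the two edges: a single edge, or
      the empty monomial if they cancel. Its degree is below 2, so the induction hypothesis applies
      to \<open>m2 + t\<close>.\<close>
    have step: "?X m - 1 \<in> I_ideal"
      if g: "x_var e * x_var f - ?X t \<in> I_ideal" and t: "mono_image t = edge_vec e + edge_vec f" "total_degree t < 2" for t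
    proof -
      have "?X m2 * (x_var e * x_var f - ?X t) = ?X m - ?X (m2 + t)"
        by (simp add: x_var_mult right_diff_distrib mult_single m)
      then have "?X m - ?X (m2 + t) \<in> I_ideal" using ring_module.subspace_scale[OF sub g] by metis
      moreover have "?X (m2 + t) - 1 \<in> I_ideal"
        using less.prems t by (intro less.hyps) (simp_all add: m)
      ultimately have "(?X m - ?X (m2 + t)) + (?X (m2 + t) - 1) \<in> I_ideal"
        by (rule ring_module.subspace_add[OF sub])
      then show ?thesis by simp
    qed
    show ?thesis
    proof (cases "tgt f = src e")
      case True
      have "Edge (src e, tgt e) = e" "Edge (tgt e, src e) = f" using f(2) True by (auto simp: edge_eqI)
      then have "x_var e * x_var f - ?X 0 \<in> I_ideal"
        using I_ideal_generators(1)[OF src_neq_tgt(1)[of e]] by (simp add: single_one)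
      then show ?thesis by (rule step) (use uu True in auto)
    next
      case False
      have "Edge (src e, tgt e) = e" "Edge (tgt e, tgt f) = f"
        by (rule Edge_src_tgt) (metis Edge_src_tgt f(2))
      moreover have "tgt e \<noteq> tgt f" using f(2) src_neq_tgt(1)[of f] by metis
      ultimately have "x_var e * x_var f - ?X (Poly_Mapping.single (Edge (src e, tgt f)) 1) \<in> I_ideal"
        using I_ideal_generators(2)[OF src_neq_tgt(1)[of e], of "tgt f"] False by (simp add: x_var_def)
      then show ?thesis by (rule step) (use uu False in \<open>auto simp: edge_vec_Edge\<close>)
    qed
  qed
qed

lemma binomial_in_I_ideal:
  fixes m m' :: "'n::finite monomial"
  assumes "mono_image m = mono_image m'"
  shows "Poly_Mapping.single m 1 - Poly_Mapping.single m' 1 \<in> (I_ideal :: 'n ring set)"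
proof -
  let ?X = "\<lambda>m. Poly_Mapping.single m 1 :: 'n ring"
  have sub: "module.subspace (*) (I_ideal :: 'n ring set)"
    unfolding I_ideal_def by (rule ring_module.subspace_span)
  \<comment> \<open>The reversed edges of \<open>m'\<close> invert it modulo the ideal: both
    \<open>m + r\<close> and \<open>m' + r\<close> are circulations, and cross multiplication leaves
    the difference of \<open>m\<close> and \<open>m'\<close>.\<close>
  define r where "r = (\<Sum>e\<in>UNIV. Poly_Mapping.single (rev_edge e) (Poly_Mapping.lookup m' e))"
  have r: "mono_image r = - mono_image m'"
    by (simp add: r_def mono_image_sum mono_image_def[of m'] sum_negf)
  have "?X (m + r) - 1 \<in> I_ideal" "?X (m' + r) - 1 \<in> I_ideal"
    using assms r by (auto intro!: circulation_in_I_ideal)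
  from ring_module.subspace_scale[OF sub this(1), of "?X m'"] ring_module.subspace_scale[OF sub this(2), of "?X m"]
  have "?X m' * (?X (m + r) - 1) - ?X m * (?X (m' + r) - 1) \<in> I_ideal"
    by (rule ring_module.subspace_diff[OF sub])
  moreover have "?X m' * (?X (m + r) - 1) - ?X m * (?X (m' + r) - 1) = ?X m - ?X m'"
    by (simp add: right_diff_distrib mult_single ac_simps)
  ultimately show ?thesis by simp
qed

section \<open>The initial ideal\<close>

definition is_face :: "real ^ 'n::finite edge \<Rightarrow> 'n monomial \<Rightarrow> bool" where
  "is_face c m \<longleftrightarrow> (\<exists>B\<in>vertex_bases c. Poly_Mapping.keys m \<subseteq> B)"

lemma keys_add_monomial: "Poly_Mapping.keys (m + m') = Poly_Mapping.keys m \<union> Poly_Mapping.keys m'"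
  for m m' :: "'e \<Rightarrow>\<^sub>0 nat"
  by (auto simp: in_keys_iff lookup_add)

lemma weight_diff:
  "weight c m - mono_image m \<bullet> v = (\<Sum>e\<in>UNIV. real (Poly_Mapping.lookup m e) * (c $ e - edge_vec e \<bullet> v))"
  by (simp add: weight_def mono_image_def inner_sum_left right_diff_distrib sum_subtractf mult.commute)

text \<open>The excess of the weight is a sum of slacks at \<open>v\<close>, with the exponents as
  nonnegative coefficients.\<close>

lemma weight_ge:
  assumes v: "v \<in> polytrope c"
  shows "mono_image m \<bullet> v \<le> weight c m"
    and "mono_image m \<bullet> v = weight c m \<longleftrightarrow> Poly_Mapping.keys m \<subseteq> incident_facets c v"
proof -
  let ?t = "\<lambda>e. real (Poly_Mapping.lookup m e) * (c $ e - edge_vec e \<bullet> v)"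
  have nn: "?t e \<ge> 0" for e using v by (simp add: mem_polytrope)
  then have "(\<Sum>e\<in>UNIV. ?t e) \<ge> 0" by (simp add: sum_nonneg)
  then show "mono_image m \<bullet> v \<le> weight c m" using weight_diff[of c m v] by simp
  have "mono_image m \<bullet> v = weight c m \<longleftrightarrow> (\<Sum>e\<in>UNIV. ?t e) = 0"
    using weight_diff[of c m v] by auto
  also have "\<dots> \<longleftrightarrow> (\<forall>e. ?t e = 0)" using nn by (simp add: sum_nonneg_eq_0_iff)
  also have "\<dots> \<longleftrightarrow> Poly_Mapping.keys m \<subseteq> incident_facets c v"
    using v by (auto simp: mem_incident_facets in_keys_iff)
  finally show "mono_image m \<bullet> v = weight c m \<longleftrightarrow> Poly_Mapping.keys m \<subseteq> incident_facets c v" .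
qed

lemma face_monomial_coeff:
  assumes "edge_basis B" "Poly_Mapping.keys m \<subseteq> B" "e \<in> B"
  shows "mono_image m \<bullet> dual_vec B e = real (Poly_Mapping.lookup m e)"
proof -
  have "mono_image m \<bullet> dual_vec B e = (\<Sum>f\<in>UNIV. if f = e then real (Poly_Mapping.lookup m e) else 0)"
    unfolding mono_image_def inner_sum_left
  proof (rule sum.cong[OF refl])
    fix f
    show "real (Poly_Mapping.lookup m f) *\<^sub>R edge_vec f \<bullet> dual_vec B e
      = (if f = e then real (Poly_Mapping.lookup m e) else 0)"
    proof (cases "f \<in> B")
      case True
      then show ?thesis using inner_dual_vec[OF assms(1,3) True] by simp
    next
      case False
      then have "Poly_Mapping.lookup m f = 0" using assms(2) by (metis in_keys_iff subsetD)
      then show ?thesis using False assms(3) by auto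
    qed
  qed
  then show ?thesis by simp
qed

text \<open>
  The minimal weight in a fibre is the value of the support function of the polytrope: a
  monomial attains it if and only if its support consists of facets through a common vertex.
\<close>

lemma face_minimal_unique:
  fixes c :: "real ^ 'n::finite edge"
  assumes simp: "simple_polytrope c" and face: "is_face c m"
    and eq: "mono_image m' = mono_image m" and le: "weight c m' \<le> weight c m"
  shows "m' = m"
proof -
  obtain v where v: "v extreme_point_of polytrope c" "Poly_Mapping.keys m \<subseteq> incident_facets c v"
    using face by (auto simp: is_face_def vertex_bases_def)
  let ?B = "incident_facets c v"
  have vP: "v \<in> polytrope c" using v by (simp add: extreme_point_iff_span)
  have bas: "edge_basis ?B" using simp v by (simp add: simple_polytrope_def)
  have "weight c m = mono_image m \<bullet> v" using weight_ge(2)[OF vP, of m] v(2) by simp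
  then have "mono_image m' \<bullet> v = weight c m'"
    using weight_ge(1)[OF vP, of m'] le eq by simp
  then have sub: "Poly_Mapping.keys m' \<subseteq> ?B" using weight_ge(2)[OF vP] by blast
  show ?thesis
  proof (rule poly_mapping_eqI)
    fix e
    show "Poly_Mapping.lookup m' e = Poly_Mapping.lookup m e"
    proof (cases "e \<in> ?B")
      case True
      then show ?thesis
        using face_monomial_coeff[OF bas sub True] face_monomial_coeff[OF bas v(2) True] eq by simp
    next
      case False
      then have "e \<notin> Poly_Mapping.keys m" "e \<notin> Poly_Mapping.keys m'" using sub v(2) by blast+
      then show ?thesis by (simp add: not_in_keys_iff_lookup_eq_zero)
    qed
  qed
qed

text \<open>The image of \<open>m\<close> lies in the normal cone of some vertex. Its coordinates
  there are nonnegative integers by unimodularity and serve as exponents of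
  \<open>m'\<close>.\<close>

lemma face_in_fibre:
  fixes c :: "real ^ 'n::finite edge"
  assumes simp: "simple_polytrope c" and ne: "vertex_bases c \<noteq> {}"
  obtains m' where "is_face c m'" "mono_image m' = mono_image m" "weight c m' \<le> weight c m"
    "\<not> is_face c m \<Longrightarrow> weight c m' < weight c m"
proof -
  obtain v where v: "v extreme_point_of polytrope c"
    and nn: "\<And>e. e \<in> incident_facets c v \<Longrightarrow> mono_image m \<bullet> dual_vec (incident_facets c v) e \<ge> 0"
    using exists_maximal_basis[OF simp ne, of "mono_image m"] by blast
  let ?B = "incident_facets c v"
  have vP: "v \<in> polytrope c" using v by (simp add: extreme_point_iff_span)
  have bas: "edge_basis ?B" using simp v by (simp add: simple_polytrope_def)
  have B: "?B \<in> vertex_bases c" using v by (auto simp: vertex_bases_def)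
  define m' where "m' = (\<Sum>e\<in>?B. Poly_Mapping.single e (nat \<lfloor>mono_image m \<bullet> dual_vec ?B e\<rfloor>))"
  have int: "mono_image m \<bullet> dual_vec ?B e \<in> \<int>" if "e \<in> ?B" for e
    unfolding mono_image_def inner_sum_left
    using edge_vec_inner_dual_Ints[OF bas that] by (intro Ints_sum) simp
  have "mono_image m' = (\<Sum>e\<in>?B. (mono_image m \<bullet> dual_vec ?B e) *\<^sub>R edge_vec e)"
    unfolding m'_def mono_image_sum
  proof (rule sum.cong[OF refl])
    fix e assume e: "e \<in> ?B"
    have "real (nat \<lfloor>mono_image m \<bullet> dual_vec ?B e\<rfloor>) = mono_image m \<bullet> dual_vec ?B e"
      using int[OF e] nn[OF e] by (auto simp: Ints_def)
    then show "mono_image (Poly_Mapping.single e (nat \<lfloor>mono_image m \<bullet> dual_vec ?B e\<rfloor>)) =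
      (mono_image m \<bullet> dual_vec ?B e) *\<^sub>R edge_vec e" by simp
  qed
  then have img: "mono_image m' = mono_image m" using edge_vec_expand[OF bas] by simp
  have keys: "Poly_Mapping.keys m' \<subseteq> ?B"
    unfolding m'_def by (rule order.trans[OF keys_sum]) (auto split: if_splits)
  have w: "weight c m' = mono_image m \<bullet> v" using weight_ge(2)[OF vP, of m'] keys img by simp
  show ?thesis
  proof (rule that[of m'])
    show "is_face c m'" using keys B by (auto simp: is_face_def)
    show "weight c m' \<le> weight c m" using weight_ge(1)[OF vP, of m] w by simp
    assume "\<not> is_face c m"
    then have "\<not> Poly_Mapping.keys m \<subseteq> ?B" using B by (auto simp: is_face_def)
    then show "weight c m' < weight c m"
      using weight_ge[OF vP, of m] w by simp
  qed (rule img)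
qed

lemma lookup_initial_form:
  "Poly_Mapping.lookup (initial_form c f) m =
    (if m \<in> Poly_Mapping.keys f \<and> (\<forall>m'\<in>Poly_Mapping.keys f. weight c m' \<le> weight c m)
     then Poly_Mapping.lookup f m else 0)"
proof -
  let ?S = "{m \<in> Poly_Mapping.keys f. \<forall>m'\<in>Poly_Mapping.keys f. weight c m' \<le> weight c m}"
  have "Poly_Mapping.lookup (initial_form c f) m = (\<Sum>m'\<in>?S. if m' = m then Poly_Mapping.lookup f m else 0)"
    unfolding initial_form_def lookup_sum by (intro sum.cong) (auto simp: lookup_single)
  also have "\<dots> = (if m \<in> ?S then Poly_Mapping.lookup f m else 0)" by (subst sum.delta) auto
  finally show ?thesis by simp
qed

text \<open>A face monomial is the unique lightest one in its fibre. If it were heaviest in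
  \<open>f\<close>, it would be the only term of \<open>f\<close> in this fibre, but coefficients
  along a fibre sum to 0.\<close>

lemma initial_form_nonface:
  fixes c :: "real ^ 'n::finite edge" and f :: "'n ring"
  assumes simp: "simple_polytrope c" and f: "f \<in> I_ideal"
    and m: "m \<in> Poly_Mapping.keys (initial_form c f)"
  shows "\<not> is_face c m"
proof
  assume face: "is_face c m"
  have mk: "m \<in> Poly_Mapping.keys f" "\<And>m'. m' \<in> Poly_Mapping.keys f \<Longrightarrow> weight c m' \<le> weight c m"
    using m by (auto simp: in_keys_iff[of m "initial_form c f"] lookup_initial_form split: if_splits)
  have "0 = lin (\<lambda>m'. of_bool (mono_image m' = mono_image m)) f"
    using I_ideal_fibre_sum[OF f] by simp
  also have "\<dots> = (\<Sum>m'\<in>Poly_Mapping.keys f. if m' = m then Poly_Mapping.lookup f m else 0)"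
    unfolding lin_def
    by (rule sum.cong[OF refl]) (use face_minimal_unique[OF simp face] mk(2) in auto)
  also have "\<dots> = Poly_Mapping.lookup f m" using mk(1) by simp
  finally show False using mk(1) by (simp add: in_keys_iff)
qed

text \<open>A monomial that is not a face is heavier than the face monomial in its fibre, so it is
  the initial form of their difference, which lies in \<open>I_ideal\<close>.\<close>

lemma M_ideal_iff:
  fixes c :: "real ^ 'n::finite edge" and f :: "'n ring"
  assumes simp: "simple_polytrope c" and ne: "vertex_bases c \<noteq> {}"
  shows "f \<in> M_ideal c \<longleftrightarrow> (\<forall>m\<in>Poly_Mapping.keys f. \<not> is_face c m)"
proof
  let ?T = "{f :: 'n ring. \<forall>m\<in>Poly_Mapping.keys f. \<not> is_face c m}"
  have "module.subspace (*) ?T"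
    by (rule subspace_keys) (auto simp: is_face_def keys_add_monomial)
  then have "M_ideal c \<subseteq> ?T"
    unfolding M_ideal_def using initial_form_nonface[OF simp] by (intro ring_module.span_minimal) auto
  then show "f \<in> M_ideal c \<Longrightarrow> \<forall>m\<in>Poly_Mapping.keys f. \<not> is_face c m" by blast
next
  assume nf: "\<forall>m\<in>Poly_Mapping.keys f. \<not> is_face c m"
  have sub: "module.subspace (*) (M_ideal c)"
    unfolding M_ideal_def by (rule ring_module.subspace_span)
  have mono: "Poly_Mapping.single m 1 \<in> M_ideal c" if m: "\<not> is_face c m" for m
  proof -
    obtain m' where m': "is_face c m'" "mono_image m' = mono_image m" "weight c m' < weight c m"
      using face_in_fibre[OF simp ne, of m] m by metis
    let ?b = "Poly_Mapping.single m 1 - Poly_Mapping.single m' 1 :: 'n ring"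
    have "m \<noteq> m'" using m'(1) m by blast
    then have keys: "Poly_Mapping.keys ?b = {m, m'}"
      by (auto simp: in_keys_iff lookup_minus lookup_single when_def split: if_splits)
    have "initial_form c ?b = Poly_Mapping.single m 1"
      using m'(3) \<open>m \<noteq> m'\<close>
      by (intro poly_mapping_eqI) (auto simp: lookup_initial_form keys lookup_minus lookup_single when_def)
    moreover have "?b \<in> I_ideal" using m'(2) by (intro binomial_in_I_ideal) simp
    ultimately show ?thesis
      unfolding M_ideal_def by (metis imageI ring_module.span_base)
  qed
  have "f = (\<Sum>m\<in>Poly_Mapping.keys f. Poly_Mapping.single 0 (Poly_Mapping.lookup f m) * Poly_Mapping.single m 1)"
    by (subst poly_mapping_sum_single) (simp add: mult_single)
  also have "\<dots> \<in> M_ideal c"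
    by (intro ring_module.subspace_sum[OF sub] ring_module.subspace_scale[OF sub] mono) (use nf in blast)
  finally show "f \<in> M_ideal c" .
qed

lemma prod_x_var: "(\<Prod>e\<in>B. x_var e) = (Poly_Mapping.single (basis_mono B) 1 :: 'n::finite ring)"
proof -
  have "(\<Prod>e\<in>B. x_var e) = (Poly_Mapping.single (\<Sum>e\<in>B. Poly_Mapping.single e 1) 1 :: 'n ring)" if "finite B"
    using that by induction (simp_all add: x_var_def mult_single single_one)
  then show ?thesis by (simp add: basis_mono_def)
qed

lemma variable_ideal_iff:
  fixes f :: "'n::finite ring"
  shows "f \<in> ideal_of (x_var ` (- B)) \<longleftrightarrow> (\<forall>m\<in>Poly_Mapping.keys f. \<not> Poly_Mapping.keys m \<subseteq> B)"
proof
  let ?T = "{f :: 'n ring. \<forall>m\<in>Poly_Mapping.keys f. \<not> Poly_Mapping.keys m \<subseteq> B}"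
  have "module.subspace (*) ?T"
    by (rule subspace_keys) (auto simp: keys_add_monomial)
  then have "ideal_of (x_var ` (- B)) \<subseteq> ?T"
    by (intro ring_module.span_minimal) (auto simp: x_var_def)
  then show "f \<in> ideal_of (x_var ` (- B)) \<Longrightarrow> \<forall>m\<in>Poly_Mapping.keys f. \<not> Poly_Mapping.keys m \<subseteq> B" by blast
next
  assume nf: "\<forall>m\<in>Poly_Mapping.keys f. \<not> Poly_Mapping.keys m \<subseteq> B"
  have sub: "module.subspace (*) (ideal_of (x_var ` (- B)) :: 'n ring set)"
    by (rule ring_module.subspace_span)
  have mono: "Poly_Mapping.single m a \<in> (ideal_of (x_var ` (- B)) :: 'n ring set)" if m: "\<not> Poly_Mapping.keys m \<subseteq> B" for m a
  proof -
    obtain e where e: "e \<in> Poly_Mapping.keys m" "e \<notin> B" using m by blast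
    obtain m' where m': "m = m' + Poly_Mapping.single e 1" using monomial_split[OF e(1)] .
    have "Poly_Mapping.single m' a * x_var e \<in> (ideal_of (x_var ` (- B)) :: 'n ring set)"
      using e(2) by (intro ring_module.span_scale ring_module.span_base) blast
    then show ?thesis by (simp add: x_var_def mult_single m')
  qed
  have "(\<Sum>m\<in>Poly_Mapping.keys f. Poly_Mapping.single m (Poly_Mapping.lookup f m)) \<in> ideal_of (x_var ` (- B))"
    by (intro ring_module.subspace_sum[OF sub] mono) (use nf in blast)
  then show "f \<in> ideal_of (x_var ` (- B))" by (simp flip: poly_mapping_sum_single)
qed

lemma minimal_prime_vertex:
  fixes c :: "real ^ 'n::finite edge"
  assumes simp: "simple_polytrope c" and B: "B \<in> vertex_bases c"
  shows "minimal_prime_of (M_ideal c) (ideal_of (x_var ` (- B)) :: 'n ring set)"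
proof -
  let ?Q = "ideal_of (x_var ` (- B)) :: 'n ring set"
  have ne: "vertex_bases c \<noteq> {}" using B by blast
  have subQ: "module.subspace (*) ?Q" by (rule ring_module.subspace_span)
  \<comment> \<open>Setting the variables outside \<open>B\<close> to zero. This is reduction modulo
    \<open>?Q\<close> to the polynomials in the remaining variables, which form an integral
    domain.\<close>
  define res where "res f = (\<Sum>m\<in>{m \<in> Poly_Mapping.keys f. Poly_Mapping.keys m \<subseteq> B}. Poly_Mapping.single m (Poly_Mapping.lookup f m))" for f :: "'n ring"
  have lres: "Poly_Mapping.lookup (res f) m = (if Poly_Mapping.keys m \<subseteq> B then Poly_Mapping.lookup f m else 0)" for f m
  proof -
    have "Poly_Mapping.lookup (res f) m = (\<Sum>m'\<in>{m \<in> Poly_Mapping.keys f. Poly_Mapping.keys m \<subseteq> B}. if m' = m then Poly_Mapping.lookup f m else 0)"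
      unfolding res_def lookup_sum by (intro sum.cong) (auto simp: lookup_single)
    also have "\<dots> = (if Poly_Mapping.keys m \<subseteq> B then Poly_Mapping.lookup f m else 0)"
      by (subst sum.delta) (auto simp: not_in_keys_iff_lookup_eq_zero)
    finally show ?thesis .
  qed
  have diff: "f - res f \<in> ?Q" for f
    unfolding variable_ideal_iff by (auto simp: in_keys_iff lookup_minus lres split: if_splits)
  have kres: "Poly_Mapping.keys m \<subseteq> B" if "m \<in> Poly_Mapping.keys (res f)" for f m
    using that by (auto simp: in_keys_iff[of m "res f"] lres split: if_splits)
  have res0: "res f = 0" if "f \<in> ?Q" for f
    using that unfolding variable_ideal_iff
    by (intro poly_mapping_eqI) (auto simp: lres not_in_keys_iff_lookup_eq_zero)
  have "prime_ideal ?Q"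
    unfolding prime_ideal_def
  proof (intro conjI allI impI)
    show "1 \<notin> ?Q" unfolding variable_ideal_iff by simp
    fix f g assume fg: "f * g \<in> ?Q"
    have "res f * res g - f * g = - ((f - res f) * g) - (res f * (g - res g))"
      by (simp add: algebra_simps)
    moreover have "\<dots> \<in> ?Q"
      using ring_module.subspace_scale[OF subQ diff[of f], of g] ring_module.subspace_scale[OF subQ diff[of g], of "res f"]
      by (intro ring_module.subspace_diff[OF subQ] ring_module.subspace_neg[OF subQ]) (simp_all add: mult.commute)
    ultimately have "(res f * res g - f * g) + f * g \<in> ?Q"
      using fg by (metis ring_module.subspace_add[OF subQ])
    then have pr: "res f * res g \<in> ?Q" by simp
    have "Poly_Mapping.keys (res f * res g) = {}"
    proof (rule ccontr)
      assume "Poly_Mapping.keys (res f * res g) \<noteq> {}"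
      then obtain m where m: "m \<in> Poly_Mapping.keys (res f * res g)" by blast
      then obtain a b where "m = a + b" "a \<in> Poly_Mapping.keys (res f)" "b \<in> Poly_Mapping.keys (res g)"
        using keys_mult by blast
      then have "Poly_Mapping.keys m \<subseteq> B" using kres by (auto simp: keys_add_monomial)
      then show False using pr m unfolding variable_ideal_iff by blast
    qed
    then have "res f = 0 \<or> res g = 0" by simp
    then show "f \<in> ?Q \<or> g \<in> ?Q" using diff[of f] diff[of g] by auto
  qed (rule subQ)
  moreover have "M_ideal c \<subseteq> ?Q"
  proof
    fix f assume "f \<in> M_ideal c"
    then show "f \<in> ?Q" using B unfolding M_ideal_iff[OF simp ne] variable_ideal_iff is_face_def by blast
  qed
  moreover have "Q' = ?Q" if Q': "prime_ideal Q'" "M_ideal c \<subseteq> Q'" "Q' \<subseteq> ?Q" for Q'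
  proof -
    \<comment> \<open>Adding \<open>e\<close> to the vertex monomial leaves the complex, so the
      product lies in \<open>M\<close>; the vertex monomial itself is not even in
      \<open>?Q\<close>.\<close>
    have "x_var e \<in> Q'" if e: "e \<notin> B" for e
    proof -
      have "\<not> is_face c (Poly_Mapping.single e 1 + basis_mono B)"
      proof
        assume "is_face c (Poly_Mapping.single e 1 + basis_mono B)"
        then obtain B' where B': "B' \<in> vertex_bases c" "insert e B \<subseteq> B'"
          by (auto simp: is_face_def keys_add_monomial)
        then have "card (insert e B) \<le> card B'" by (intro card_mono) auto
        then show False
          using e vertex_bases_basis[OF simp B] vertex_bases_basis[OF simp B'(1)] by (simp add: edge_basis_def)
      qed
      then have "x_var e * Poly_Mapping.single (basis_mono B) 1 \<in> Q'"
        using Q'(2) by (auto simp: M_ideal_iff[OF simp ne] x_var_def mult_single)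
      moreover have "Poly_Mapping.single (basis_mono B) 1 \<notin> Q'"
      proof
        assume "Poly_Mapping.single (basis_mono B) 1 \<in> Q'"
        then have "Poly_Mapping.single (basis_mono B) 1 \<in> ?Q" using Q'(3) by blast
        then show False unfolding variable_ideal_iff by simp
      qed
      ultimately show ?thesis using Q'(1) unfolding prime_ideal_def by blast
    qed
    then have "?Q \<subseteq> Q'" using Q'(1) by (intro ring_module.span_minimal) (auto simp: prime_ideal_def)
    then show ?thesis using Q'(3) by blast
  qed
  ultimately show ?thesis unfolding minimal_prime_of_def by blast
qed

section \<open>The quotient by the initial ideal and the linear relations\<close>

lemma subspace_M_ideal: "module.subspace (*) (M_ideal c)"
  unfolding M_ideal_def by (rule ring_module.subspace_span)

lemma subspace_L_ideal: "module.subspace (*) L_ideal"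
  unfolding L_ideal_def by (rule ring_module.subspace_span)

lemma subspace_set_plus:
  fixes S T :: "'a::comm_ring_1 set"
  assumes S: "module.subspace (*) S" and T: "module.subspace (*) T"
  shows "module.subspace (*) (S + T)"
proof (rule ring_module.subspaceI)
  show "0 \<in> S + T"
    using set_plus_intro[OF ring_module.subspace_0[OF S] ring_module.subspace_0[OF T]] by simp
  show "x + y \<in> S + T" if xy: "x \<in> S + T" "y \<in> S + T" for x y
  proof -
    obtain a b a' b' where ab: "x = a + b" "a \<in> S" "b \<in> T" "y = a' + b'" "a' \<in> S" "b' \<in> T"
      using xy by (auto elim!: set_plus_elim)
    have "(a + a') + (b + b') \<in> S + T"
      using ab ring_module.subspace_add[OF S] ring_module.subspace_add[OF T] by (intro set_plus_intro)
    then show ?thesis using ab by (simp add: ac_simps)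
  qed
  show "r * x \<in> S + T" if x: "x \<in> S + T" for r x
  proof -
    obtain a b where ab: "x = a + b" "a \<in> S" "b \<in> T" using x by (auto elim!: set_plus_elim)
    have "r * a + r * b \<in> S + T"
      using ab ring_module.subspace_scale[OF S] ring_module.subspace_scale[OF T] by (intro set_plus_intro)
    then show ?thesis using ab by (simp add: distrib_left)
  qed
qed

lemmas subspace_ML = subspace_set_plus[OF subspace_M_ideal subspace_L_ideal]

lemma M_subset_ML: "f \<in> M_ideal c \<Longrightarrow> f \<in> M_ideal c + L_ideal"
  using set_plus_intro[of f "M_ideal c" 0 L_ideal] ring_module.subspace_0[OF subspace_L_ideal] by simp

lemma L_subset_ML: "f \<in> L_ideal \<Longrightarrow> f \<in> M_ideal c + L_ideal"
  using set_plus_intro[of 0 "M_ideal c" f L_ideal] ring_module.subspace_0[OF subspace_M_ideal[of c]] by simp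

lemma single_sum: "Poly_Mapping.single m (\<Sum>x\<in>A. a x) = (\<Sum>x\<in>A. Poly_Mapping.single m (a x))"
  by (induction A rule: infinite_finite_induct) (simp_all add: single_add)

lemma of_int_mult_single:
  fixes a :: "'k::comm_ring_1"
  shows "of_int z * Poly_Mapping.single (m :: 'm::comm_monoid_add) a = Poly_Mapping.single m (of_int z * a)"
  by (simp add: mult_single flip: single_of_int)

text \<open>The form is the combination of the generators of \<open>L_ideal\<close> with the
  coordinates of \<open>d\<close> as coefficients. These pass from the reals to the weight field as
  integers, hence the floors, which are exact here.\<close>

lemma linear_form_in_L_ideal:
  fixes d :: "real ^ 'n::finite"
  assumes d: "\<And>i. coord d i \<in> \<int>"
  shows "(\<Sum>e\<in>UNIV. Poly_Mapping.single (s + Poly_Mapping.single e 1) (of_int \<lfloor>edge_vec e \<bullet> d\<rfloor>))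
    \<in> (L_ideal :: 'n ring set)"
proof -
  define g :: "'n option \<Rightarrow> 'n ring"
    where "g k = (\<Sum>e | src e = k. x_var e) - (\<Sum>e | tgt e = k. x_var e)" for k
  define b :: "'n option \<Rightarrow> 'n edge \<Rightarrow> int"
    where "b k e = of_bool (src e = k) - of_bool (tgt e = k)" for k e
  have g: "g k = (\<Sum>e\<in>UNIV. Poly_Mapping.single (Poly_Mapping.single e 1) (of_int (b k e)))" for k
  proof -
    have "g k = (\<Sum>e\<in>UNIV. if src e = k then x_var e else 0) - (\<Sum>e\<in>UNIV. if tgt e = k then x_var e else 0)"
      unfolding g_def by (simp add: sum.If_cases)
    also have "\<dots> = (\<Sum>e\<in>UNIV. Poly_Mapping.single (Poly_Mapping.single e 1) (of_int (b k e)))"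
      unfolding sum_subtractf[symmetric] by (intro sum.cong) (auto simp: b_def x_var_def single_diff single_uminus)
    finally show ?thesis .
  qed
  have fl: "(\<Sum>k\<in>UNIV. \<lfloor>coord d k\<rfloor> * b k e) = \<lfloor>edge_vec e \<bullet> d\<rfloor>" for e
  proof -
    have "(\<Sum>k\<in>UNIV. \<lfloor>coord d k\<rfloor> * b k e) = \<lfloor>coord d (src e)\<rfloor> - \<lfloor>coord d (tgt e)\<rfloor>"
    proof -
      have "(\<Sum>k\<in>UNIV. z k * of_bool (x = k)) = z x" for z :: "'n option \<Rightarrow> int" and x
      proof -
        have "(\<Sum>k\<in>UNIV. z k * of_bool (x = k)) = (\<Sum>k\<in>UNIV. if k = x then z x else 0)"
          by (rule sum.cong) auto
        then show ?thesis by simp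
      qed
      then show ?thesis by (simp only: b_def right_diff_distrib sum_subtractf)
    qed
    also have "\<dots> = \<lfloor>edge_vec e \<bullet> d\<rfloor>"
      using d[of "src e"] d[of "tgt e"] by (auto simp: inner_edge_vec Ints_def simp flip: of_int_diff)
    finally show ?thesis .
  qed
  have "Poly_Mapping.single s 1 * (\<Sum>k\<in>UNIV. of_int \<lfloor>coord d k\<rfloor> * g k) \<in> L_ideal"
    by (intro ring_module.subspace_scale[OF subspace_L_ideal] ring_module.subspace_sum[OF subspace_L_ideal])
      (auto simp: L_ideal_def g_def intro: ring_module.span_base)
  also have "(\<Sum>k\<in>UNIV. of_int \<lfloor>coord d k\<rfloor> * g k) =
     (\<Sum>e\<in>UNIV. \<Sum>k\<in>UNIV. Poly_Mapping.single (Poly_Mapping.single e 1) (of_int (\<lfloor>coord d k\<rfloor> * b k e)))"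
    unfolding g sum_distrib_left of_int_mult_single by (subst sum.swap) simp
  also have "\<dots> = (\<Sum>e\<in>UNIV. Poly_Mapping.single (Poly_Mapping.single e 1) (of_int \<lfloor>edge_vec e \<bullet> d\<rfloor>))"
    by (simp only: single_sum[symmetric] of_int_sum[symmetric] fl)
  finally show ?thesis by (simp add: sum_distrib_left mult_single)
qed

lemma basis_mono_insert:
  "e \<notin> A \<Longrightarrow> basis_mono (insert e A) = basis_mono A + Poly_Mapping.single e 1"
  by (rule poly_mapping_eqI) (auto simp: lookup_basis_mono lookup_add lookup_single when_def)

text \<open>Multiply the ridge monomial by the linear form dual to \<open>e\<close>. The edge
  \<open>e\<close> yields the monomial of \<open>B\<close> with coefficient 1, the edge
  \<open>f\<close> that of \<open>B'\<close> with coefficient -1; every other edge has coefficient 0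
  or leaves the complex and yields an element of \<open>M\<close>.\<close>

lemma ridge_relation:
  fixes c :: "real ^ 'n::finite edge"
  assumes simp: "simple_polytrope c" and B: "B \<in> vertex_bases c" and e: "e \<in> B"
    and B': "B' \<in> vertex_bases c" "B' \<noteq> B" "B - {e} \<subseteq> B'"
  shows "Poly_Mapping.single (basis_mono B) 1 - Poly_Mapping.single (basis_mono B') 1 \<in> M_ideal c + L_ideal"
proof -
  obtain f where f: "f \<notin> B" "insert f (B - {e}) \<in> vertex_bases c"
    "dual_vec (insert f (B - {e})) f = - dual_vec B e"
    "\<And>B'. B' \<in> vertex_bases c \<Longrightarrow> B - {e} \<subseteq> B' \<Longrightarrow> B' = B \<or> B' = insert f (B - {e})"
    using ridge_neighbour_basis[OF simp B e] by metis
  have B'eq: "B' = insert f (B - {e})" using f(4)[OF B'(1,3)] B'(2) by blast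
  have ne: "vertex_bases c \<noteq> {}" using B by blast
  have bas: "edge_basis B" "edge_basis B'" using vertex_bases_basis[OF simp] B B'(1) by auto
  define d where "d = dual_vec B e"
  define s where "s = basis_mono (B - {e})"
  define t :: "'n edge \<Rightarrow> 'n ring"
    where "t g = Poly_Mapping.single (s + Poly_Mapping.single g 1) (of_int \<lfloor>edge_vec g \<bullet> d\<rfloor>)" for g
  have S: "(\<Sum>g\<in>UNIV. t g) \<in> L_ideal"
    unfolding t_def d_def by (rule linear_form_in_L_ideal) (rule coord_dual_vec_Ints[OF bas(1) e])
  have te: "t e = Poly_Mapping.single (basis_mono B) 1"
  proof -
    have "s + Poly_Mapping.single e 1 = basis_mono B"
      using basis_mono_insert[of e "B - {e}"] e by (simp add: s_def insert_absorb)
    then show ?thesis using inner_dual_vec[OF bas(1) e e] by (simp add: t_def d_def)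
  qed
  have tf: "t f = - Poly_Mapping.single (basis_mono B') 1"
  proof -
    have "edge_vec f \<bullet> d = -1"
      using inner_dual_vec[OF bas(2), of f f] f(3) by (simp add: B'eq d_def)
    then have "\<lfloor>edge_vec f \<bullet> d\<rfloor> = -1" by (simp add: floor_eq_iff)
    then show ?thesis
      using basis_mono_insert[of f "B - {e}"] f(1) by (simp add: t_def s_def B'eq single_uminus)
  qed
  have rest: "t g \<in> M_ideal c" if g: "g \<noteq> e" "g \<noteq> f" for g
  proof (cases "g \<in> B")
    case True
    then have "edge_vec g \<bullet> d = 0" using inner_dual_vec[OF bas(1) e True] g by (simp add: d_def)
    then show ?thesis using ring_module.subspace_0[OF subspace_M_ideal] by (simp add: t_def)
  next
    case False
    have "\<not> is_face c (s + Poly_Mapping.single g 1)"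
    proof
      assume "is_face c (s + Poly_Mapping.single g 1)"
      then obtain B'' where "B'' \<in> vertex_bases c" "insert g (B - {e}) \<subseteq> B''"
        by (auto simp: is_face_def keys_add_monomial s_def)
      then show False using f(4)[of B''] False g by auto
    qed
    then show ?thesis unfolding M_ideal_iff[OF simp ne] by (simp add: t_def)
  qed
  have fe: "f \<noteq> e" using f(1) e by blast
  have "(\<Sum>g\<in>UNIV. t g) = t e + (t f + (\<Sum>g\<in>UNIV - {e} - {f}. t g))"
    using fe by (simp add: sum.remove[of UNIV e] sum.remove[of "UNIV - {e}" f])
  then have "Poly_Mapping.single (basis_mono B) 1 - Poly_Mapping.single (basis_mono B') 1 =
    (\<Sum>g\<in>UNIV. t g) - (\<Sum>g\<in>UNIV - {e} - {f}. t g)"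
    by (simp add: te tf)
  also have "\<dots> \<in> M_ideal c + L_ideal"
    by (intro ring_module.subspace_diff[OF subspace_ML] L_subset_ML[OF S] M_subset_ML
        ring_module.subspace_sum[OF subspace_M_ideal] rest) auto
  finally show ?thesis .
qed

text \<open>Walking along edges of the polytrope that increase a generic functional connects all vertices.\<close>

lemma vertex_monomials_congruent:
  fixes c :: "real ^ 'n::finite edge"
  assumes simp: "simple_polytrope c" and B: "B \<in> vertex_bases c" "B' \<in> vertex_bases c"
  shows "Poly_Mapping.single (basis_mono B) 1 - Poly_Mapping.single (basis_mono B') 1 \<in> M_ideal c + L_ideal"
proof -
  obtain \<xi> where gen: "generic c \<xi>" using exists_rational_generic[OF simp] by blast
  let ?X = "{v. v extreme_point_of polytrope c}"
  let ?m = "\<lambda>B. Poly_Mapping.single (basis_mono B) 1 :: 'n ring"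
  have reach: "\<exists>B0\<in>vertex_bases c. (\<forall>e\<in>B0. \<xi> \<bullet> dual_vec B0 e > 0) \<and>
      ?m (incident_facets c v) - ?m B0 \<in> M_ideal c + L_ideal" if "v \<in> ?X" for v
    using that
  \<comment> \<open>The number of vertices above \<open>v\<close> drops with every step of the
    walk.\<close>
  proof (induction "card {w \<in> ?X. \<xi> \<bullet> v < \<xi> \<bullet> w}" arbitrary: v rule: less_induct)
    case less
    let ?B = "incident_facets c v"
    have B: "?B \<in> vertex_bases c" using less.prems by (auto simp: vertex_bases_def)
    show ?case
    proof (cases "\<forall>e\<in>?B. \<xi> \<bullet> dual_vec ?B e > 0")
      case True
      then show ?thesis using B ring_module.subspace_0[OF subspace_ML] by (intro bexI[of _ ?B]) auto
    next
      case False
      then obtain e where e: "e \<in> ?B" "\<xi> \<bullet> dual_vec ?B e < 0"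
        using gen B by (force simp: generic_def)
      obtain s f where sf: "s > 0" "(v - s *\<^sub>R dual_vec ?B e) extreme_point_of polytrope c"
        "f \<notin> ?B" "incident_facets c (v - s *\<^sub>R dual_vec ?B e) = insert f (?B - {e})"
        using ridge_neighbour[OF simp _ e(1)] less.prems by (metis mem_Collect_eq)
      define w where "w = v - s *\<^sub>R dual_vec ?B e"
      have w: "w \<in> ?X" "incident_facets c w = insert f (?B - {e})" using sf by (auto simp: w_def)
      have "\<xi> \<bullet> w > \<xi> \<bullet> v" using sf(1) e(2) by (simp add: w_def inner_diff_right mult_pos_neg)
      then have "{x \<in> ?X. \<xi> \<bullet> w < \<xi> \<bullet> x} \<subset> {x \<in> ?X. \<xi> \<bullet> v < \<xi> \<bullet> x}" using w(1) by auto
      then have "card {x \<in> ?X. \<xi> \<bullet> w < \<xi> \<bullet> x} < card {x \<in> ?X. \<xi> \<bullet> v < \<xi> \<bullet> x}"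
        using finite_extreme_points[of c] by (intro psubset_card_mono) auto
      then obtain B0 where B0: "B0 \<in> vertex_bases c" "\<forall>e\<in>B0. \<xi> \<bullet> dual_vec B0 e > 0"
        "?m (incident_facets c w) - ?m B0 \<in> M_ideal c + L_ideal"
        using less.hyps w(1) by blast
      have "?m ?B - ?m (incident_facets c w) \<in> M_ideal c + L_ideal"
        by (rule ridge_relation[OF simp B e(1)]) (use w sf(3) in \<open>auto simp: vertex_bases_def\<close>)
      from ring_module.subspace_add[OF subspace_ML this B0(3)]
      show ?thesis using B0(1,2) by (intro bexI[of _ B0]) auto
    qed
  qed
  have "\<exists>B0\<in>vertex_bases c. (\<forall>e\<in>B0. \<xi> \<bullet> dual_vec B0 e > 0) \<and> ?m A - ?m B0 \<in> M_ideal c + L_ideal"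
    if "A \<in> vertex_bases c" for A
    using that reach by (auto simp: vertex_bases_def)
  then obtain B0 B0' where B0: "B0 \<in> vertex_bases c" "\<forall>e\<in>B0. \<xi> \<bullet> dual_vec B0 e > 0" "?m B - ?m B0 \<in> M_ideal c + L_ideal"
    and B0': "B0' \<in> vertex_bases c" "\<forall>e\<in>B0'. \<xi> \<bullet> dual_vec B0' e > 0" "?m B' - ?m B0' \<in> M_ideal c + L_ideal"
    using B by metis
  \<comment> \<open>Both walks stop at a vertex with all coordinates positive, and there is only
    one.\<close>
  have "B0 = B0'" using positive_basis_unique[OF simp B0(1) B0'(1), of \<xi>] B0(2) B0'(2) by blast
  then show ?thesis using ring_module.subspace_diff[OF subspace_ML B0(3) B0'(3)] by simp
qed

lemma card_keys_le_total_degree: "card (Poly_Mapping.keys m) \<le> total_degree m"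
proof -
  have "card (Poly_Mapping.keys m) = (\<Sum>e\<in>Poly_Mapping.keys m. 1)" by simp
  also have "\<dots> \<le> (\<Sum>e\<in>Poly_Mapping.keys m. Poly_Mapping.lookup m e)"
    by (intro sum_mono) (auto simp: in_keys_iff)
  also have "\<dots> \<le> total_degree m"
    unfolding total_degree_def by (intro sum_mono2) auto
  finally show ?thesis .
qed

text \<open>
  A repeated variable is eliminated by the linear form dual to it with respect to a vertex basis
  containing the support; all other monomials that arise have larger support or vanish.
\<close>

lemma top_degree_multiple:
  fixes c :: "real ^ 'n::finite edge"
  assumes simp: "simple_polytrope c" and B: "B \<in> vertex_bases c" and deg: "total_degree m = CARD('n)"
  shows "\<exists>a. Poly_Mapping.single m 1 - Poly_Mapping.single (basis_mono B) a \<in> M_ideal c + L_ideal"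
  using deg
proof (induction "CARD('n) - card (Poly_Mapping.keys m)" arbitrary: m rule: less_induct)
  case less
  let ?J = "M_ideal c + L_ideal"
  have ne: "vertex_bases c \<noteq> {}" using B by blast
  show ?case
  proof (cases "is_face c m")
    case False
    then have "Poly_Mapping.single m 1 \<in> M_ideal c" unfolding M_ideal_iff[OF simp ne] by simp
    then show ?thesis by (intro exI[of _ 0]) (simp add: M_subset_ML)
  next
    case True
    then obtain B1 where B1: "B1 \<in> vertex_bases c" "Poly_Mapping.keys m \<subseteq> B1" by (auto simp: is_face_def)
    have bas: "edge_basis B1" by (rule vertex_bases_basis[OF simp B1(1)])
    show ?thesis
    proof (cases "\<forall>e. Poly_Mapping.lookup m e \<le> 1")
      case True
      have mb: "m = basis_mono (Poly_Mapping.keys m)"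
      proof (rule poly_mapping_eqI)
        fix e show "Poly_Mapping.lookup m e = Poly_Mapping.lookup (basis_mono (Poly_Mapping.keys m)) e"
          using True[rule_format, of e] by (auto simp: lookup_basis_mono in_keys_iff)
      qed
      then have "total_degree m = card (Poly_Mapping.keys m)" by (metis total_degree_basis_mono)
      then have "card (Poly_Mapping.keys m) = card B1"
        using less.prems bas by (simp add: edge_basis_def)
      then have "Poly_Mapping.keys m = B1" using B1(2) by (intro card_subset_eq) auto
      then show ?thesis using vertex_monomials_congruent[OF simp B1(1) B] mb by (intro exI[of _ 1]) simp
    next
      case False
      then obtain e where "\<not> Poly_Mapping.lookup m e \<le> 1" by blast
      then have e: "Poly_Mapping.lookup m e \<ge> 2" by simp
      then have ek: "e \<in> Poly_Mapping.keys m" by (simp add: in_keys_iff)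
      then obtain m' where m': "m = m' + Poly_Mapping.single e 1" by (rule monomial_split)
      have eB: "e \<in> B1" using ek B1(2) by blast
      have "e \<in> Poly_Mapping.keys m'" using e m' by (simp add: in_keys_iff lookup_add)
      then have keys: "Poly_Mapping.keys m' = Poly_Mapping.keys m" by (auto simp: m' keys_add_monomial)
      have deg': "total_degree m' + 1 = CARD('n)" using less.prems m' by simp
      define t :: "'n edge \<Rightarrow> 'n ring" where
        "t g = Poly_Mapping.single (m' + Poly_Mapping.single g 1) (of_int \<lfloor>edge_vec g \<bullet> dual_vec B1 e\<rfloor>)" for g
      have S: "(\<Sum>g\<in>UNIV. t g) \<in> L_ideal"
        unfolding t_def by (rule linear_form_in_L_ideal) (rule coord_dual_vec_Ints[OF bas eB])
      have "\<exists>a. t g - Poly_Mapping.single (basis_mono B) a \<in> ?J" if g: "g \<noteq> e" for g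
      proof (cases "g \<in> B1")
        case True
        then have "t g = 0" using inner_dual_vec[OF bas eB True] g by (simp add: t_def)
        then show ?thesis using ring_module.subspace_0[OF subspace_ML] by (intro exI[of _ 0]) simp
      next
        case False
        let ?m = "m' + Poly_Mapping.single g 1"
        have "g \<notin> Poly_Mapping.keys m" using False B1(2) by blast
        then have "card (Poly_Mapping.keys ?m) = Suc (card (Poly_Mapping.keys m))"
          by (simp add: keys_add_monomial keys)
        \<comment> \<open>The support of \<open>m\<close> is that of \<open>m'\<close>, whose degree
          is one less. Hence the truncated subtraction in the induction measure really
          decreases.\<close>
        moreover have "card (Poly_Mapping.keys m) < CARD('n)"
          using card_keys_le_total_degree[of m'] keys deg' by simp
        ultimately have "CARD('n) - card (Poly_Mapping.keys ?m) < CARD('n) - card (Poly_Mapping.keys m)"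
          by simp
        moreover have "total_degree ?m = CARD('n)" using deg' by simp
        ultimately obtain a where "Poly_Mapping.single ?m 1 - Poly_Mapping.single (basis_mono B) a \<in> ?J"
          using less.hyps by blast
        from ring_module.subspace_scale[OF subspace_ML this, of "of_int \<lfloor>edge_vec g \<bullet> dual_vec B1 e\<rfloor>"]
        show ?thesis
          by (simp add: right_diff_distrib of_int_mult_single t_def) blast
      qed
      then obtain a where a: "\<And>g. g \<noteq> e \<Longrightarrow> t g - Poly_Mapping.single (basis_mono B) (a g) \<in> ?J" by metis
      have te: "t e = Poly_Mapping.single m 1"
        using inner_dual_vec[OF bas eB eB] by (simp add: t_def m')
      have "(\<Sum>g\<in>UNIV. t g) = t e + (\<Sum>g\<in>UNIV - {e}. t g)" by (simp add: sum.remove[of UNIV e])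
      then have "Poly_Mapping.single m 1 - Poly_Mapping.single (basis_mono B) (- (\<Sum>g\<in>UNIV - {e}. a g)) =
        (\<Sum>g\<in>UNIV. t g) - (\<Sum>g\<in>UNIV - {e}. t g - Poly_Mapping.single (basis_mono B) (a g))"
        by (simp add: te single_uminus single_sum sum_subtractf)
      also have "\<dots> \<in> ?J"
        by (intro ring_module.subspace_diff[OF subspace_ML] L_subset_ML[OF S]
            ring_module.subspace_sum[OF subspace_ML] a) auto
      finally show ?thesis by blast
    qed
  qed
qed

section \<open>Homogeneous parts\<close>

definition hom_part :: "nat \<Rightarrow> ('n::finite monomial \<Rightarrow>\<^sub>0 'k::comm_ring_1) \<Rightarrow> ('n monomial \<Rightarrow>\<^sub>0 'k)" where
  "hom_part d f = (\<Sum>m | m \<in> Poly_Mapping.keys f \<and> total_degree m = d. Poly_Mapping.single m (Poly_Mapping.lookup f m))"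

lemma lookup_hom_part:
  "Poly_Mapping.lookup (hom_part d f) m = (if total_degree m = d then Poly_Mapping.lookup f m else 0)"
proof -
  have "Poly_Mapping.lookup (hom_part d f) m =
    (\<Sum>m' | m' \<in> Poly_Mapping.keys f \<and> total_degree m' = d. if m' = m then Poly_Mapping.lookup f m else 0)"
    unfolding hom_part_def lookup_sum by (intro sum.cong) (auto simp: lookup_single)
  also have "\<dots> = (if total_degree m = d then Poly_Mapping.lookup f m else 0)"
    by (subst sum.delta) (auto simp: not_in_keys_iff_lookup_eq_zero)
  finally show ?thesis .
qed

lemma hom_part_add: "hom_part d (f + g) = hom_part d f + hom_part d g"
  by (rule poly_mapping_eqI) (simp add: lookup_hom_part lookup_add)

lemma hom_part_zero [simp]: "hom_part d 0 = 0"
  by (simp add: hom_part_def)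

lemma hom_part_sum: "hom_part d (\<Sum>x\<in>A. f x) = (\<Sum>x\<in>A. hom_part d (f x))"
  by (induction A rule: infinite_finite_induct) (simp_all add: hom_part_add)

lemma hom_part_single_mult:
  fixes f :: "'n::finite monomial \<Rightarrow>\<^sub>0 'k::comm_ring_1"
  shows "hom_part d (Poly_Mapping.single s a * f) =
    (if total_degree s \<le> d then Poly_Mapping.single s a * hom_part (d - total_degree s) f else 0)"
proof (rule poly_mapping_eqI)
  fix k
  show "Poly_Mapping.lookup (hom_part d (Poly_Mapping.single s a * f)) k = Poly_Mapping.lookup
    (if total_degree s \<le> d then Poly_Mapping.single s a * hom_part (d - total_degree s) f else 0) k"
  proof (cases "\<exists>t. k = s + t")
    case True
    then obtain t where "k = s + t" by blast
    then show ?thesis by (auto simp: lookup_hom_part lookup_single_mult)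
  next
    case False
    then have z: "Poly_Mapping.lookup (Poly_Mapping.single s a * g) k = 0" for g :: "'n monomial \<Rightarrow>\<^sub>0 'k"
      using keys_single_mult[of s a g] by (auto simp: not_in_keys_iff_lookup_eq_zero[symmetric])
    then show ?thesis by (simp add: lookup_hom_part)
  qed
qed

text \<open>\<open>M\<close> is a monomial ideal and \<open>L\<close> is generated by linear forms.
  Gradedness is wanted because neither the monomial order nor the Groebner basis has to respect
  degrees.\<close>

lemma hom_part_ML:
  fixes c :: "real ^ 'n::finite edge"
  assumes simp: "simple_polytrope c" and ne: "vertex_bases c \<noteq> {}" and f: "f \<in> M_ideal c + L_ideal"
  shows "hom_part d f \<in> M_ideal c + L_ideal"
proof -
  obtain g h where gh: "f = g + h" "g \<in> M_ideal c" "h \<in> L_ideal" using f by (auto simp: set_plus_def)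
  have "hom_part d g \<in> M_ideal c"
    using gh(2) unfolding M_ideal_iff[OF simp ne]
    by (auto simp: in_keys_iff lookup_hom_part split: if_splits)
  moreover have "hom_part d h \<in> L_ideal"
  proof -
    let ?T = "{h :: 'n ring. \<forall>d. hom_part d h \<in> L_ideal}"
    have "module.subspace (*) ?T"
    proof (rule ring_module.subspaceI)
      show "0 \<in> ?T" by (simp add: ring_module.subspace_0[OF subspace_L_ideal])
      show "x + y \<in> ?T" if "x \<in> ?T" "y \<in> ?T" for x y
        using that by (auto simp: hom_part_add intro: ring_module.subspace_add[OF subspace_L_ideal])
      show "r * x \<in> ?T" if x: "x \<in> ?T" for r x
      proof (intro CollectI allI)
        fix d
        have "r * x = (\<Sum>s\<in>Poly_Mapping.keys r. Poly_Mapping.single s (Poly_Mapping.lookup r s) * x)"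
          by (subst poly_mapping_sum_single[of r]) (simp add: sum_distrib_right)
        then have "hom_part d (r * x) = (\<Sum>s\<in>Poly_Mapping.keys r. hom_part d (Poly_Mapping.single s (Poly_Mapping.lookup r s) * x))"
          by (simp only: hom_part_sum)
        also have "\<dots> \<in> L_ideal"
        proof (rule ring_module.subspace_sum[OF subspace_L_ideal])
          fix s
          show "hom_part d (Poly_Mapping.single s (Poly_Mapping.lookup r s) * x) \<in> L_ideal"
            unfolding hom_part_single_mult
            using x by (auto intro: ring_module.subspace_0[OF subspace_L_ideal]
                ring_module.subspace_scale[OF subspace_L_ideal])
        qed
        finally show "hom_part d (r * x) \<in> L_ideal" .
      qed
    qed
    moreover have "(\<Sum>e | src e = k. x_var e) - (\<Sum>e | tgt e = k. x_var e) \<in> ?T" for k :: "'n option"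
    proof (intro CollectI allI)
      fix d
      let ?g = "(\<Sum>e | src e = k. x_var e) - (\<Sum>e | tgt e = k. x_var e) :: 'n ring"
      have "Poly_Mapping.lookup ?g m = 0" if "total_degree m \<noteq> 1" for m
      proof -
        have "Poly_Mapping.lookup (x_var e :: 'n ring) m = 0" for e
          using that by (auto simp: x_var_def lookup_single when_def)
        then show ?thesis by (simp add: lookup_minus lookup_sum)
      qed
      then have "hom_part d ?g = (if d = 1 then ?g else 0)"
        by (intro poly_mapping_eqI) (auto simp: lookup_hom_part)
      moreover have "?g \<in> L_ideal" unfolding L_ideal_def by (rule ring_module.span_base) blast
      ultimately show "hom_part d ?g \<in> L_ideal"
        by (simp add: ring_module.subspace_0[OF subspace_L_ideal])
    qed
    ultimately have "L_ideal \<subseteq> ?T" unfolding L_ideal_def by (intro ring_module.span_minimal) auto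
    then show ?thesis using gh(3) by blast
  qed
  ultimately show ?thesis unfolding gh(1) hom_part_add by (rule set_plus_intro)
qed

section \<open>The degree functional over the weight field\<close>

definition const_field :: "rat \<Rightarrow> 'n::finite weight_field" where
  "const_field r = Fract (Poly_Mapping.single 0 r) 1"

lemma const_field_simps [simp]:
  "const_field 0 = 0" "const_field 1 = 1"
  "const_field (a + b) = const_field a + const_field b"
  "const_field (a - b) = const_field a - const_field b"
  by (simp_all add: const_field_def single_one single_add single_diff Zero_fract_def One_fract_def)

lemma const_field_sum: "const_field (\<Sum>x\<in>A. f x) = (\<Sum>x\<in>A. const_field (f x))"
  by (induction A rule: infinite_finite_induct) simp_all

lemma Fract_add_one: "Fract (a + b) 1 = Fract a 1 + Fract b 1"
  and Fract_mult_one: "Fract (a * b) 1 = Fract a 1 * Fract b 1"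
  by simp_all

lemma Fract_sum: "Fract (\<Sum>x\<in>A. f x) 1 = (\<Sum>x\<in>A. Fract (f x) 1)"
  by (induction A rule: infinite_finite_induct)
    (simp_all only: sum.infinite sum.empty sum.insert not_False_eq_True Fract_add_one Zero_fract_def)

lemma Fract_prod: "Fract (\<Prod>x\<in>A. f x) 1 = (\<Prod>x\<in>A. Fract (f x) 1)"
  by (induction A rule: infinite_finite_induct)
    (simp_all only: prod.infinite prod.empty prod.insert not_False_eq_True Fract_mult_one One_fract_def)

text \<open>The cut-off outside degree \<open>n - 1\<close> makes the functional total on the ring,
  and multiples of the generators of \<open>L\<close> need a check in this one degree only.\<close>

definition degree_coeff :: "('n::finite monomial \<Rightarrow> rat) \<Rightarrow> 'n monomial \<Rightarrow> 'n weight_field" where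
  "degree_coeff r m = (if total_degree m = CARD('n) then const_field (r m) else 0)"

lemma degree_functional_zero:
  fixes c :: "real ^ 'n::finite edge"
  assumes reg: "c \<in> polytrope_region" and max: "maximal_polytrope c" and gen: "generic c \<xi>"
    and r: "\<And>m. of_rat (r m) = localized c \<xi> m" and f: "f \<in> M_ideal c + L_ideal"
  shows "lin (degree_coeff r) f = 0"
proof -
  note simp = maximal_polytropeD(1)[OF max] and ne = maximal_polytropeD(2)[OF max]
  obtain g h where gh: "f = g + h" "g \<in> M_ideal c" "h \<in> L_ideal" using f by (auto simp: set_plus_def)
  have "lin (degree_coeff r) g = 0"
    unfolding lin_def
  proof (rule sum.neutral, rule ballI)
    fix m assume "m \<in> Poly_Mapping.keys g"
    then have "\<not> is_face c m" using gh(2) by (simp add: M_ideal_iff[OF simp ne])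
    then have "localized c \<xi> m = 0" by (intro localized_eq_zero) (auto simp: is_face_def)
    then have "r m = 0" using r[of m] by simp
    then show "Poly_Mapping.lookup g m * degree_coeff r m = 0" by (simp add: degree_coeff_def)
  qed
  moreover have "lin (degree_coeff r) h = 0"
    using _ gh(3) unfolding L_ideal_def
  proof (rule lin_ideal_zero)
    fix g :: "'n ring" and s
    assume "g \<in> range (\<lambda>k. (\<Sum>e | src e = k. x_var e) - (\<Sum>e | tgt e = k. x_var e))"
    then obtain k where g: "g = (\<Sum>e | src e = k. x_var e) - (\<Sum>e | tgt e = k. x_var e)" by blast
    let ?r = "\<lambda>e. r (s + Poly_Mapping.single e 1)"
    have eq: "lin (\<lambda>m. degree_coeff r (s + m)) g =
      (\<Sum>e | src e = k. degree_coeff r (s + Poly_Mapping.single e 1)) -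
      (\<Sum>e | tgt e = k. degree_coeff r (s + Poly_Mapping.single e 1))"
      by (simp add: g lin_diff lin_sum x_var_def)
    show "lin (\<lambda>m. degree_coeff r (s + m)) g = 0"
    proof (cases "total_degree s + 1 = CARD('n)")
      case True
      \<comment> \<open>The relation is verified in the reals, pulled back to the rationals by
        injectivity, and then sent to the weight field.\<close>
      have "real_of_rat ((\<Sum>e | src e = k. ?r e) - (\<Sum>e | tgt e = k. ?r e)) =
        (\<Sum>e\<in>UNIV. if src e = k then localized c \<xi> (s + Poly_Mapping.single e 1) else 0) -
        (\<Sum>e\<in>UNIV. if tgt e = k then localized c \<xi> (s + Poly_Mapping.single e 1) else 0)"
        by (simp add: of_rat_diff of_rat_sum r sum.If_cases)
      also have "\<dots> = (\<Sum>e\<in>UNIV. (edge_vec e \<bullet> node_vec k) * localized c \<xi> (s + Poly_Mapping.single e 1))"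
        unfolding sum_subtractf[symmetric]
        by (intro sum.cong) (auto simp: edge_vec_inner_node_vec)
      also have "\<dots> = 0"
        by (rule localized_linear_relation[OF reg max gen]) (use True in simp)
      finally have "(\<Sum>e | src e = k. ?r e) - (\<Sum>e | tgt e = k. ?r e) = 0" by simp
      then have "const_field ((\<Sum>e | src e = k. ?r e) - (\<Sum>e | tgt e = k. ?r e)) = (0 :: 'n weight_field)"
        by (simp only: const_field_simps)
      then show ?thesis unfolding eq using True by (simp add: degree_coeff_def const_field_sum)
    next
      case False
      then show ?thesis unfolding eq by (simp add: degree_coeff_def)
    qed
  qed
  ultimately show ?thesis by (simp add: gh(1) lin_add)
qed

lemma Fract_word:
  "Fract (Poly_Mapping.single (word_mono k w) r) 1 = (\<Prod>i<k. a_var (w i)) * const_field r"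
proof -
  have x: "(\<Prod>i<k. x_var (w i)) = (Poly_Mapping.single (word_mono k w) 1 :: 'a weight_poly)"
    unfolding word_mono_def by (induction k) (simp_all add: x_var_def mult_single)
  have "Poly_Mapping.single (word_mono k w) r = (\<Prod>i<k. x_var (w i)) * Poly_Mapping.single 0 r"
    unfolding x by (simp add: mult_single)
  then show ?thesis by (simp only: Fract_mult_one Fract_prod const_field_def a_var_def)
qed

lemma q_poly_power:
  "(q_poly :: 'n::finite ring) ^ k = (\<Sum>w\<in>words k. Poly_Mapping.single (word_mono k w) (\<Prod>i<k. a_var (w i)))"
proof -
  have q: "(q_poly :: 'n ring) = (\<Sum>e\<in>UNIV. Poly_Mapping.single (Poly_Mapping.single e 1) (a_var e))"
    by (simp add: q_poly_def x_var_def mult_single)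
  have "(\<Prod>i<k. Poly_Mapping.single (Poly_Mapping.single (w i) 1) (a_var (w i)) :: 'n ring) =
     Poly_Mapping.single (word_mono k w) (\<Prod>i<k. a_var (w i))" for w :: "nat \<Rightarrow> 'n edge"
    unfolding word_mono_def by (induction k) (simp_all add: mult_single)
  then show ?thesis unfolding q power_sum_words mono_eval_word_mono by simp
qed

lemma degree_functional_q_power:
  "lin (degree_coeff r) ((q_poly :: 'n::finite ring) ^ CARD('n)) =
    Fract (\<Sum>w\<in>words CARD('n). Poly_Mapping.single (word_mono CARD('n) w) (r (word_mono CARD('n) w))) 1"
  by (simp add: q_poly_power lin_sum Fract_sum Fract_word degree_coeff_def total_degree_word_mono)

theorem theorem3p5:
  fixes c :: "real ^ 'n::finite edge"
    and le :: "'n monomial \<Rightarrow> 'n monomial \<Rightarrow> bool"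
    and G :: "'n ring set"
    and v :: "real ^ 'n"
  assumes "c \<in> polytrope_region"
    and "maximal_polytrope c"
    and "monomial_order le"
    and "groebner_basis le (M_ideal c + L_ideal) G"
    and "v extreme_point_of polytrope c"
  shows "(\<exists>!V. is_volume_polynomial c V) \<and>
    (\<forall>d. algorithm_output c le G v (q_poly ^ CARD('n)) d \<longleftrightarrow> d = Fract (volume_polynomial c) 1)"
proof -
  interpret monom_order le by standard (rule assms(3))
  note simp = maximal_polytropeD(1)[OF assms(2)] and ne = maximal_polytropeD(2)[OF assms(2)]
  let ?J = "M_ideal c + L_ideal" and ?B = "incident_facets c v"
  have B: "?B \<in> vertex_bases c" using assms(5) by (auto simp: vertex_bases_def)
  have cB: "card ?B = CARD('n)" using vertex_bases_basis[OF simp B] by (simp add: edge_basis_def)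
  obtain \<xi> where gen: "generic c \<xi>" and rat: "\<And>k. \<xi> $ k \<in> \<rat>"
    using exists_rational_generic[OF simp] by blast
  have "\<forall>m. \<exists>q. of_rat q = localized c \<xi> m"
    using localized_rational[OF simp rat] by (metis Rats_cases)
  then obtain r where r: "\<And>m. of_rat (r m) = localized c \<xi> m" by metis
  define V where "V = (\<Sum>w\<in>words CARD('n). Poly_Mapping.single (word_mono CARD('n) w) (r (word_mono CARD('n) w)))"
  have V: "is_volume_polynomial c V"
    unfolding V_def by (rule is_volume_polynomial_localized[OF assms(1,2) gen r])
  then have ex1: "\<exists>!V. is_volume_polynomial c V"
    using volume_polynomial_unique[OF assms(1,2)] by blast
  then have vol: "volume_polynomial c = V" unfolding volume_polynomial_def using V by (rule the1_equality)
  define \<Phi> where "\<Phi> = lin (degree_coeff r)"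
  have \<Phi>J: "\<Phi> f = \<Phi> g" if "f - g \<in> ?J" for f g
    using degree_functional_zero[OF assms(1,2) gen r that] by (simp add: \<Phi>_def lin_diff)
  have \<Phi>q: "\<Phi> (q_poly ^ CARD('n)) = Fract V 1"
    unfolding \<Phi>_def V_def by (rule degree_functional_q_power)
  have "real_of_rat (r (basis_mono ?B)) = 1" unfolding r by (rule localized_basis_mono[OF simp B gen])
  then have \<Phi>B: "\<Phi> (\<Prod>e\<in>?B. x_var e) = 1"
    by (simp add: \<Phi>_def prod_x_var degree_coeff_def cB)
  have nf: "\<Phi> h = \<Phi> f" "\<forall>m\<in>Poly_Mapping.keys h. standard_monomial le ?J m" if "normal_form le G f h" for f h
    using normal_form_props[OF subspace_ML assms(4) that] \<Phi>J[of f h] by auto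
  have out: "d = Fract V 1" if "algorithm_output c le G v (q_poly ^ CARD('n)) d" for d
  proof -
    obtain \<alpha> \<gamma> h where
      \<alpha>: "\<And>m. standard_monomial le ?J m \<and> total_degree m = CARD('n) \<longleftrightarrow> m = \<alpha>" and
      \<gamma>: "\<gamma> \<noteq> 0" "normal_form le G (\<Prod>e\<in>?B. x_var e) (Poly_Mapping.single \<alpha> \<gamma>)" and
      h: "normal_form le G (q_poly ^ CARD('n)) h" "d = Poly_Mapping.lookup h \<alpha> / \<gamma>"
      using \<open>algorithm_output c le G v (q_poly ^ CARD('n)) d\<close> unfolding algorithm_output_def by blast
    \<comment> \<open>The vertex monomial and its normal form have the same value 1, which
      determines the value at \<open>\<alpha>\<close>.\<close>
    have "\<gamma> * degree_coeff r \<alpha> = 1" using nf(1)[OF \<gamma>(2)] \<Phi>B by (simp add: \<Phi>_def)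
    then have \<alpha>\<gamma>: "degree_coeff r \<alpha> = 1 / \<gamma>" using \<gamma>(1) by (simp add: eq_divide_eq mult.commute)
    \<comment> \<open>The functional sees only terms of degree \<open>n - 1\<close>, and
      \<open>\<alpha>\<close> is the only standard monomial of that degree.\<close>
    have "\<Phi> h = (\<Sum>m\<in>Poly_Mapping.keys h. if m = \<alpha> then Poly_Mapping.lookup h \<alpha> * degree_coeff r \<alpha> else 0)"
      unfolding \<Phi>_def lin_def
    proof (rule sum.cong[OF refl])
      fix m assume "m \<in> Poly_Mapping.keys h"
      then have "m = \<alpha> \<or> degree_coeff r m = 0"
        using nf(2)[OF h(1)] \<alpha> by (auto simp: degree_coeff_def)
      then show "Poly_Mapping.lookup h m * degree_coeff r m =
        (if m = \<alpha> then Poly_Mapping.lookup h \<alpha> * degree_coeff r \<alpha> else 0)"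
        by auto
    qed
    also have "\<dots> = Poly_Mapping.lookup h \<alpha> * degree_coeff r \<alpha>"
      by (simp add: not_in_keys_iff_lookup_eq_zero)
    finally show ?thesis using nf(1)[OF h(1)] \<Phi>q h(2) \<alpha>\<gamma> by simp
  qed
  obtain h where h: "normal_form le G (\<Prod>e\<in>?B. x_var e) h" using normal_form_exists by blast
  \<comment> \<open>The algorithm does return a value: the functional is 1 on the vertex monomial,
    so its normal form has a term of degree \<open>n - 1\<close>.\<close>
  have "\<exists>\<alpha>\<in>Poly_Mapping.keys h. total_degree \<alpha> = CARD('n)"
  proof (rule ccontr)
    assume "\<not> ?thesis"
    then have "\<Phi> h = 0" unfolding \<Phi>_def lin_def by (intro sum.neutral) (auto simp: degree_coeff_def)
    then show False using nf(1)[OF h] \<Phi>B by simp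
  qed
  then obtain \<alpha> where \<alpha>: "\<alpha> \<in> Poly_Mapping.keys h" "total_degree \<alpha> = CARD('n)" by blast
  have \<alpha>std: "standard_monomial le ?J \<alpha>" using nf(2)[OF h] \<alpha>(1) by blast
  \<comment> \<open>Modulo \<open>?J\<close> both monomials are multiples of the vertex monomial,
    with factors \<open>a\<close> and \<open>b\<close>. The combination \<open>f\<close> lies in
    \<open>?J\<close> and has standard terms only, so it is 0. Then \<open>b\<close> is 0, which
    puts the standard monomial \<open>\<alpha>\<close> into \<open>?J\<close>.\<close>
  have uniq: "m = \<alpha>" if m: "standard_monomial le ?J m" "total_degree m = CARD('n)" for m
  proof (rule ccontr)
    assume "m \<noteq> \<alpha>"
    let ?b = "basis_mono ?B"
    obtain a b where ab: "Poly_Mapping.single m 1 - Poly_Mapping.single ?b a \<in> ?J"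
      "Poly_Mapping.single \<alpha> 1 - Poly_Mapping.single ?b b \<in> ?J"
      using top_degree_multiple[OF simp B m(2)] top_degree_multiple[OF simp B \<alpha>(2)] by blast
    define f :: "'n ring" where "f = Poly_Mapping.single m b - Poly_Mapping.single \<alpha> a"
    have "f = Poly_Mapping.single 0 b * (Poly_Mapping.single m 1 - Poly_Mapping.single ?b a) -
      Poly_Mapping.single 0 a * (Poly_Mapping.single \<alpha> 1 - Poly_Mapping.single ?b b)"
      by (simp add: f_def right_diff_distrib mult_single mult.commute)
    also have "\<dots> \<in> ?J"
      by (intro ring_module.subspace_diff[OF subspace_ML] ring_module.subspace_scale[OF subspace_ML] ab)
    finally have "f \<in> ?J" .
    moreover have "standard_monomial le ?J k" if "k \<in> Poly_Mapping.keys f" for k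
      using that keys_diff[of "Poly_Mapping.single m b" "Poly_Mapping.single \<alpha> a"] m(1) \<alpha>std
      by (auto simp: f_def split: if_splits)
    ultimately have f0: "f = 0" using standard_in_ideal_zero[OF subspace_ML] by blast
    have "b = Poly_Mapping.lookup f m" using \<open>m \<noteq> \<alpha>\<close> by (simp add: f_def lookup_minus lookup_single)
    then have "Poly_Mapping.single \<alpha> 1 \<in> ?J" using ab(2) f0 by simp
    then have "(Poly_Mapping.single \<alpha> 1 :: 'n ring) = 0"
      by (rule standard_in_ideal_zero[OF subspace_ML]) (use \<alpha>std in \<open>simp split: if_splits\<close>)
    then show False by (metis lookup_single_eq lookup_zero zero_neq_one)
  qed
  \<comment> \<open>In any other degree the vertex monomial has no part, so the corresponding part
    of \<open>h\<close> lies in \<open>?J\<close>; consisting of standard monomials, it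
    vanishes.\<close>
  have "total_degree m = CARD('n)" if m: "m \<in> Poly_Mapping.keys h" for m
  proof (rule ccontr)
    assume d: "total_degree m \<noteq> CARD('n)"
    let ?d = "total_degree m"
    have "hom_part ?d ((\<Prod>e\<in>?B. x_var e) - h) = - hom_part ?d h"
      using d by (intro poly_mapping_eqI) (auto simp: lookup_hom_part lookup_minus prod_x_var lookup_single when_def cB)
    moreover have "hom_part ?d ((\<Prod>e\<in>?B. x_var e) - h) \<in> ?J"
      by (intro hom_part_ML[OF simp ne] normal_form_props(1)[OF subspace_ML assms(4) h])
    ultimately have "hom_part ?d h \<in> ?J" using ring_module.subspace_neg[OF subspace_ML] by fastforce
    moreover have "standard_monomial le ?J k" if "k \<in> Poly_Mapping.keys (hom_part ?d h)" for k
      using that nf(2)[OF h] by (auto simp: in_keys_iff lookup_hom_part split: if_splits)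
    ultimately have "hom_part ?d h = 0" using standard_in_ideal_zero[OF subspace_ML] by blast
    then have "Poly_Mapping.lookup h m = 0" using lookup_hom_part[of ?d h m] by simp
    then show False using m by (simp add: in_keys_iff)
  qed
  then have keys: "Poly_Mapping.keys h \<subseteq> {\<alpha>}" using uniq nf(2)[OF h] by blast
  define \<gamma> where "\<gamma> = Poly_Mapping.lookup h \<alpha>"
  have hs: "h = Poly_Mapping.single \<alpha> \<gamma>"
  proof (rule poly_mapping_eqI)
    fix k show "Poly_Mapping.lookup h k = Poly_Mapping.lookup (Poly_Mapping.single \<alpha> \<gamma>) k"
      using keys by (cases "k = \<alpha>") (auto simp: \<gamma>_def lookup_single not_in_keys_iff_lookup_eq_zero[symmetric])
  qed
  have \<gamma>: "\<gamma> \<noteq> 0" using \<alpha>(1) by (simp add: \<gamma>_def in_keys_iff)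
  obtain p where p: "normal_form le G (q_poly ^ CARD('n)) p" using normal_form_exists by blast
  have "algorithm_output c le G v (q_poly ^ CARD('n)) (Poly_Mapping.lookup p \<alpha> / \<gamma>)"
    unfolding algorithm_output_def
  proof (intro conjI exI allI)
    show "standard_monomial le ?J m \<and> total_degree m = CARD('n) \<longleftrightarrow> m = \<alpha>" for m
      using uniq \<alpha>std \<alpha>(2) by blast
    show "normal_form le G (\<Prod>e\<in>?B. x_var e) (Poly_Mapping.single \<alpha> \<gamma>)" using h hs by simp
  qed (use assms(4,5) minimal_prime_vertex[OF simp B] \<gamma> p in auto)
  then show ?thesis using ex1 vol out by metis
qed

end
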